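(* Let $\sigma>1$ and \[B\ge\frac{1}{(1-q^{-\sigma})(1-q^{1-\sigma})^2}.\] Then $(q,s,B)$ does not satisfy the Northcott property, i.e. the set $S_{q,s,B}=\{[K]:|\zeta_K^*(s)|\le B\}$ is infinite.
   Context: $s=\sigma+i\tau$ with $\sigma=\operatorname{Re}(s)$. $K$ ranges over isomorphism classes $[K]$ of global function fields in one variable with constant field $\mathbb F_q$; $\zeta_K^*(s)$ is the first nonzero Taylor coefficient of the zeta function $\zeta_K$ at $s$ (equal to $\zeta_K(s)$ for $\sigma>1$). *)

theory Defs
  imports
    "HOL-Complex_Analysis.Complex_Analysis"
    "HOL-Algebra.Algebra"
    "HOL-Number_Theory.Prime_Powers"
begin

text \<open>
  Global function fields in one variable whose (full) constant field has \<open>q\<close> elements.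
  For \<open>q > 0\<close> the condition \<open>card k = q\<close> includes finiteness of \<open>k\<close>; the subfield \<open>k\<close> is then
  uniquely determined by \<open>K\<close>, being the set of all elements of \<open>K\<close> algebraic over the prime field.
\<close>

definition function_field :: "nat \<Rightarrow> ('a, 'b) ring_scheme \<Rightarrow> bool" where
  "function_field q K \<longleftrightarrow> field K \<and>
     (\<exists>k. subfield k K \<and> card k = q \<and>
        (\<forall>y\<in>carrier K. ring.algebraic K k y \<longrightarrow> y \<in> k) \<and>
        (\<exists>x\<in>carrier K. ring.transcendental K k x \<and>
           ring.finite_dimension K (generate_field K (insert x k)) (carrier K)))"

text \<open>
  A place is represented by its valuation ring. Valuation rings of \<open>K\<close> contain all roots of
  unity, hence the constant field, so this need not be required separately; and the constant
  field of a function field is never itself a valuation ring.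
\<close>

definition places :: "('a, 'b) ring_scheme \<Rightarrow> 'a set set" where
  "places K = {V. subring V K \<and> V \<noteq> carrier K \<and>
     (\<forall>z\<in>carrier K - {\<zero>\<^bsub>K\<^esub>}. z \<in> V \<or> inv\<^bsub>K\<^esub> z \<in> V)}"

definition place_ideal :: "('a, 'b) ring_scheme \<Rightarrow> 'a set \<Rightarrow> 'a set" where
  "place_ideal K V = {z\<in>V. z = \<zero>\<^bsub>K\<^esub> \<or> inv\<^bsub>K\<^esub> z \<notin> V}"

definition place_norm :: "('a, 'b) ring_scheme \<Rightarrow> 'a set \<Rightarrow> nat" where
  "place_norm K V = card (carrier ((K\<lparr>carrier := V\<rparr>) Quot (place_ideal K V)))"

text \<open>
  The Euler product, as an unconditional product over the set of all places: the limit of the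
  finite subproducts along the directed set of finite sets of places.
\<close>

definition euler_product :: "('a, 'b) ring_scheme \<Rightarrow> complex \<Rightarrow> complex" where
  "euler_product K s =
     Lim (finite_subsets_at_top (places K))
       (\<lambda>F. \<Prod>V\<in>F. inverse (1 - of_nat (place_norm K V) powr (- s)))"

text \<open>
  Outside the half-plane \<open>Re s > 1\<close> the zeta function is the meromorphic continuation of the
  Euler product (with the value 0 at poles, the convention of \<open>nicely_meromorphic_on\<close>).
\<close>

definition zeta :: "('a, 'b) ring_scheme \<Rightarrow> complex \<Rightarrow> complex" where
  "zeta K s =
     (if Re s > 1 then euler_product K s
      else (THE f. f nicely_meromorphic_on UNIV \<and>
                   (\<forall>w. Re w > 1 \<longrightarrow> f w = euler_product K w)) s)"

text \<open>
  The first nonzero coefficient of the expansion of the zeta function at \<open>s\<close>. Using the Laurent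
  expansion also covers the poles; where the zeta function is holomorphic, as for \<open>Re s > 1\<close>,
  this is the Taylor expansion.
\<close>

definition zeta_star :: "('a, 'b) ring_scheme \<Rightarrow> complex \<Rightarrow> complex" where
  "zeta_star K s =
     (let L = laurent_expansion (zeta K) s in fls_nth L (fls_subdegree L))"

text \<open>
  Function fields over a finite field are countably infinite, so every isomorphism class has
  representatives whose carrier is a set of natural numbers; the isomorphism classes are formed
  among these. Isomorphisms are isomorphisms of fields; they map constant field onto constant
  field, but need not respect a chosen identification of it with a fixed model of the field with
  \<open>q\<close> elements.
\<close>

definition function_fields :: "nat \<Rightarrow> nat ring set" where
  "function_fields q = {K. function_field q K}"

definition iso_class :: "nat \<Rightarrow> nat ring \<Rightarrow> nat ring set" where
  "iso_class q K = {K' \<in> function_fields q. K \<simeq> K'}"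

definition northcott_set :: "nat \<Rightarrow> complex \<Rightarrow> real \<Rightarrow> nat ring set set" where
  "northcott_set q s B = {iso_class q K | K. K \<in> function_fields q \<and> cmod (zeta_star K s) \<le> B}"

definition northcott_property :: "nat \<Rightarrow> complex \<Rightarrow> real \<Rightarrow> bool" where
  "northcott_property q s B \<longleftrightarrow> finite (northcott_set q s B)"

end

theory Submission
  imports
    Defs
    "HOL-Algebra.Algebraic_Closure_Type"
    "Berlekamp_Zassenhaus.Finite_Field"
begin

text \<open>
  If \<open>K\<close> is a separable quadratic extension of \<open>k(x)\<close>, then at most two places lie above each
  place of \<open>k(x)\<close>; if moreover \<open>K\<close> is ramified at infinity, just one place lies above infinity.
  Comparing Euler products factor by factor bounds \<open>|\<zeta>\<^sub>K(s)|\<close> by the Euler factor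
  \<open>(1 - q\<^bsup>-\<sigma>\<^esup>)\<^bsup>-1\<^esup>\<close> at infinity times the square of
  \<open>\<Prod>\<^sub>P (1 - |P|\<^bsup>-\<sigma>\<^esup>)\<^bsup>-1\<^esup> = (1 - q\<^bsup>1-\<sigma>\<^esup>)\<^bsup>-1\<^esup>\<close>,
  which is the given bound.

  Such extensions are given by \<open>y\<^sup>2 = P y + f\<close> with \<open>deg f\<close> odd and larger than \<open>2 deg P\<close>, in all
  characteristics. Let \<open>P\<close> be a prime of odd degree greater than \<open>n\<close>. By the Chinese remainder theorem \<open>f\<close>
  can be chosen so that the equation is Eisenstein at \<open>P\<close> and all other primes of degree at
  most \<open>n\<close> are inert. Then \<open>K\<close> has a place of degree \<open>deg P\<close>, but no place of odd degree \<open>d\<close> with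
  \<open>1 < d \<le> n\<close>. The least odd degree greater than 1 of a place of \<open>K\<close> is therefore an unbounded isomorphism
  invariant of this family.
\<close>

hide_const (open) Divisibility.prime Divisibility.irreducible Polynomials.degree Polynomials.lead_coeff

section \<open>Valuation rings and quadratic extensions\<close>

text \<open>Places are defined as valuation rings, so the argument stays with these: subfields and
  valuation rings are sets in one ambient field, and a place of \<open>K\<close> lies over its
  intersection with \<open>F\<close>. Places over the same ring are told apart by elements congruent
  to 0 or 1 at each of them; this yields the bound two. The linear coefficient of the equation is
  the prime \<open>P\<close> itself. It vanishes modulo \<open>P\<close>, as an Eisenstein equation
  requires, and is nonzero modulo every other prime, which is what makes inert residues available in
  every characteristic, including 2. Places over inert primes have even degree; hence the interest
  in odd degrees. Degree 1 is left out because the infinite place always has it. The ramified place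
  at infinity serves twice: it contributes a single Euler factor, and, its residue field consisting
  of the constants, it keeps the constant field of \<open>K\<close> from growing. Norms are
  cardinalities, so an infinite residue field would have norm 0 and Euler factor 1. Lower bounds for
  norms therefore carry the alternative 0, which is harmless for upper bounds of the
  product.\<close>

definition subfield_set :: "'o::field set \<Rightarrow> bool" where
  "subfield_set F \<longleftrightarrow> 1 \<in> F \<and> (\<forall>a\<in>F. \<forall>b\<in>F. a - b \<in> F \<and> a * b \<in> F) \<and> (\<forall>a\<in>F. inverse a \<in> F)"

text \<open>The whole of \<open>F\<close> satisfies this; properness is demanded separately where
  places are meant. Since \<open>inverse 0 = 0\<close>, zero makes no exception in the last
  clause.\<close>

definition valuation_ring :: "'o::field set \<Rightarrow> 'o set \<Rightarrow> bool" where
  "valuation_ring F V \<longleftrightarrow> V \<subseteq> F \<and> 1 \<in> V \<and> (\<forall>a\<in>V. \<forall>b\<in>V. a - b \<in> V \<and> a * b \<in> V) \<and>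
     (\<forall>a\<in>F. a \<in> V \<or> inverse a \<in> V)"

definition max_ideal :: "'o::field set \<Rightarrow> 'o set" where
  "max_ideal V = {a \<in> V. a = 0 \<or> inverse a \<notin> V}"

lemma subfield_setD:
  assumes "subfield_set F"
  shows "1 \<in> F" "0 \<in> F"
    and "a \<in> F \<Longrightarrow> b \<in> F \<Longrightarrow> a - b \<in> F" "a \<in> F \<Longrightarrow> b \<in> F \<Longrightarrow> a * b \<in> F"
    and "a \<in> F \<Longrightarrow> b \<in> F \<Longrightarrow> a + b \<in> F" "a \<in> F \<Longrightarrow> - a \<in> F"
    and "a \<in> F \<Longrightarrow> inverse a \<in> F" "a \<in> F \<Longrightarrow> b \<in> F \<Longrightarrow> a / b \<in> F"
    and "a \<in> F \<Longrightarrow> a ^ n \<in> F"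
proof -
  show one: "1 \<in> F" and diff: "\<And>a b. a \<in> F \<Longrightarrow> b \<in> F \<Longrightarrow> a - b \<in> F"
    and mult: "\<And>a b. a \<in> F \<Longrightarrow> b \<in> F \<Longrightarrow> a * b \<in> F"
    and inv: "\<And>a. a \<in> F \<Longrightarrow> inverse a \<in> F"
    using assms by (auto simp: subfield_set_def)
  show zero: "0 \<in> F"
    using diff[OF one one] by simp
  show neg: "- a \<in> F" if "a \<in> F" for a
    using diff[OF zero that] by simp
  show "a + b \<in> F" if "a \<in> F" "b \<in> F" for a b
    using diff[OF that(1) neg[OF that(2)]] by simp
  show "a / b \<in> F" if "a \<in> F" "b \<in> F" for a b
    using mult[OF that(1) inv[OF that(2)]] by (simp add: divide_inverse)
  show "a ^ n \<in> F" if "a \<in> F" for a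
    by (induction n) (auto intro: one mult that)
qed

lemma valuation_ringD:
  assumes "valuation_ring F V"
  shows "1 \<in> V" "0 \<in> V"
    and "a \<in> V \<Longrightarrow> b \<in> V \<Longrightarrow> a - b \<in> V" "a \<in> V \<Longrightarrow> b \<in> V \<Longrightarrow> a * b \<in> V"
    and "a \<in> V \<Longrightarrow> b \<in> V \<Longrightarrow> a + b \<in> V" "a \<in> V \<Longrightarrow> - a \<in> V"
    and "a \<in> V \<Longrightarrow> a \<in> F" "a \<in> F \<Longrightarrow> a \<notin> V \<Longrightarrow> inverse a \<in> V"
    and "a \<in> V \<Longrightarrow> a ^ n \<in> V"
proof -
  show one: "1 \<in> V" and diff: "\<And>a b. a \<in> V \<Longrightarrow> b \<in> V \<Longrightarrow> a - b \<in> V"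
    and mult: "\<And>a b. a \<in> V \<Longrightarrow> b \<in> V \<Longrightarrow> a * b \<in> V"
    and "a \<in> V \<Longrightarrow> a \<in> F" "a \<in> F \<Longrightarrow> a \<notin> V \<Longrightarrow> inverse a \<in> V"
    using assms by (auto simp: valuation_ring_def)
  show zero: "0 \<in> V"
    using diff[OF one one] by simp
  show neg: "- a \<in> V" if "a \<in> V" for a
    using diff[OF zero that] by simp
  show "a + b \<in> V" if "a \<in> V" "b \<in> V" for a b
    using diff[OF that(1) neg[OF that(2)]] by simp
  show "a ^ n \<in> V" if "a \<in> V" for a
    by (induction n) (auto intro: one mult that)
qed

lemma max_idealD: "a \<in> max_ideal V \<Longrightarrow> a \<in> V"
  by (simp add: max_ideal_def)

lemma max_ideal_inverse:
  assumes "valuation_ring F V" "a \<in> F" "a \<notin> V"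
  shows "inverse a \<in> max_ideal V"
  using valuation_ringD(8)[OF assms] assms(3) by (auto simp: max_ideal_def)

lemma unit_inverse: "a \<in> V \<Longrightarrow> a \<notin> max_ideal V \<Longrightarrow> inverse a \<in> V"
  by (auto simp: max_ideal_def)

lemma unit_nonzero: "a \<in> V \<Longrightarrow> a \<notin> max_ideal V \<Longrightarrow> a \<noteq> 0"
  by (auto simp: max_ideal_def)

context
  fixes F V :: "'o::field set"
  assumes V: "valuation_ring F V" and F: "subfield_set F"
begin

lemma one_notin_max_ideal: "1 \<notin> max_ideal V"
  using valuation_ringD(1)[OF V] by (auto simp: max_ideal_def)

lemma zero_in_max_ideal: "0 \<in> max_ideal V"
  using valuation_ringD(2)[OF V] by (auto simp: max_ideal_def)

lemma max_ideal_mult: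
  assumes "a \<in> max_ideal V" "b \<in> V"
  shows "a * b \<in> max_ideal V"
proof -
  have "inverse a \<in> V" if "a * b \<noteq> 0" "inverse (a * b) \<in> V"
    using valuation_ringD(4)[OF V that(2) assms(2)] that(1) by (simp add: mult.assoc)
  thus ?thesis
    using assms valuation_ringD(4)[OF V] by (auto simp: max_ideal_def)
qed

lemma max_ideal_mult': "a \<in> V \<Longrightarrow> b \<in> max_ideal V \<Longrightarrow> a * b \<in> max_ideal V"
  using max_ideal_mult[of b a] by (simp add: mult.commute)

lemma max_ideal_uminus: "a \<in> max_ideal V \<Longrightarrow> - a \<in> max_ideal V"
  using max_ideal_mult[of a "-1"] valuation_ringD(1,6)[OF V] by simp

text \<open>One of \<open>b / a\<close> and \<open>a / b\<close> lies in \<open>V\<close>; if it is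
  \<open>b / a\<close>, then \<open>a + b = a * (1 + b / a)\<close> is a multiple of
  \<open>a\<close> in \<open>V\<close>.\<close>

lemma max_ideal_add:
  assumes a: "a \<in> max_ideal V" and b: "b \<in> max_ideal V"
  shows "a + b \<in> max_ideal V"
proof (cases "a = 0 \<or> b = 0")
  case True
  thus ?thesis using assms by auto
next
  case False
  have *: "u + v \<in> max_ideal V"
    if "u \<in> max_ideal V" "v \<in> max_ideal V" "u \<noteq> 0" "v / u \<in> V" for u v
    using max_ideal_mult[OF that(1) valuation_ringD(5)[OF V valuation_ringD(1)[OF V] that(4)]] that(3)
    by (simp add: algebra_simps)
  have "a \<in> F" "b \<in> F"
    using a b valuation_ringD(7)[OF V] by (auto dest: max_idealD)
  hence "b / a \<in> V \<or> a / b \<in> V"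
    using valuation_ringD(8)[OF V, of "b / a"] subfield_setD(8)[OF F] by auto
  thus ?thesis
    using *[of a b] *[of b a] a b False by (auto simp: add.commute)
qed

lemma max_ideal_diff: "a \<in> max_ideal V \<Longrightarrow> b \<in> max_ideal V \<Longrightarrow> a - b \<in> max_ideal V"
  using max_ideal_add[of a "- b"] max_ideal_uminus by simp

lemma max_ideal_prime:
  assumes "a \<in> V" "b \<in> V" "a * b \<in> max_ideal V"
  shows "a \<in> max_ideal V \<or> b \<in> max_ideal V"
proof (rule ccontr)
  assume *: "\<not> ?thesis"
  hence "inverse a * inverse b \<in> V"
    using assms unit_inverse valuation_ringD(4)[OF V] by blast
  hence "inverse (a * b) \<in> V" "a * b \<noteq> 0"
    using * unit_nonzero assms by (auto simp: mult.commute)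
  thus False using assms(3) by (auto simp: max_ideal_def)
qed

lemma unit_add:
  assumes "a \<in> V" "a \<notin> max_ideal V" "b \<in> max_ideal V"
  shows "a + b \<notin> max_ideal V"
  using max_ideal_diff[of "a + b" b] assms by auto

lemma one_diff_unit: "a \<in> max_ideal V \<Longrightarrow> 1 - a \<notin> max_ideal V"
  using max_ideal_add[of a "1 - a"] one_notin_max_ideal by auto

text \<open>Scaling by the inverse of whichever of the two elements has the larger pole.\<close>
lemma scale_into_valuation_ring:
  assumes "a \<in> F" "b \<in> F" "\<not> (a \<in> V \<and> b \<in> V)"
  obtains t where "t \<in> max_ideal V" "t \<noteq> 0" "t * a \<in> V" "t * b \<in> V" "t * a = 1 \<or> t * b = 1"
proof -
  note witness = that
  have *: thesis if uv: "u \<in> F" "u \<notin> V" "v * inverse u \<in> V" "(u = a \<and> v = b) \<or> (u = b \<and> v = a)" for u v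
  proof (rule witness[of "inverse u"])
    have "u \<noteq> 0" using uv(2) valuation_ringD(2)[OF V] by auto
    thus "inverse u * a = 1 \<or> inverse u * b = 1" "inverse u \<noteq> 0"
      using uv(4) by auto
    show "inverse u \<in> max_ideal V"
      using max_ideal_inverse[OF V uv(1,2)] .
    show "inverse u * a \<in> V" "inverse u * b \<in> V"
      using uv(3,4) \<open>u \<noteq> 0\<close> valuation_ringD(1)[OF V] by (auto simp: mult.commute)
  qed
  have q: "b * inverse a \<in> F" "inverse (b * inverse a) = a * inverse b"
    using assms subfield_setD[OF F] by auto
  show thesis
  proof (cases "a \<noteq> 0 \<and> b * inverse a \<in> V")
    case True
    have "b \<in> V" if "a \<in> V"
      using valuation_ringD(4)[OF V _ that, of "b * inverse a"] True by (simp add: mult.assoc)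
    hence "a \<notin> V" using assms(3) by auto
    thus thesis using *[of a b] assms True by auto
  next
    case False
    hence ab: "a * inverse b \<in> V"
      using valuation_ringD(8)[OF V q(1)] q(2) valuation_ringD(2)[OF V] by (auto simp: mult.commute)
    have "b \<noteq> 0" using False assms(3) valuation_ringD(2)[OF V] by auto
    have "b \<notin> V"
    proof
      assume "b \<in> V"
      hence "a \<in> V"
        using valuation_ringD(4)[OF V ab \<open>b \<in> V\<close>] \<open>b \<noteq> 0\<close> by (simp add: mult.assoc)
      thus False using assms(3) \<open>b \<in> V\<close> by simp
    qed
    thus thesis using *[of b a] assms ab by auto
  qed
qed

end

section \<open>Extending a valuation ring to a quadratic extension\<close>

locale quadratic_extension =
  fixes F K :: "'o::field set"
  assumes F: "subfield_set F" and K: "subfield_set K" and FK: "F \<subseteq> K"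
    and dim: "w \<in> K \<Longrightarrow> w \<notin> F \<Longrightarrow> z \<in> K \<Longrightarrow> \<exists>a\<in>F. \<exists>b\<in>F. z = a + b * w"
begin

text \<open>\<open>T\<close> and \<open>N\<close> are the trace and the norm of \<open>z\<close>.
  The assumption \<open>dim\<close> speaks of every generator \<open>w\<close> outside
  \<open>F\<close>, so it applies to \<open>z\<close> itself.\<close>

lemma minimal_equation:
  assumes "z \<in> K" "z \<notin> F"
  obtains T N where "T \<in> F" "N \<in> F" "z * z = T * z - N"
proof -
  obtain a b where "a \<in> F" "b \<in> F" "z * z = a + b * z"
    using dim[OF assms, of "z * z"] subfield_setD(4)[OF K] assms by blast
  thus thesis
    using that[of b "- a"] subfield_setD(6)[OF F] by (simp add: add.commute)
qed

lemma valuation_ring_Int: "valuation_ring K V \<Longrightarrow> valuation_ring F (V \<inter> F)"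
  using F FK by (auto simp: valuation_ring_def subfield_set_def)

lemma max_ideal_Int: "valuation_ring K V \<Longrightarrow> max_ideal (V \<inter> F) = max_ideal V \<inter> F"
  using subfield_setD(7)[OF F] by (auto simp: max_ideal_def)

text \<open>A pole of \<open>z\<close> is impossible: in \<open>z = T - N / z\<close> the right-hand
  side would then be integral.\<close>

lemma integral_in_valuation_ring:
  assumes V: "valuation_ring K V" and z: "z \<in> K" "T \<in> V" "N \<in> V" "z * z = T * z - N"
  shows "z \<in> V"
proof (rule ccontr)
  assume "z \<notin> V"
  hence u: "inverse z \<in> V" and "z \<noteq> 0"
    using valuation_ringD[OF V] z(1) by auto
  have "z = (z * z) * inverse z" using \<open>z \<noteq> 0\<close> by simp
  also have "\<dots> = T - N * inverse z"
    unfolding z(4) using \<open>z \<noteq> 0\<close> by (simp add: algebra_simps)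
  finally have "z = T - N * inverse z" .
  moreover have "T - N * inverse z \<in> V"
    using z u valuation_ringD[OF V] by metis
  ultimately show False using \<open>z \<notin> V\<close> by simp
qed

text \<open>
  If \<open>z\<close> lies in just one of the two rings, its trace \<open>T\<close> has a pole that dominates its norm;
  then \<open>z / T\<close> has trace 1 and a norm in the maximal ideal, so one of its conjugates vanishes
  at each place.
\<close>
lemma separating_element_aux:
  assumes V: "valuation_ring K V" "V \<inter> F = R" and V': "valuation_ring K V'" "V' \<inter> F = R"
    and z: "z \<in> V" "z \<notin> V'"
  obtains w where "w \<in> max_ideal V" "1 - w \<in> max_ideal V'"
    "\<And>U. valuation_ring K U \<Longrightarrow> U \<inter> F = R \<Longrightarrow> w \<in> U \<and> w * (1 - w) \<in> max_ideal U"
proof -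
  have zK: "z \<in> K" using valuation_ringD(7)[OF V(1) z(1)] .
  have zF: "z \<notin> F" using z V V' by auto
  have z0: "z \<noteq> 0" using z(2) valuation_ringD(2)[OF V'(1)] by auto
  obtain T N where TN: "T \<in> F" "N \<in> F" "z * z = T * z - N"
    using minimal_equation[OF zK zF] .
  have R: "valuation_ring F R" using valuation_ring_Int[OF V(1)] V(2) by simp
  have mR: "max_ideal R \<subseteq> max_ideal U" if "valuation_ring K U" "U \<inter> F = R" for U
    using max_ideal_Int[OF that(1)] that(2) by auto
  have nTN: "\<not> (T \<in> R \<and> N \<in> R)"
    using integral_in_valuation_ring[OF V'(1) zK, of T N] TN z(2) V'(2) by auto
  have q: "T * inverse N \<in> F" "N * inverse T \<in> F"
    using TN subfield_setD[OF F] by auto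
  have u: "inverse z \<in> max_ideal V'"
    using max_ideal_inverse[OF V'(1) zK z(2)] .
  show thesis
  proof (cases "T \<noteq> 0 \<and> N * inverse T \<in> R")
    case True
    have "T \<notin> R"
      using nTN True valuation_ringD(4)[OF R, of "N * inverse T" T] by (auto simp: mult.assoc)
    hence iT: "inverse T \<in> max_ideal R"
      using max_ideal_inverse[OF R TN(1)] by simp
    \<comment> \<open>\<open>T - z\<close> is the conjugate of \<open>z\<close> and equals
      \<open>N / z\<close>, so \<open>1 - z / T\<close> vanishes at \<open>V'\<close>, where
      \<open>z\<close> has its pole.\<close>
    have w1: "1 - z / T = (N * inverse T) * inverse z"
    proof -
      have "N = (T - z) * z" using TN(3) by (simp add: algebra_simps)
      hence "N * inverse T * inverse z = (T - z) * inverse T * (z * inverse z)"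
        by (simp only: mult_ac)
      hence "N * inverse T * inverse z = (T - z) * inverse T" using z0 by simp
      also have "\<dots> = 1 - z / T" using True by (simp add: left_diff_distrib divide_inverse)
      finally show ?thesis ..
    qed
    \<comment> \<open>The norm of \<open>z / T\<close> is \<open>N / T^2\<close>; it lies in the
      maximal ideal of \<open>R\<close>, hence in that of every \<open>U\<close> over
      \<open>R\<close>.\<close>
    have w2: "z / T * (1 - z / T) = (N * inverse T) * inverse T"
      unfolding w1 using z0 by (simp add: field_simps)
    show thesis
    proof (rule that[of "z / T"])
      show "z / T \<in> max_ideal V"
        using max_ideal_mult'[OF V(1) K z(1)] iT mR[OF V] by (auto simp: divide_inverse)
      show "1 - z / T \<in> max_ideal V'"
        unfolding w1 using max_ideal_mult'[OF V'(1) K _ u] True V'(2) by auto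
      show "z / T \<in> U \<and> z / T * (1 - z / T) \<in> max_ideal U"
        if U: "valuation_ring K U" "U \<inter> F = R" for U
      proof
        show w3: "z / T * (1 - z / T) \<in> max_ideal U"
          unfolding w2 using max_ideal_mult'[OF U(1) K] True U(2) mR[OF U] iT by auto
        show "z / T \<in> U"
          by (rule integral_in_valuation_ring[OF U(1), where T = 1 and N = "z / T * (1 - z / T)"])
             (use zK TN(1) FK subfield_setD(8)[OF K] valuation_ringD(1)[OF U(1)] max_idealD[OF w3]
               in \<open>auto simp: algebra_simps\<close>)
      qed
    qed
  next
    case False
    \<comment> \<open>Here the norm dominates the trace. Dividing \<open>N = T * z - z * z\<close>
      by \<open>N\<close> exhibits 1 as an element of the maximal ideal of \<open>V\<close>, so this
      case cannot occur.\<close>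
    have N: "N \<notin> R" and TiN: "T * inverse N \<in> max_ideal R"
    proof -
      have "T * inverse N \<in> max_ideal R \<and> N \<notin> R" if "T \<noteq> 0"
      proof -
        have *: "N * inverse T \<notin> R" using that False by simp
        hence "inverse (N * inverse T) \<in> max_ideal R"
          by (rule max_ideal_inverse[OF R q(2)])
        hence TN': "T * inverse N \<in> max_ideal R"
          by (simp add: mult.commute)
        have "N \<noteq> 0" using * valuation_ringD(2)[OF R] by auto
        have "T \<in> R" if "N \<in> R"
          using valuation_ringD(4)[OF R max_idealD[OF TN'] that] \<open>N \<noteq> 0\<close> by (simp add: mult.assoc)
        thus ?thesis using nTN TN' by auto
      qed
      moreover have "T * inverse N \<in> max_ideal R \<and> N \<notin> R" if "T = 0"
        using that nTN valuation_ringD(2)[OF R] zero_in_max_ideal[OF R F] by simp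
      ultimately show "N \<notin> R" "T * inverse N \<in> max_ideal R"
        by blast+
    qed
    have iN: "inverse N \<in> max_ideal R"
      using max_ideal_inverse[OF R TN(2) N] .
    have "N \<noteq> 0" using N valuation_ringD(2)[OF R] by auto
    hence "1 = (T * z - z * z) * inverse N"
      using TN(3) by simp
    also have "\<dots> = (T * inverse N) * z - (z * z) * inverse N"
      by (simp add: algebra_simps)
    also have "\<dots> \<in> max_ideal V"
    proof (rule max_ideal_diff[OF V(1) K])
      show "T * inverse N * z \<in> max_ideal V"
        using max_ideal_mult[OF V(1) K _ z(1)] mR[OF V] TiN by auto
      show "z * z * inverse N \<in> max_ideal V"
        using max_ideal_mult'[OF V(1) K valuation_ringD(4)[OF V(1) z(1) z(1)]] mR[OF V] iN by auto
    qed
    finally show thesis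
      using one_notin_max_ideal[OF V(1) K] by simp
  qed
qed

text \<open>A form of weak approximation: \<open>w\<close> is 0 at \<open>V\<close>, 1 at
  \<open>V'\<close>, and 0 or 1 at every further place over \<open>R\<close>. One of the two rings
  has an element outside the other; if only \<open>V'\<close> has one, \<open>1 - w\<close>
  serves.\<close>

lemma separating_element:
  assumes V: "valuation_ring K V" "V \<inter> F = R" and V': "valuation_ring K V'" "V' \<inter> F = R"
    and neq: "V \<noteq> V'"
  obtains w where "w \<in> max_ideal V" "1 - w \<in> max_ideal V'"
    "\<And>U. valuation_ring K U \<Longrightarrow> U \<inter> F = R \<Longrightarrow> w \<in> U \<and> w * (1 - w) \<in> max_ideal U"
proof -
  consider z where "z \<in> V" "z \<notin> V'" | z where "z \<in> V'" "z \<notin> V"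
    using neq by auto
  thus thesis
  proof cases
    case 1
    thus thesis using separating_element_aux[OF V V' 1] that by blast
  next
    case 2
    obtain w where w: "w \<in> max_ideal V'" "1 - w \<in> max_ideal V"
      "\<And>U. valuation_ring K U \<Longrightarrow> U \<inter> F = R \<Longrightarrow> w \<in> U \<and> w * (1 - w) \<in> max_ideal U"
      using separating_element_aux[OF V' V 2] by blast
    show thesis
    proof (rule that[of "1 - w"])
      show "1 - w \<in> U \<and> (1 - w) * (1 - (1 - w)) \<in> max_ideal U"
        if "valuation_ring K U" "U \<inter> F = R" for U
        using w(3)[OF that] valuation_ringD(1,3)[OF that(1)] by (auto simp: mult.commute)
    qed (use w in auto)
  qed
qed

text \<open>A separating \<open>w\<close> that is a unit of the smaller ring would be a unit of the
  larger one, although it lies in the maximal ideal there.\<close>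

lemma valuation_rings_incomparable:
  assumes V: "valuation_ring K V" "V \<inter> F = R" and V': "valuation_ring K V'" "V' \<inter> F = R"
    and sub: "V \<subseteq> V'"
  shows "V = V'"
proof (rule ccontr)
  assume "V \<noteq> V'"
  then obtain w where w: "w \<in> max_ideal V'" "1 - w \<in> max_ideal V" "w \<in> V"
    using separating_element[OF V' V] V by metis
  have "w \<notin> max_ideal V"
    using one_diff_unit[OF V(1) K w(2)] by simp
  hence "inverse w \<in> V'" "w \<noteq> 0"
    using unit_inverse[of w V] unit_nonzero[of w V] w sub by auto
  thus False using w(1) by (auto simp: max_ideal_def)
qed

text \<open>Write an element \<open>w'\<close> separating \<open>V1\<close> and \<open>V3\<close> as
  \<open>a + b * w\<close>. Both \<open>w\<close> and \<open>w'\<close> vanish at \<open>V1\<close>,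
  so for integral coefficients \<open>a\<close> vanishes there, hence in \<open>R\<close>, hence at
  \<open>V3\<close>; but then \<open>w'\<close> would vanish at \<open>V3\<close> too. At
  \<open>V2\<close> the element \<open>w\<close> is a unit, which keeps it out of \<open>F\<close>
  and rules out poles of \<open>a\<close> and \<open>b\<close>.\<close>

lemma at_most_two_aux:
  assumes V1: "valuation_ring K V1" "V1 \<inter> F = R" and V2: "valuation_ring K V2" "V2 \<inter> F = R"
    and V3: "valuation_ring K V3" "V3 \<inter> F = R"
    and w: "w \<in> max_ideal V1" "1 - w \<in> max_ideal V2" "w \<in> max_ideal V3"
  shows "V1 = V3"
proof (rule ccontr)
  assume "V1 \<noteq> V3"
  then obtain w' where w': "w' \<in> max_ideal V1" "1 - w' \<in> max_ideal V3" "w' \<in> V2"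
    using separating_element[OF V1 V3] V2 by metis
  have R: "valuation_ring F R" using valuation_ring_Int[OF V1(1)] V1(2) by simp
  have m1: "max_ideal V1 \<inter> F = max_ideal R" using max_ideal_Int[OF V1(1)] V1(2) by simp
  have m2: "max_ideal V2 \<inter> F = max_ideal R" using max_ideal_Int[OF V2(1)] V2(2) by simp
  have m3: "max_ideal V3 \<inter> F = max_ideal R" using max_ideal_Int[OF V3(1)] V3(2) by simp
  have w2: "w \<notin> max_ideal V2" using one_diff_unit[OF V2(1) K w(2)] by simp
  have w3: "w' \<notin> max_ideal V3" using one_diff_unit[OF V3(1) K w'(2)] by simp
  have wF: "w \<notin> F" using m1 m2 w(1) w2 by auto
  have V_K: "w \<in> K" "w' \<in> K"
    using w w' valuation_ringD(7)[OF V1(1)] by (auto dest: max_idealD)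
  obtain a b where ab: "a \<in> F" "b \<in> F" "w' = a + b * w"
    using dim[OF V_K(1) wF V_K(2)] by auto
  show False
  proof (cases "a \<in> R \<and> b \<in> R")
    case True
    have "w' - b * w \<in> max_ideal V1"
      using max_ideal_diff[OF V1(1) K w'(1)] max_ideal_mult'[OF V1(1) K _ w(1)] True V1(2) by auto
    hence "a \<in> max_ideal V3"
      using ab m1 m3 by auto
    hence "w' \<in> max_ideal V3"
      using max_ideal_add[OF V3(1) K] max_ideal_mult'[OF V3(1) K _ w(3)] True V3(2) ab by auto
    thus False using w3 by simp
  next
    case False
    \<comment> \<open>After scaling, the relation at \<open>V1\<close> puts \<open>t * a\<close>
      into the maximal ideal, so \<open>t * b = 1\<close>; at \<open>V2\<close> the same relation
      would then make \<open>w\<close> vanish.\<close>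
    obtain t where t: "t \<in> max_ideal R" "t * a \<in> R" "t * b \<in> R" "t * a = 1 \<or> t * b = 1"
      using scale_into_valuation_ring[OF R F ab(1,2) False] by metis
    have tV: "t \<in> max_ideal V1" "t \<in> max_ideal V2"
      using t(1) m1 m2 by auto
    have "t * w' - (t * b) * w \<in> max_ideal V1"
      using max_ideal_diff[OF V1(1) K] max_ideal_mult'[OF V1(1) K _ w(1)] t(3) V1(2)
        max_ideal_mult[OF V1(1) K tV(1) max_idealD[OF w'(1)]] by auto
    hence "t * a \<in> max_ideal V1"
      by (simp add: ab(3) algebra_simps)
    hence ta: "t * a \<in> max_ideal V2" "t * b = 1"
      using m1 m2 t valuation_ringD(7)[OF R] one_notin_max_ideal[OF V1(1) K] by auto
    have "t * w' - t * a \<in> max_ideal V2"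
      using max_ideal_diff[OF V2(1) K] max_ideal_mult[OF V2(1) K tV(2) w'(3)] ta by auto
    also have "t * w' - t * a = (t * b) * w"
      by (simp add: ab(3) algebra_simps)
    finally show False using w2 ta(2) by simp
  qed
qed

text \<open>An element separating \<open>V1\<close> and \<open>V2\<close> is 0 or 1 at
  \<open>V3\<close>; passing from \<open>w\<close> to \<open>1 - w\<close> exchanges
  \<open>V1\<close> and \<open>V2\<close>.\<close>

lemma at_most_two_extensions:
  assumes V1: "valuation_ring K V1" "V1 \<inter> F = R" and V2: "valuation_ring K V2" "V2 \<inter> F = R"
    and V3: "valuation_ring K V3" "V3 \<inter> F = R"
  shows "V1 = V2 \<or> V1 = V3 \<or> V2 = V3"
proof (rule ccontr)
  assume neq: "\<not> ?thesis"
  obtain w where w: "w \<in> max_ideal V1" "1 - w \<in> max_ideal V2"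
      "w \<in> V3 \<and> w * (1 - w) \<in> max_ideal V3"
    using separating_element[OF V1 V2] neq V3 by metis
  have "w \<in> max_ideal V3 \<or> 1 - w \<in> max_ideal V3"
    using max_ideal_prime[OF V3(1) K, of w "1 - w"] w valuation_ringD(1,3)[OF V3(1)] by auto
  thus False
    using at_most_two_aux[OF V1 V2 V3 w(1,2)] at_most_two_aux[OF V2 V1 V3, of "1 - w"] w neq by auto
qed

end

section \<open>Integral generators and inert places\<close>

locale quadratic_generator = quadratic_extension F K for F K :: "'o::field set" +
  fixes y h f :: 'o and R :: "'o set"
  assumes y: "y \<in> K" "y \<notin> F" and yy: "y * y = h * y + f"
    and R: "valuation_ring F R" and hf: "h \<in> R" "f \<in> R"
begin

lemma span: 
  assumes "z \<in> K" obtains a b where "a \<in> F" "b \<in> F" "z = a + b * y"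
  using dim[OF y assms] by blast

lemma integral_basis_in:
  assumes "valuation_ring K V" "V \<inter> F = R" "a \<in> R" "b \<in> R"
  shows "a + b * y \<in> V"
proof -
  have "y \<in> V"
    using integral_in_valuation_ring[OF assms(1) y(1), of h "- f"] yy hf assms(2)
      valuation_ringD(6)[OF assms(1)] by auto
  thus ?thesis
    using assms valuation_ringD(4,5)[OF assms(1)] by auto
qed

text \<open>If \<open>b\<close> were a unit, \<open>y\<close> would be congruent to
  \<open>c = - a / b\<close>. As \<open>h - y\<close> is the other root,
  \<open>c * c - h * c - f = (y - c) * (h - c - y)\<close>, and \<open>c\<close> would be a root in
  the residue field of \<open>R\<close>. So 1 and \<open>y\<close> stay independent over that
  residue field.\<close>

lemma residue_inert:
  assumes noroot: "\<And>c. c \<in> R \<Longrightarrow> c * c - h * c - f \<notin> max_ideal R"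
    and V: "valuation_ring K V" "V \<inter> F = R"
    and ab: "a \<in> R" "b \<in> R" "a + b * y \<in> max_ideal V"
  shows "a \<in> max_ideal R" "b \<in> max_ideal R"
proof -
  have m: "max_ideal V \<inter> F = max_ideal R" using max_ideal_Int[OF V(1)] V(2) by simp
  have yV: "y \<in> V"
    using integral_basis_in[OF V, of 0 1] valuation_ringD(1,2)[OF R] by simp
  show b: "b \<in> max_ideal R"
  proof (rule ccontr)
    assume bR: "b \<notin> max_ideal R"
    have ib: "inverse b \<in> R" "b \<noteq> 0"
      using unit_inverse[OF ab(2) bR] unit_nonzero[OF ab(2) bR] by auto
    define c where "c = - (a * inverse b)"
    have c: "c \<in> R" unfolding c_def using ab ib valuation_ringD[OF R] by auto
    have ibV: "inverse b \<in> V" using ib V(2) by auto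
    have "y - c = inverse b * (a + b * y)"
      using ib(2) by (simp add: c_def algebra_simps)
    hence yc: "y - c \<in> max_ideal V"
      using max_ideal_mult'[OF V(1) K ibV ab(3)] by simp
    have "c \<in> V" "h \<in> V" using c hf V(2) by auto
    hence "h - c - y \<in> V"
      using valuation_ringD(3)[OF V(1)] yV by blast
    moreover have "c * c - h * c - f = (y - c) * (h - c - y)"
      using yy by (simp add: algebra_simps)
    ultimately have "c * c - h * c - f \<in> max_ideal V"
      using max_ideal_mult[OF V(1) K yc] by simp
    moreover have "c * c - h * c - f \<in> F"
      using c hf valuation_ringD[OF R] by metis
    ultimately show False using noroot[OF c] m by auto
  qed
  have "b * y \<in> max_ideal V"
    using max_ideal_mult[OF V(1) K _ yV] b m by auto
  hence "a + b * y - b * y \<in> max_ideal V"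
    by (rule max_ideal_diff[OF V(1) K ab(3)])
  thus "a \<in> max_ideal R" using ab m valuation_ringD(7)[OF R] by auto
qed

text \<open>A coefficient with a pole could be scaled to 1 while the element moves into the maximal
  ideal, contrary to \<open>residue_inert\<close>.\<close>

lemma integral_basis_inert:
  assumes noroot: "\<And>c. c \<in> R \<Longrightarrow> c * c - h * c - f \<notin> max_ideal R"
    and V: "valuation_ring K V" "V \<inter> F = R" and z: "z \<in> V"
  obtains a b where "a \<in> R" "b \<in> R" "z = a + b * y"
proof -
  have m: "max_ideal V \<inter> F = max_ideal R" using max_ideal_Int[OF V(1)] V(2) by simp
  obtain a b where ab: "a \<in> F" "b \<in> F" "z = a + b * y"
    using span valuation_ringD(7)[OF V(1) z] by blast
  have "a \<in> R \<and> b \<in> R"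
  proof (rule ccontr)
    assume *: "\<not> ?thesis"
    obtain t where t: "t \<in> max_ideal R" "t * a \<in> R" "t * b \<in> R" "t * a = 1 \<or> t * b = 1"
      using scale_into_valuation_ring[OF R F ab(1,2) *] by metis
    have "t * z \<in> max_ideal V"
      using max_ideal_mult[OF V(1) K _ z] t(1) m by auto
    hence "t * a + t * b * y \<in> max_ideal V"
      by (simp add: ab(3) algebra_simps)
    from residue_inert[OF noroot V t(2,3) this] show False
      using t(4) one_notin_max_ideal[OF R F] by auto
  qed
  thus thesis using that ab by blast
qed

end

section \<open>Eisenstein generators: total ramification\<close>

locale eisenstein_generator = quadratic_generator F K y h f R for F K :: "'o::field set" and y h f R +
  fixes \<pi> g :: 'o
  assumes \<pi>: "\<pi> \<in> max_ideal R" "\<pi> \<noteq> 0" "\<And>a. a \<in> max_ideal R \<Longrightarrow> a / \<pi> \<in> R"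
    and h: "h \<in> max_ideal R" and f: "f = \<pi> * g" and g: "g \<in> R" "g \<notin> max_ideal R"
begin

text \<open>This is \<open>R[y]\<close>, which turns out to be the only valuation ring of
  \<open>K\<close> over \<open>R\<close>.\<close>

definition W where "W = {a + b * y | a b. a \<in> R \<and> b \<in> R}"

lemma WI: "a \<in> R \<Longrightarrow> b \<in> R \<Longrightarrow> a + b * y \<in> W"
  by (auto simp: W_def)

lemma R_subset_W: "a \<in> R \<Longrightarrow> a \<in> W"
  using WI[of a 0] valuation_ringD(2)[OF R] by simp

lemma W_mult:
  assumes "u \<in> W" "v \<in> W" shows "u * v \<in> W"
proof -
  obtain a b c d where "u = a + b * y" "v = c + d * y" and *: "a \<in> R" "b \<in> R" "c \<in> R" "d \<in> R"
    using assms unfolding W_def by auto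
  hence "u * v = a * c + (a * d + b * c) * y + b * d * (y * y)"
    by (simp add: algebra_simps)
  hence "u * v = (a * c + b * d * f) + (a * d + b * c + b * d * h) * y"
    unfolding yy by (simp add: algebra_simps)
  thus ?thesis using * hf WI valuation_ringD(4,5)[OF R] by metis
qed

text \<open>The inverse of \<open>z\<close> is its conjugate divided by its norm. After scaling, the
  norm is a unit if \<open>a0\<close> is one; otherwise \<open>b0 = 1\<close> and the norm is a unit
  times \<open>\<pi>\<close>, which cancels against the scaling factor \<open>t\<close>.\<close>

lemma inverse_in_W:
  assumes z: "z \<in> K" "z \<notin> W" shows "inverse z \<in> W"
proof -
  obtain a b where ab: "a \<in> F" "b \<in> F" "z = a + b * y" using span z(1) by blast
  have nab: "\<not> (a \<in> R \<and> b \<in> R)" using z(2) ab(3) WI by auto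
  obtain t where t: "t \<in> max_ideal R" "t \<noteq> 0" "t * a \<in> R" "t * b \<in> R" "t * a = 1 \<or> t * b = 1"
    using scale_into_valuation_ring[OF R F ab(1,2) nab] by metis
  define a0 b0 where "a0 = t * a" and "b0 = t * b"
  have R0: "a0 \<in> R" "b0 \<in> R" and a0b0: "a0 = 1 \<or> b0 = 1" using t by (auto simp: a0_def b0_def)
  \<comment> \<open>\<open>n\<close> is the norm of \<open>a0 + b0 * y\<close>, whose conjugate is
    \<open>a0 + h * b0 - b0 * y\<close>.\<close>
  define n where "n = a0 * a0 + h * a0 * b0 - b0 * b0 * f"
  have n: "(a0 + b0 * y) * (a0 + h * b0 - b0 * y) = n"
    using yy by (simp add: n_def algebra_simps)
  have z0: "a0 + b0 * y = t * z" by (simp add: a0_def b0_def ab(3) algebra_simps)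
  have conj: "c * (a0 + h * b0 - b0 * y) \<in> W" if "c \<in> R" for c
    using W_mult[OF R_subset_W[OF that] WI[of "a0 + h * b0" "- b0"]] R0 hf valuation_ringD[OF R]
    by (simp add: algebra_simps)
  have inv: "inverse z = t * inverse n * (a0 + h * b0 - b0 * y)" if "n \<noteq> 0"
  proof -
    have "z * (t * inverse n * (a0 + h * b0 - b0 * y)) = n * inverse n"
      using n z0 by (simp add: mult_ac)
    thus ?thesis using that by (intro inverse_unique) simp
  qed
  have hR: "h * a0 * b0 \<in> max_ideal R"
    using max_ideal_mult[OF R F h, of "a0 * b0"] R0 valuation_ringD(4)[OF R] by (simp add: mult.assoc)
  have fR: "b0 * b0 * f \<in> max_ideal R"
    using max_ideal_mult[OF R F \<pi>(1), of "b0 * b0 * g"] R0 g valuation_ringD(4)[OF R]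
    by (simp add: f mult_ac)
  show ?thesis
  proof (cases "a0 \<in> max_ideal R")
    case False
    have "a0 * a0 \<in> R" "a0 * a0 \<notin> max_ideal R"
      using max_ideal_prime[OF R F R0(1) R0(1)] False valuation_ringD(4)[OF R] R0 by auto
    hence "a0 * a0 + (h * a0 * b0 - b0 * b0 * f) \<notin> max_ideal R"
      using unit_add[OF R F] max_ideal_diff[OF R F hR fR] by blast
    hence nR: "n \<in> R" "n \<notin> max_ideal R"
      using R0 hf valuation_ringD(3,4,5)[OF R] by (auto simp: n_def algebra_simps)
    have "t * inverse n \<in> R"
      using unit_inverse[OF nR] max_idealD[OF t(1)] valuation_ringD(4)[OF R] by blast
    thus ?thesis
      using inv conj unit_nonzero[OF nR] by simp
  next
    case True
    hence b0: "b0 = 1" using a0b0 one_notin_max_ideal[OF R F] by auto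
    define a1 h1 t1 where "a1 = a0 / \<pi>" and "h1 = h / \<pi>" and "t1 = t / \<pi>"
    have R1: "a1 \<in> R" "h1 \<in> R" "t1 \<in> R" unfolding a1_def h1_def t1_def using \<pi>(3) True h t(1) by auto
    have mult: "a0 = \<pi> * a1" "h = \<pi> * h1" "t = \<pi> * t1"
      using \<pi>(2) by (simp_all add: a1_def h1_def t1_def)
    \<comment> \<open>\<open>n\<close> will be \<open>- (\<pi> * m)\<close>, and \<open>m\<close> is
      congruent to the unit \<open>g\<close>.\<close>
    define m where "m = g - (a0 * a1 + h * a1)"
    have "a0 * a1 + h * a1 \<in> max_ideal R"
      using max_ideal_add[OF R F] max_ideal_mult[OF R F] True h R1 by auto
    hence m: "m \<in> R" "m \<notin> max_ideal R"
      using valuation_ringD(3)[OF R g(1)] max_idealD unit_add[OF R F g] max_ideal_uminus[OF R F]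
      by (force simp: m_def)+
    have nm: "n = - (\<pi> * m)" by (simp add: n_def m_def b0 f mult algebra_simps)
    have "inverse m \<in> R" "m \<noteq> 0" using unit_inverse[OF m] unit_nonzero[OF m] by auto
    moreover have "t * inverse n = - (t1 * inverse m)"
      using \<open>m \<noteq> 0\<close> \<pi>(2) by (simp add: nm mult(3) field_simps)
    moreover have "n \<noteq> 0" using \<open>m \<noteq> 0\<close> \<pi>(2) by (simp add: nm)
    ultimately have "t * inverse n \<in> R" "n \<noteq> 0"
      using valuation_ringD(6)[OF R valuation_ringD(4)[OF R R1(3)], of "inverse m"] by simp_all
    thus ?thesis using inv conj by simp
  qed
qed

lemma valuation_ring_W: "valuation_ring K W"
proof -
  have "W \<subseteq> K"
    unfolding W_def using FK valuation_ringD(7)[OF R] y subfield_setD(4,5)[OF K] by blast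
  moreover have "u - v \<in> W" if uv: "u \<in> W" "v \<in> W" for u v
  proof -
    obtain a b c d where "u = a + b * y" "v = c + d * y" and *: "a \<in> R" "b \<in> R" "c \<in> R" "d \<in> R"
      using uv unfolding W_def by auto
    hence "u - v = (a - c) + (b - d) * y" by (simp add: algebra_simps)
    thus ?thesis using WI[of "a - c" "b - d"] * valuation_ringD(3)[OF R] by auto
  qed
  moreover have "\<forall>a\<in>K. a \<in> W \<or> inverse a \<in> W"
    using inverse_in_W by blast
  ultimately show ?thesis
    using W_mult R_subset_W[OF valuation_ringD(1)[OF R]] by (auto simp: valuation_ring_def)
qed

lemma W_Int: "W \<inter> F = R"
proof
  show "R \<subseteq> W \<inter> F" using R_subset_W valuation_ringD(7)[OF R] by auto
  show "W \<inter> F \<subseteq> R"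
  proof
    fix z assume z: "z \<in> W \<inter> F"
    then obtain a b where ab: "z = a + b * y" "a \<in> R" "b \<in> R" by (auto simp: W_def)
    have F': "a \<in> F" "b \<in> F" using ab valuation_ringD(7)[OF R] by auto
    have "b = 0"
    proof (rule ccontr)
      assume "b \<noteq> 0"
      hence "y = (z - a) / b" using ab by simp
      thus False using y(2) F' z subfield_setD(3,8)[OF F] by auto
    qed
    thus "z \<in> R" using ab by simp
  qed
qed

lemma W_neq: "W \<noteq> K"
proof
  assume "W = K"
  hence "inverse \<pi> \<in> W \<inter> F"
    using max_idealD[OF \<pi>(1)] valuation_ringD(7)[OF R] FK subfield_setD(7) F K by auto
  hence "inverse \<pi> \<in> R" using W_Int by simp
  thus False using \<pi>(1,2) by (auto simp: max_ideal_def)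
qed

text \<open>Every valuation ring over \<open>R\<close> contains the integral element
  \<open>y\<close>, hence \<open>W\<close>; two such rings are never properly nested.\<close>

lemma eisenstein_unique:
  assumes "valuation_ring K V" "V \<inter> F = R" shows "V = W"
proof -
  have "W \<subseteq> V" using integral_basis_in[OF assms] by (auto simp: W_def)
  thus ?thesis using valuation_rings_incomparable[OF valuation_ring_W W_Int assms] by simp
qed

text \<open>Modulo the maximal ideal the equation reads \<open>y * y = 0\<close>, so
  \<open>y\<close> vanishes and the residue field remains that of \<open>R\<close>.\<close>

lemma residue_W:
  assumes "z \<in> W" obtains a where "a \<in> R" "z - a \<in> max_ideal W"
proof -
  have m: "max_ideal W \<inter> F = max_ideal R" using max_ideal_Int[OF valuation_ring_W] W_Int by simp
  have yW: "y \<in> W" "h \<in> W"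
    using WI[of 0 1] R_subset_W hf valuation_ringD(1,2)[OF R] by auto
  have "f \<in> max_ideal W"
    using max_ideal_mult[OF R F \<pi>(1) g(1)] m by (auto simp: f)
  hence "y * (y - h) \<in> max_ideal W"
    by (simp add: yy algebra_simps)
  hence "y \<in> max_ideal W \<or> y - h \<in> max_ideal W"
    using max_ideal_prime[OF valuation_ring_W K] yW valuation_ringD(3)[OF valuation_ring_W] by blast
  moreover have "h \<in> max_ideal W" using h m by auto
  ultimately have "y \<in> max_ideal W"
    using max_ideal_add[OF valuation_ring_W K, of "y - h" h] by auto
  moreover obtain a b where ab: "z = a + b * y" "a \<in> R" "b \<in> R"
    using assms unfolding W_def by auto
  ultimately have "z - a \<in> max_ideal W"
    using max_ideal_mult'[OF valuation_ring_W K R_subset_W[OF ab(3)]] by simp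
  thus thesis using that ab by blast
qed

end

section \<open>Analyticity and size of the zeta function\<close>

text \<open>The comparison is
  \<open>\<Sum> x \<le> \<Prod> (1 + x) \<le> \<Prod> 1 / (1 - x)\<close>: bounded Euler products
  give convergence of the sum over the places.\<close>

lemma finite_prod_bound_imp_summable_on:
  fixes x :: "'a \<Rightarrow> real"
  assumes x: "\<And>i. i \<in> I \<Longrightarrow> 0 \<le> x i \<and> x i < 1"
    and C: "\<And>G. finite G \<Longrightarrow> G \<subseteq> I \<Longrightarrow> (\<Prod>i\<in>G. inverse (1 - x i)) \<le> C"
  shows "x summable_on I"
proof (rule nonneg_bdd_above_summable_on)
  have "sum x G \<le> C" if G: "G \<subseteq> I" "finite G" for G
  proof -
    have "sum x G \<le> (\<Prod>i\<in>G. 1 + x i)"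
      using G(2,1)
    proof (induction G rule: finite_induct)
      case (insert i G)
      have "1 \<le> (\<Prod>i\<in>G. 1 + x i)"
        using x insert.prems by (intro prod_ge_1) auto
      hence "x i * 1 \<le> x i * (\<Prod>i\<in>G. 1 + x i)"
        using x insert.prems by (intro mult_left_mono) auto
      thus ?case using insert by (simp add: algebra_simps)
    qed auto
    also have "\<dots> \<le> (\<Prod>i\<in>G. inverse (1 - x i))"
    proof (rule prod_mono, safe)
      fix i assume "i \<in> G"
      hence xi: "0 \<le> x i" "x i < 1" using x G by auto
      thus "0 \<le> 1 + x i" by simp
      have "(1 + x i) * (1 - x i) \<le> 1" by (simp add: algebra_simps)
      thus "1 + x i \<le> inverse (1 - x i)" using xi by (simp add: field_simps)
    qed
    also have "\<dots> \<le> C" using C G by auto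
    finally show ?thesis .
  qed
  thus "bdd_above (sum x ` {F. F \<subseteq> I \<and> finite F})"
    by (auto intro!: bdd_aboveI)
qed (use x in auto)

lemma norm_of_nat_powr: "cmod (of_nat n powr w) = real n powr Re w"
  using norm_powr_real_powr[of "of_nat n" w] by simp

text \<open>For \<open>|a|\<close> below 1/2 the estimate \<open>|Ln (1 - a)| \<le> 2 * |a|\<close>
  is available. For \<open>n = 0\<close>, the norm assigned to an infinite residue field, the power
  is 0.\<close>

lemma nat_powr_le_half:
  fixes n :: nat
  assumes "n \<noteq> 1" "\<sigma> > 1"
  shows "real n powr (- \<sigma>) < 1 / 2"
proof (cases "n = 0")
  case False
  hence "real n powr (- \<sigma>) \<le> 2 powr (- \<sigma>)"
    using assms by (intro powr_mono2') auto
  also have "\<dots> < 2 powr (- 1)"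
    using assms by (intro powr_less_mono) auto
  finally show ?thesis by (simp add: powr_minus)
qed auto

context
  fixes K :: "('a, 'b) ring_scheme"
  assumes norm_neq_1: "\<And>V. V \<in> places K \<Longrightarrow> place_norm K V \<noteq> 1"
    and bounded: "\<And>\<sigma>. \<sigma> > 1 \<Longrightarrow> \<exists>C. \<forall>G. finite G \<longrightarrow> G \<subseteq> places K \<longrightarrow>
      (\<Prod>V\<in>G. inverse (1 - real (place_norm K V) powr (- \<sigma>))) \<le> C"
begin

lemma summable_place_norms:
  assumes "\<sigma> > 1"
  shows "(\<lambda>V. real (place_norm K V) powr (- \<sigma>)) summable_on places K"
proof -
  obtain C where "\<forall>G. finite G \<longrightarrow> G \<subseteq> places K \<longrightarrow>
      (\<Prod>V\<in>G. inverse (1 - real (place_norm K V) powr (- \<sigma>))) \<le> C"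
    using bounded[OF assms] by blast
  moreover have "real (place_norm K V) powr (- \<sigma>) < 1" if "V \<in> places K" for V
    using nat_powr_le_half[OF norm_neq_1[OF that] assms] by simp
  ultimately show ?thesis
    by (intro finite_prod_bound_imp_summable_on[where C = C]) auto
qed

text \<open>Logarithms turn the unconditional product into a sum, to which the Weierstrass test
  applies; exponentiating back also shows that the product is nonzero.\<close>

definition log_factor :: "'a set \<Rightarrow> complex \<Rightarrow> complex" where
  "log_factor V w = - Ln (1 - of_nat (place_norm K V) powr (- w))"

lemma exp_log_factor:
  assumes "V \<in> places K" "Re w > 1"
  shows "exp (log_factor V w) = inverse (1 - of_nat (place_norm K V) powr (- w))"
proof -
  have "cmod (of_nat (place_norm K V) powr (- w)) < 1"
    using nat_powr_le_half[OF norm_neq_1[OF assms(1)] assms(2)] by (simp add: norm_of_nat_powr)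
  hence "1 - of_nat (place_norm K V) powr (- w) \<noteq> 0" by auto
  thus ?thesis by (simp add: log_factor_def exp_minus)
qed

lemma uniform_limit_log_factor:
  assumes "\<sigma> > 1"
  shows "uniform_limit {w. Re w \<ge> \<sigma>} (\<lambda>G w. \<Sum>V\<in>G. log_factor V w)
           (\<lambda>w. \<Sum>\<^sub>\<infinity>V\<in>places K. log_factor V w) (finite_subsets_at_top (places K))"
proof (rule Weierstrass_m_test_general)
  show "(\<lambda>V. 2 * real (place_norm K V) powr (- \<sigma>)) summable_on places K"
    by (intro summable_on_cmult_right summable_place_norms assms)
  fix V w assume V: "V \<in> places K" and w: "w \<in> {w. Re w \<ge> \<sigma>}"
  let ?a = "of_nat (place_norm K V) powr (- w) :: complex"
  have "cmod ?a < 1 / 2"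
    using nat_powr_le_half[OF norm_neq_1[OF V], of "Re w"] assms w by (simp add: norm_of_nat_powr)
  hence "cmod (log_factor V w) \<le> 2 * cmod ?a"
    using norm_Ln_le[of "- ?a"] by (simp add: log_factor_def)
  also have "cmod ?a \<le> real (place_norm K V) powr (- \<sigma>)"
  proof (cases "place_norm K V = 0")
    case False
    thus ?thesis using w by (simp add: norm_of_nat_powr powr_mono)
  qed auto
  finally show "cmod (log_factor V w) \<le> 2 * real (place_norm K V) powr (- \<sigma>)" by simp
qed

lemma tendsto_euler_product:
  assumes "Re w > 1"
  shows "((\<lambda>G. \<Prod>V\<in>G. inverse (1 - of_nat (place_norm K V) powr (- w))) \<longlongrightarrow>
           exp (\<Sum>\<^sub>\<infinity>V\<in>places K. log_factor V w)) (finite_subsets_at_top (places K))"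
proof -
  have "((\<lambda>G. exp (\<Sum>V\<in>G. log_factor V w)) \<longlongrightarrow> exp (\<Sum>\<^sub>\<infinity>V\<in>places K. log_factor V w))
          (finite_subsets_at_top (places K))"
    using tendsto_uniform_limitI[OF uniform_limit_log_factor[OF assms], of w] by (intro tendsto_exp) auto
  moreover have "\<forall>\<^sub>F G in finite_subsets_at_top (places K).
      exp (\<Sum>V\<in>G. log_factor V w) = (\<Prod>V\<in>G. inverse (1 - of_nat (place_norm K V) powr (- w)))"
    using assms by (intro eventually_finite_subsets_at_top_weakI)
      (auto simp: exp_sum exp_log_factor intro!: prod.cong)
  ultimately show ?thesis by (rule Lim_transform_eventually)
qed

lemma euler_product_eq:
  "Re w > 1 \<Longrightarrow> euler_product K w = exp (\<Sum>\<^sub>\<infinity>V\<in>places K. log_factor V w)"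
  unfolding euler_product_def by (intro tendsto_Lim tendsto_euler_product) auto

text \<open>\<open>zeta_star\<close> is read off a Laurent expansion, so holomorphy near
  \<open>s\<close> is required and not just the value at \<open>s\<close>. For this
  \<open>bounded\<close> is assumed for all \<open>\<sigma> > 1\<close>.\<close>

lemma analytic_zeta:
  assumes s: "Re s > 1"
  shows "zeta K analytic_on {s}"
proof -
  \<comment> \<open>Half the distance from \<open>s\<close> to the line \<open>Re w = 1\<close>: the
    closed disc stays in \<open>Re w \<ge> 1 + r\<close>, where the convergence is uniform.\<close>
  define r where "r = (Re s - 1) / 2"
  have r: "r > 0" using s by (simp add: r_def)
  have Re_ge: "Re w \<ge> 1 + r" if "w \<in> cball s r" for w
  proof -
    have "\<bar>Re (s - w)\<bar> \<le> r"
      using that abs_Re_le_cmod[of "s - w"] by (auto simp: dist_norm)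
    hence "Re s - Re w \<le> (Re s - 1) / 2"
      using abs_le_D1[of "Re (s - w)"] by (simp only: r_def minus_complex.sel)
    thus ?thesis by (simp add: r_def field_simps)
  qed
  have hol: "log_factor V holomorphic_on cball s r" if V: "V \<in> places K" for V
  proof (cases "place_norm K V = 0")
    case True
    thus ?thesis by (simp add: log_factor_def [abs_def])
  next
    case False
    have "1 - of_nat (place_norm K V) powr (- w) \<notin> \<real>\<^sub>\<le>\<^sub>0" if w: "w \<in> cball s r" for w
    proof
      assume "1 - of_nat (place_norm K V) powr (- w) \<in> \<real>\<^sub>\<le>\<^sub>0"
      hence "Re (of_nat (place_norm K V) powr (- w)) \<ge> 1"
        by (auto simp: complex_nonpos_Reals_iff)
      moreover have "cmod (of_nat (place_norm K V) powr (- w)) < 1"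
        using nat_powr_le_half[OF norm_neq_1[OF V], of "Re w"] Re_ge[OF w] r
        by (simp add: norm_of_nat_powr)
      ultimately show False
        using complex_Re_le_cmod[of "of_nat (place_norm K V) powr (- w)"] by linarith
    qed
    thus ?thesis
      unfolding log_factor_def [abs_def] using False by (intro holomorphic_intros) auto
  qed
  have "(\<lambda>w. \<Sum>\<^sub>\<infinity>V\<in>places K. log_factor V w) holomorphic_on ball s r"
  proof (rule holomorphic_uniform_limit)
    show "\<forall>\<^sub>F G in finite_subsets_at_top (places K).
        continuous_on (cball s r) (\<lambda>w. \<Sum>V\<in>G. log_factor V w) \<and>
        (\<lambda>w. \<Sum>V\<in>G. log_factor V w) holomorphic_on ball s r"
    proof (rule eventually_finite_subsets_at_top_weakI)
      fix G assume "finite G" "G \<subseteq> places K"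
      hence "(\<lambda>w. \<Sum>V\<in>G. log_factor V w) holomorphic_on cball s r"
        using hol by (intro holomorphic_intros) auto
      thus "continuous_on (cball s r) (\<lambda>w. \<Sum>V\<in>G. log_factor V w) \<and>
          (\<lambda>w. \<Sum>V\<in>G. log_factor V w) holomorphic_on ball s r"
        using holomorphic_on_imp_continuous_on holomorphic_on_subset[OF _ ball_subset_cball] by blast
    qed
    show "uniform_limit (cball s r) (\<lambda>G w. \<Sum>V\<in>G. log_factor V w)
        (\<lambda>w. \<Sum>\<^sub>\<infinity>V\<in>places K. log_factor V w) (finite_subsets_at_top (places K))"
      by (rule uniform_limit_on_subset[OF uniform_limit_log_factor[of "1 + r"]]) (use r Re_ge in auto)
  qed auto
  hence "(\<lambda>w. exp (\<Sum>\<^sub>\<infinity>V\<in>places K. log_factor V w)) holomorphic_on ball s r"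
    by (intro holomorphic_intros)
  hence "(\<lambda>w. exp (\<Sum>\<^sub>\<infinity>V\<in>places K. log_factor V w)) analytic_on {s}"
    using r by (auto simp: analytic_at intro!: exI[of _ "ball s r"])
  moreover have "\<forall>\<^sub>F w in nhds s. zeta K w = exp (\<Sum>\<^sub>\<infinity>V\<in>places K. log_factor V w)"
  proof -
    have "open {w. Re w > 1}" by (simp add: open_halfspace_Re_gt)
    hence "\<forall>\<^sub>F w in nhds s. Re w > 1"
      using s by (auto simp: eventually_nhds)
    thus ?thesis
      by eventually_elim (simp add: zeta_def euler_product_eq)
  qed
  ultimately show ?thesis
    by (subst analytic_at_cong) auto
qed

text \<open>The value at \<open>s\<close> is an exponential, hence nonzero, so the expansion begins
  with its constant term.\<close>

lemma zeta_star_eq: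
  assumes s: "Re s > 1"
  shows "zeta_star K s = exp (\<Sum>\<^sub>\<infinity>V\<in>places K. log_factor V s)"
proof -
  let ?E = "fps_expansion (zeta K) s"
  have "laurent_expansion (zeta K) s = fps_to_fls ?E"
    using analytic_at_imp_has_fps_expansion[OF analytic_zeta[OF s]]
    by (intro laurent_expansion_eqI has_laurent_expansion_fps)
  moreover have E0: "fps_nth ?E 0 = exp (\<Sum>\<^sub>\<infinity>V\<in>places K. log_factor V s)"
    using s by (simp add: fps_expansion_def zeta_def euler_product_eq)
  moreover have "subdegree ?E = 0"
    using E0 by (intro subdegree_eq_0) auto
  ultimately show ?thesis
    by (simp add: zeta_star_def fls_subdegree_fls_to_fps)
qed

text \<open>Finite subproducts are estimated factor by factor with
  \<open>|1 - a| \<ge> 1 - |a|\<close>, and the bound passes to the limit.\<close>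

lemma norm_zeta_star_le:
  assumes s: "Re s > 1"
    and B: "\<And>G. finite G \<Longrightarrow> G \<subseteq> places K \<Longrightarrow>
      (\<Prod>V\<in>G. inverse (1 - real (place_norm K V) powr (- Re s))) \<le> B"
  shows "cmod (zeta_star K s) \<le> B"
  unfolding zeta_star_eq[OF s]
proof (rule tendsto_upperbound[OF tendsto_norm[OF tendsto_euler_product[OF s]]])
  show "\<forall>\<^sub>F G in finite_subsets_at_top (places K).
      cmod (\<Prod>V\<in>G. inverse (1 - of_nat (place_norm K V) powr (- s))) \<le> B"
  proof (rule eventually_finite_subsets_at_top_weakI)
    fix G assume G: "finite G" "G \<subseteq> places K"
    have "cmod (\<Prod>V\<in>G. inverse (1 - of_nat (place_norm K V) powr (- s))) =
        (\<Prod>V\<in>G. inverse (cmod (1 - of_nat (place_norm K V) powr (- s))))"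
      by (simp add: prod_norm [symmetric] norm_inverse)
    also have "\<dots> \<le> (\<Prod>V\<in>G. inverse (1 - real (place_norm K V) powr (- Re s)))"
    proof (rule prod_mono, safe)
      fix V assume "V \<in> G"
      hence "real (place_norm K V) powr (- Re s) < 1"
        using nat_powr_le_half[OF norm_neq_1 s] G by fastforce
      moreover have "1 - real (place_norm K V) powr (- Re s) \<le>
          cmod (1 - of_nat (place_norm K V) powr (- s))"
        using norm_triangle_ineq2[of 1 "of_nat (place_norm K V) powr (- s) :: complex"]
        by (simp add: norm_of_nat_powr)
      ultimately show "inverse (cmod (1 - of_nat (place_norm K V) powr (- s))) \<le>
          inverse (1 - real (place_norm K V) powr (- Re s))"
        by (intro le_imp_inverse_le) auto
    qed auto
    also have "\<dots> \<le> B" using B G by auto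
    finally show "cmod (\<Prod>V\<in>G. inverse (1 - of_nat (place_norm K V) powr (- s))) \<le> B" .
  qed
qed auto

end

section \<open>The Euler product of a polynomial ring\<close>

lemma card_poly_degree_less:
  "card {g :: 'k::{finite,field} poly. g = 0 \<or> degree g < n} = CARD('k) ^ n"
  and finite_poly_degree_less: "finite {g :: 'k poly. g = 0 \<or> degree g < n}"
proof -
  let ?D = "\<lambda>n. {g :: 'k poly. g = 0 \<or> degree g < n}"
  have "finite (?D n) \<and> card (?D n) = CARD('k) ^ n"
  proof (induction n)
    case (Suc n)
    have iff: "pCons c g \<in> ?D (Suc n) \<longleftrightarrow> g \<in> ?D n" for c and g :: "'k poly"
      by (cases "g = 0") (simp_all add: degree_pCons_eq_if)
    have "?D (Suc n) = (\<lambda>(c, g). pCons c g) ` (UNIV \<times> ?D n)"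
    proof (intro equalityI subsetI)
      fix g assume g: "g \<in> ?D (Suc n)"
      obtain c h where ch: "g = pCons c h" by (cases g)
      hence "h \<in> ?D n" using g by (simp only: iff)
      thus "g \<in> (\<lambda>(c, g). pCons c g) ` (UNIV \<times> ?D n)"
        by (intro image_eqI[of _ _ "(c, h)"]) (simp_all add: ch)
    next
      fix g assume "g \<in> (\<lambda>(c, g). pCons c g) ` (UNIV \<times> ?D n)"
      then obtain c h where ch: "g = pCons c h" and "h \<in> ?D n"
        by (elim imageE SigmaE) simp
      thus "g \<in> ?D (Suc n)" by (simp only: iff)
    qed
    moreover have "inj_on (\<lambda>(c, g). pCons c g) (UNIV \<times> ?D n)"
      by (auto simp: inj_on_def)
    ultimately show ?case
      using Suc.IH by (simp only: card_image finite_imageI finite_cartesian_product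
        card_cartesian_product finite power_Suc simp_thms)
  qed simp
  thus "card (?D n) = CARD('k) ^ n" "finite (?D n)" by auto
qed

lemma card_monic_poly:
  "card {g :: 'k::{finite,field} poly. lead_coeff g = 1 \<and> degree g = n} = CARD('k) ^ n"
proof -
  let ?D = "{g :: 'k poly. g = 0 \<or> degree g < n}"
  have "bij_betw (\<lambda>g. Polynomial.monom 1 n + g) ?D
      {g. lead_coeff g = 1 \<and> degree g = n}"
  proof (rule bij_betw_byWitness[where f' = "\<lambda>g. g - Polynomial.monom 1 n"], goal_cases)
    case 3
    show ?case
    proof (rule image_subsetI)
      fix g :: "'k poly"
      assume g: "g \<in> {g. g = 0 \<or> degree g < n}"
      have "degree (Polynomial.monom 1 n + g) = n"
        using g by (cases "g = 0") (simp_all add: degree_monom_eq degree_add_eq_left)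
      moreover have "Polynomial.coeff (Polynomial.monom 1 n + g) n = 1"
        using g by (cases "g = 0") (simp_all add: coeff_eq_0)
      ultimately show "Polynomial.monom 1 n + g \<in>
          {g. lead_coeff g = 1 \<and> degree g = n}"
        by simp
    qed
  next
    case 4
    show ?case
    proof (rule image_subsetI)
      fix g :: "'k poly"
      assume "g \<in> {g. lead_coeff g = 1 \<and> degree g = n}"
      hence g: "lead_coeff g = 1" "degree g = n" by auto
      have "degree (g - Polynomial.monom 1 n) \<le> n"
        using g by (intro degree_diff_le) (auto simp: degree_monom_eq)
      moreover have "Polynomial.coeff (g - Polynomial.monom 1 n) n = 0"
        using g by simp
      ultimately have "g - Polynomial.monom 1 n = 0 \<or> degree (g - Polynomial.monom 1 n) < n"
        by (rule eq_zero_or_degree_less)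
      thus "g - Polynomial.monom 1 n \<in> {g. g = 0 \<or> degree g < n}" by simp
    qed
  qed auto
  from bij_betw_same_card[OF this] show ?thesis
    by (simp only: card_poly_degree_less)
qed

definition poly_norm :: "'k::{finite,zero} poly \<Rightarrow> nat" where
  "poly_norm g = CARD('k) ^ degree g"

lemma card_field_ge_2: "CARD('k::{finite,field}) \<ge> 2"
proof -
  have "card {0, 1 :: 'k} \<le> CARD('k)" by (rule card_mono) auto
  thus ?thesis by simp
qed

lemma poly_norm_mult:
  "g \<noteq> 0 \<Longrightarrow> h \<noteq> 0 \<Longrightarrow> poly_norm (g * h :: 'k::{finite,field} poly) = poly_norm g * poly_norm h"
  by (simp add: poly_norm_def Polynomial.degree_mult_eq power_add)

text \<open>\<open>prime\<close> includes being normalized here, so primes are monic irreducible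
  polynomials, one for each class of associates.\<close>

lemma lead_coeff_prime_poly:
  assumes "prime (P :: 'k::field_gcd poly)"
  shows "lead_coeff P = 1"
proof -
  have P0: "P \<noteq> 0" using assms by auto
  have "unit_factor P = 1"
    using unit_factor_normalize[OF P0] normalize_prime[OF assms] by simp
  hence "unit_factor (lead_coeff P) = 1"
    by (simp add: unit_factor_poly_def one_pCons)
  moreover have "is_unit (lead_coeff P)"
    using P0 by (simp add: dvd_field_iff)
  ultimately show ?thesis by (simp add: is_unit_unit_factor)
qed

lemma degree_prime_poly: "prime (P :: 'k::field_gcd poly) \<Longrightarrow> degree P > 0"
  using is_unit_iff_degree[of P] not_prime_unit[of P] by (cases "P = 0") auto

text \<open>There are \<open>q ^ n\<close> monic polynomials of degree \<open>n\<close>, each of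
  norm \<open>q ^ n\<close>; this gives a geometric series of ratio
  \<open>q powr (1 - \<sigma>)\<close>.\<close>

lemma sum_monic_poly_le:
  fixes \<sigma> :: real
  assumes "\<sigma> > 1" "finite G" "G \<subseteq> {g :: 'k::{finite,field} poly. lead_coeff g = 1}"
  shows "(\<Sum>g\<in>G. real (poly_norm g) powr (- \<sigma>)) \<le> 1 / (1 - real CARD('k) powr (1 - \<sigma>))"
proof -
  define q where "q = real CARD('k)"
  have q: "q \<ge> 2" using card_field_ge_2 by (simp add: q_def)
  define M where "M n = {g :: 'k poly. lead_coeff g = 1 \<and> degree g = n}" for n
  have card_M: "card (M n) = CARD('k) ^ n" for n
    unfolding M_def by (rule card_monic_poly)
  hence fin: "finite (M n)" for n
    using card_field_ge_2[where 'k = 'k] by (intro card_ge_0_finite) (simp add: card_M)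
  obtain N where N: "\<forall>g\<in>G. degree g < N"
    using finite_nat_set_iff_bounded[of "degree ` G"] assms(2) by auto
  have r: "q powr (1 - \<sigma>) < 1" "q powr (1 - \<sigma>) \<ge> 0"
    using q assms(1) powr_less_mono[of "1 - \<sigma>" 0 q] by auto
  have "(\<Sum>g\<in>G. real (poly_norm g) powr (- \<sigma>)) \<le>
      (\<Sum>g\<in>(\<Union>n<N. M n). real (poly_norm g) powr (- \<sigma>))"
    using assms(2,3) N fin by (intro sum_mono2) (auto simp: M_def)
  also have "\<dots> = (\<Sum>n<N. \<Sum>g\<in>M n. real (poly_norm g) powr (- \<sigma>))"
    using fin by (intro sum.UNION_disjoint) (auto simp: M_def)
  also have "\<dots> = (\<Sum>n<N. (q powr (1 - \<sigma>)) ^ n)"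
  proof (rule sum.cong)
    fix n
    have "(\<Sum>g\<in>M n. real (poly_norm g) powr (- \<sigma>)) = (\<Sum>g\<in>M n. (q ^ n) powr (- \<sigma>))"
      by (intro sum.cong) (auto simp: M_def poly_norm_def q_def)
    also have "\<dots> = q ^ n * (q ^ n) powr (- \<sigma>)"
      by (simp add: card_M q_def)
    also have "\<dots> = q powr real n * (q powr real n) powr (- \<sigma>)"
      using q by (simp only: powr_realpow)
    also have "\<dots> = q powr (real n * (1 - \<sigma>))"
      by (simp only: powr_powr powr_add [symmetric]) (simp add: algebra_simps)
    also have "\<dots> = (q powr (1 - \<sigma>)) ^ n"
      using q by (simp add: powr_power mult.commute)
    finally show "(\<Sum>g\<in>M n. real (poly_norm g) powr (- \<sigma>)) = (q powr (1 - \<sigma>)) ^ n" .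
  qed simp
  also have "\<dots> \<le> suminf (\<lambda>n. (q powr (1 - \<sigma>)) ^ n)"
    using r by (intro sum_le_suminf summable_geometric) auto
  also have "\<dots> = 1 / (1 - q powr (1 - \<sigma>))"
    using r by (intro suminf_geometric) auto
  finally show ?thesis by (simp add: q_def)
qed

text \<open>
  Sieving: adding a prime \<open>P\<close> to \<open>S\<close> multiplies the sum over the monic polynomials without
  prime factor in \<open>S\<close> by the inverse of the Euler factor at \<open>P\<close>, while the term of the
  polynomial 1 always remains.
\<close>
lemma euler_product_poly_le:
  fixes \<sigma> :: real and S :: "'k::{finite,field_gcd} poly set"
  assumes \<sigma>: "\<sigma> > 1" and S: "finite S" "\<And>P. P \<in> S \<Longrightarrow> prime P"
  shows "(\<Prod>P\<in>S. inverse (1 - real (poly_norm P) powr (- \<sigma>))) \<le> 1 / (1 - real CARD('k) powr (1 - \<sigma>))"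
proof -
  define w where "w g = real (poly_norm g) powr (- \<sigma>)" for g :: "'k poly"
  define A where "A S = {g :: 'k poly. lead_coeff g = 1 \<and> (\<forall>P\<in>S. \<not> P dvd g)}" for S
  define C where "C = 1 / (1 - real CARD('k) powr (1 - \<sigma>))"
  have w_nonneg: "w g \<ge> 0" for g by (simp add: w_def)
  have le_C: "sum w G \<le> C" if "finite G" "G \<subseteq> A S" for G S
    using sum_monic_poly_le[OF \<sigma> that(1)] that(2) by (auto simp: w_def C_def A_def)
  have summ: "w summable_on A S" for S
    using le_C by (intro nonneg_bdd_above_summable_on bdd_aboveI[where M = C] w_nonneg) auto
  have w1: "w P < 1" if "prime P" for P
  proof -
    have "degree P > 0"
      using that by (rule degree_prime_poly)
    hence "real CARD('k) ^ degree P > 1"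
      using card_field_ge_2[where 'k = 'k] by (intro one_less_power) auto
    hence "real (poly_norm P) powr (- \<sigma>) < real (poly_norm P) powr 0"
      using \<sigma> by (intro powr_less_mono) (auto simp: poly_norm_def)
    thus ?thesis by (simp add: w_def poly_norm_def)
  qed
  have step: "infsum w (A (insert P S)) = (1 - w P) * infsum w (A S)"
    if P: "prime P" "P \<notin> S" and S: "\<And>Q. Q \<in> S \<Longrightarrow> prime Q" for P S
  proof -
    have P0: "P \<noteq> 0" using P by auto
    \<comment> \<open>Distinct normalized primes do not divide one another, so multiplication by
      \<open>P\<close> introduces no prime factor from \<open>S\<close>.\<close>
    have split: "A S = A (insert P S) \<union> (*) P ` A S"
    proof (intro equalityI subsetI)
      fix g assume g: "g \<in> A S"
      show "g \<in> A (insert P S) \<union> (*) P ` A S"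
      proof (cases "P dvd g")
        case True
        then obtain h where h: "g = P * h" by (elim dvdE)
        have "h \<in> A S"
          using g lead_coeff_prime_poly[OF P(1)] by (auto simp: A_def h Polynomial.lead_coeff_mult)
        thus ?thesis using h by blast
      qed (use g in \<open>auto simp: A_def\<close>)
    next
      fix g assume "g \<in> A (insert P S) \<union> (*) P ` A S"
      thus "g \<in> A S"
      proof
        assume "g \<in> (*) P ` A S"
        then obtain h where h: "g = P * h" "h \<in> A S" by auto
        have "\<not> Q dvd P * h" if Q: "Q \<in> S" for Q
        proof
          assume "Q dvd P * h"
          hence "Q dvd P"
            using prime_dvd_multD[OF S[OF Q]] h(2) Q by (auto simp: A_def)
          hence "Q = P" using primes_dvd_imp_eq S[OF Q] P(1) by blast
          thus False using P(2) Q by simp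
        qed
        thus "g \<in> A S"
          using h lead_coeff_prime_poly[OF P(1)] by (auto simp: A_def Polynomial.lead_coeff_mult)
      qed (auto simp: A_def)
    qed
    have inj: "inj_on ((*) P) (A S)" using P0 by (auto simp: inj_on_def)
    have "infsum w ((*) P ` A S) = infsum (\<lambda>g. w (P * g)) (A S)"
      using inj by (simp add: infsum_reindex o_def)
    also have "\<dots> = infsum (\<lambda>g. w P * w g) (A S)"
    proof (rule infsum_cong)
      fix g assume "g \<in> A S"
      hence "g \<noteq> 0" by (auto simp: A_def)
      thus "w (P * g) = w P * w g"
        using P0 by (simp add: w_def poly_norm_mult powr_mult)
    qed
    also have "\<dots> = w P * infsum w (A S)"
      using summ by (intro infsum_cmult_right) auto
    finally have "infsum w ((*) P ` A S) = w P * infsum w (A S)" .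
    moreover have "infsum w (A S) = infsum w (A (insert P S)) + infsum w ((*) P ` A S)"
    proof (subst (1) split, rule infsum_Un_disjoint)
      show "w summable_on (*) P ` A S"
        by (rule summable_on_subset_banach[OF summ[of S]]) (use split in blast)
      show "A (insert P S) \<inter> (*) P ` A S = {}" by (auto simp: A_def)
    qed (rule summ)
    ultimately show ?thesis by (simp add: algebra_simps)
  qed
  have "infsum w (A S) = (\<Prod>P\<in>S. 1 - w P) * infsum w (A {})"
    using S
  proof (induction S rule: finite_induct)
    case (insert P S)
    thus ?case using step[of P S] by (simp add: mult.assoc)
  qed simp
  also have "\<dots> \<le> (\<Prod>P\<in>S. 1 - w P) * C"
  proof (rule mult_left_mono)
    show "infsum w (A {}) \<le> C" by (rule infsum_le_finite_sums[OF summ]) (rule le_C)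
    show "(\<Prod>P\<in>S. 1 - w P) \<ge> 0" using w1 S by (intro prod_nonneg) (simp add: less_imp_le)
  qed
  finally have "infsum w (A S) \<le> (\<Prod>P\<in>S. 1 - w P) * C" .
  moreover have "1 \<le> infsum w (A S)"
  proof -
    have "\<not> is_unit P" if "P \<in> S" for P
      using S(2)[OF that] not_prime_unit by blast
    hence "{1} \<subseteq> A S" by (auto simp: A_def)
    hence "sum w {1} \<le> infsum w (A S)"
      using w_nonneg by (intro finite_sum_le_infsum summ) auto
    thus ?thesis by (simp add: w_def poly_norm_def)
  qed
  moreover have pos: "(\<Prod>P\<in>S. 1 - w P) > 0" using w1 S by (intro prod_pos) simp
  ultimately have "inverse (\<Prod>P\<in>S. 1 - w P) \<le> C" by (simp add: field_simps)
  moreover have "(\<Prod>P\<in>S. inverse (1 - w P)) = inverse (\<Prod>P\<in>S. 1 - w P)"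
    using prod_inversef[of "\<lambda>P. 1 - w P" S] by (simp add: o_def)
  ultimately show ?thesis by (simp add: C_def w_def)
qed

section \<open>Places under isomorphisms\<close>

lemma place_norm_eq_card:
  "place_norm K V = card ((\<lambda>a. (\<lambda>i. i \<oplus>\<^bsub>K\<^esub> a) ` place_ideal K V) ` V)"
proof -
  have "carrier ((K\<lparr>carrier := V\<rparr>) Quot place_ideal K V) = (\<lambda>a. (\<lambda>i. i \<oplus>\<^bsub>K\<^esub> a) ` place_ideal K V) ` V"
    by (auto simp: FactRing_def A_RCOSETS_def' a_r_coset_def')
  thus ?thesis by (simp add: place_norm_def)
qed

lemma place_image:
  assumes R: "Ring.field R" and S: "Ring.field S" and h: "h \<in> ring_iso R S" and V: "V \<in> places R"
  shows "h ` V \<in> places S" "place_norm S (h ` V) = place_norm R V"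
proof -
  interpret R: Ring.field R by fact
  interpret S: Ring.field S by fact
  interpret h: ring_hom_ring R S h
    using h by (intro ring_hom_ring.intro ring_hom_ring_axioms.intro R.ring_axioms S.ring_axioms)
      (auto simp: ring_iso_def)
  have bij: "bij_betw h (carrier R) (carrier S)" using h by (auto simp: ring_iso_def)
  hence inj: "inj_on h (carrier R)" and surj: "h ` carrier R = carrier S"
    by (auto simp: bij_betw_def)
  have sub: "V \<subseteq> carrier R" and subr: "subring V R" and ne: "V \<noteq> carrier R"
    and val: "\<And>z. z \<in> carrier R \<Longrightarrow> z \<noteq> \<zero>\<^bsub>R\<^esub> \<Longrightarrow> z \<in> V \<or> inv\<^bsub>R\<^esub> z \<in> V"
    using V subringE(1) by (auto simp: places_def)
  have h0: "h z = \<zero>\<^bsub>S\<^esub> \<longleftrightarrow> z = \<zero>\<^bsub>R\<^esub>" if "z \<in> carrier R" for z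
    using inj_onD[OF inj, of z "\<zero>\<^bsub>R\<^esub>"] that by auto
  have h_inv: "inv\<^bsub>S\<^esub> (h z) = h (inv\<^bsub>R\<^esub> z)" and invR: "inv\<^bsub>R\<^esub> z \<in> carrier R"
    if z: "z \<in> carrier R" "z \<noteq> \<zero>\<^bsub>R\<^esub>" for z
  proof -
    have U: "z \<in> Units R" using z R.field_Units by blast
    thus iR: "inv\<^bsub>R\<^esub> z \<in> carrier R" by simp
    have "h z \<otimes>\<^bsub>S\<^esub> h (inv\<^bsub>R\<^esub> z) = \<one>\<^bsub>S\<^esub>"
      using U iR z(1) h.hom_mult[of z "inv\<^bsub>R\<^esub> z"] by simp
    thus "inv\<^bsub>S\<^esub> (h z) = h (inv\<^bsub>R\<^esub> z)"
      using iR z(1) by (intro S.comm_inv_char) auto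
  qed
  have mem: "h z \<in> h ` A \<longleftrightarrow> z \<in> A" if "z \<in> carrier R" "A \<subseteq> carrier R" for z A
    using inj_on_image_mem_iff[OF inj that] .
  show "h ` V \<in> places S"
    unfolding places_def
  proof (intro CollectI conjI ballI)
    show "subring (h ` V) S" by (rule h.img_is_subring[OF subr])
    show "h ` V \<noteq> carrier S"
      using inj_on_image_eq_iff[OF inj sub subset_refl] ne surj by simp
    fix z assume "z \<in> carrier S - {\<zero>\<^bsub>S\<^esub>}"
    then obtain z' where z': "z' \<in> carrier R" "z = h z'" "z' \<noteq> \<zero>\<^bsub>R\<^esub>"
      using surj h0 by auto
    thus "z \<in> h ` V \<or> inv\<^bsub>S\<^esub> z \<in> h ` V"
      using val[OF z'(1,3)] h_inv[OF z'(1,3)] by auto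
  qed
  have ideal: "place_ideal S (h ` V) = h ` place_ideal R V"
  proof (intro equalityI subsetI)
    fix z assume z: "z \<in> place_ideal S (h ` V)"
    then obtain v where v: "v \<in> V" "z = h v" by (auto simp: place_ideal_def)
    have vc: "v \<in> carrier R" using v sub by auto
    have "v = \<zero>\<^bsub>R\<^esub> \<or> inv\<^bsub>R\<^esub> v \<notin> V"
      using z h0[OF vc] h_inv[OF vc] by (cases "v = \<zero>\<^bsub>R\<^esub>") (auto simp: place_ideal_def v(2))
    thus "z \<in> h ` place_ideal R V" using v by (auto simp: place_ideal_def)
  next
    fix z assume "z \<in> h ` place_ideal R V"
    then obtain v where v: "v \<in> V" "z = h v" "v = \<zero>\<^bsub>R\<^esub> \<or> inv\<^bsub>R\<^esub> v \<notin> V"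
      by (auto simp: place_ideal_def)
    have vc: "v \<in> carrier R" using v sub by auto
    have "z = \<zero>\<^bsub>S\<^esub> \<or> inv\<^bsub>S\<^esub> z \<notin> h ` V"
      using v h0[OF vc] h_inv[OF vc] mem[OF invR[OF vc] sub] by (cases "v = \<zero>\<^bsub>R\<^esub>") auto
    thus "z \<in> place_ideal S (h ` V)" using v by (auto simp: place_ideal_def)
  qed
  have I: "place_ideal R V \<subseteq> carrier R" using sub by (auto simp: place_ideal_def)
  define coset where "coset a = (\<lambda>i. i \<oplus>\<^bsub>R\<^esub> a) ` place_ideal R V" for a
  have cos: "(\<lambda>i. i \<oplus>\<^bsub>S\<^esub> h a) ` h ` place_ideal R V = h ` coset a" if "a \<in> V" for a
  proof -
    have "h i \<oplus>\<^bsub>S\<^esub> h a = h (i \<oplus>\<^bsub>R\<^esub> a)" if "i \<in> place_ideal R V" for i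
      using h.hom_add[of i a] \<open>a \<in> V\<close> that sub I by (auto simp: subset_iff)
    thus ?thesis by (simp add: coset_def image_image cong: image_cong)
  qed
  have "(\<lambda>a. (\<lambda>i. i \<oplus>\<^bsub>S\<^esub> a) ` place_ideal S (h ` V)) ` h ` V = (`) h ` coset ` V"
    unfolding ideal image_image[of _ h V] image_image[of "(`) h"] using cos by (intro image_cong) auto
  moreover have "inj_on ((`) h) (coset ` V)"
  proof (rule inj_on_subset)
    show "inj_on ((`) h) (Pow (carrier R))" by (rule inj_on_image_Pow[OF inj])
    show "coset ` V \<subseteq> Pow (carrier R)" using sub I by (auto simp: coset_def)
  qed
  ultimately show "place_norm S (h ` V) = place_norm R V"
    unfolding place_norm_eq_card by (simp add: card_image coset_def [abs_def])
qed

text \<open>The bridge from sets in a type-class field, where the calculations take place, to the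
  records on which places and zeta functions are defined.\<close>

definition set_ring :: "'o::field set \<Rightarrow> 'o ring" where
  "set_ring K = \<lparr>carrier = K, monoid.mult = (*), one = 1, ring.zero = 0, add = (+)\<rparr>"

lemma set_ring_simps [simp]:
  "carrier (set_ring K) = K" "x \<otimes>\<^bsub>set_ring K\<^esub> y = x * y" "\<one>\<^bsub>set_ring K\<^esub> = 1"
  "\<zero>\<^bsub>set_ring K\<^esub> = 0" "x \<oplus>\<^bsub>set_ring K\<^esub> y = x + y"
  by (simp_all add: set_ring_def)

lemma field_set_ring:
  assumes K: "subfield_set K"
  shows "Ring.field (set_ring K)"
proof -
  have "cring (set_ring K)"
  proof (rule cringI)
    show "abelian_group (set_ring K)"
      using subfield_setD[OF K]
      by (intro abelian_groupI) (auto simp: algebra_simps intro!: bexI[of _ "- _"])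
    show "comm_monoid (set_ring K)"
      using subfield_setD[OF K] by (intro comm_monoidI) (auto simp: algebra_simps)
  qed (auto simp: algebra_simps)
  moreover have "\<exists>y\<in>K. x * y = 1" if "x \<in> K" "x \<noteq> 0" for x
    using subfield_setD(7)[OF K that(1)] that(2) by (intro bexI[of _ "inverse x"]) auto
  ultimately show ?thesis
    by (intro cring.cring_fieldI2) auto
qed

context
  fixes K :: "'o::field set"
  assumes K: "subfield_set K"
begin

interpretation K: Ring.field "set_ring K"
  by (rule field_set_ring[OF K])

lemma uminus_set_ring: "x \<in> K \<Longrightarrow> \<ominus>\<^bsub>set_ring K\<^esub> x = - x"
  using subfield_setD(6)[OF K] by (intro K.minus_equality) auto

lemma inv_set_ring: "x \<in> K \<Longrightarrow> x \<noteq> 0 \<Longrightarrow> inv\<^bsub>set_ring K\<^esub> x = inverse x"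
  using subfield_setD(7)[OF K] by (intro K.comm_inv_char) auto

lemma places_set_ring: "V \<in> places (set_ring K) \<longleftrightarrow> valuation_ring K V \<and> V \<noteq> K"
proof
  assume V: "V \<in> places (set_ring K)"
  hence sub: "subring V (set_ring K)" and ne: "V \<noteq> K"
    and val: "\<And>z. z \<in> K \<Longrightarrow> z \<noteq> 0 \<Longrightarrow> z \<in> V \<or> inv\<^bsub>set_ring K\<^esub> z \<in> V"
    by (auto simp: places_def)
  have "V \<subseteq> K" using subringE(1)[OF sub] by simp
  moreover have "a - b \<in> V" "a * b \<in> V" if "a \<in> V" "b \<in> V" for a b
    using subringE(5)[OF sub that(2)] subringE(6)[OF sub that] subringE(7)[OF sub that(1), of "- b"]
      that \<open>V \<subseteq> K\<close> by (auto simp: uminus_set_ring)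
  moreover have "a \<in> V \<or> inverse a \<in> V" if "a \<in> K" for a
    using val[OF that] inv_set_ring[OF that] subringE(2)[OF sub] by (cases "a = 0") auto
  ultimately show "valuation_ring K V \<and> V \<noteq> K"
    using ne subringE(3)[OF sub] by (auto simp: valuation_ring_def)
next
  assume V: "valuation_ring K V \<and> V \<noteq> K"
  have "subring V (set_ring K)"
    using valuation_ringD[of K V] V by (intro K.subringI) (auto simp: uminus_set_ring)
  thus "V \<in> places (set_ring K)"
    using V valuation_ringD(8)[of K V] by (auto simp: places_def inv_set_ring)
qed

lemma place_ideal_set_ring: "V \<subseteq> K \<Longrightarrow> place_ideal (set_ring K) V = max_ideal V"
  by (auto simp: place_ideal_def max_ideal_def inv_set_ring subset_iff)

text \<open>The norm counts cosets: a complete incongruent set computes it, while a merely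
  incongruent set bounds it from below, unless there are infinitely many cosets and
  \<open>card\<close> returns 0.\<close>

lemma place_norm_set_ring:
  assumes V: "valuation_ring K V"
  shows place_norm_eq_representatives:
    "\<lbrakk>\<And>z. z \<in> V \<Longrightarrow> \<exists>a\<in>A. z - a \<in> max_ideal V; A \<subseteq> V;
      \<And>a b. a \<in> A \<Longrightarrow> b \<in> A \<Longrightarrow> a - b \<in> max_ideal V \<Longrightarrow> a = b\<rbrakk>
      \<Longrightarrow> place_norm (set_ring K) V = card A"
    and place_norm_ge_representatives:
    "\<lbrakk>A \<subseteq> V; \<And>a b. a \<in> A \<Longrightarrow> b \<in> A \<Longrightarrow> a - b \<in> max_ideal V \<Longrightarrow> a = b\<rbrakk>
      \<Longrightarrow> place_norm (set_ring K) V = 0 \<or> card A \<le> place_norm (set_ring K) V"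
proof -
  define coset where "coset a = (\<lambda>i. i + a) ` max_ideal V" for a
  have norm: "place_norm (set_ring K) V = card (coset ` V)"
    using V by (simp add: place_norm_eq_card place_ideal_set_ring valuation_ring_def coset_def [abs_def])
  have coset_eq: "coset a = coset b \<longleftrightarrow> a - b \<in> max_ideal V" if "a \<in> V" "b \<in> V" for a b
  proof
    assume "coset a = coset b"
    moreover have "0 + a \<in> coset a"
      unfolding coset_def using zero_in_max_ideal[OF V K] by blast
    ultimately obtain i where "i \<in> max_ideal V" "0 + a = i + b" by (auto simp: coset_def)
    thus "a - b \<in> max_ideal V" by (simp add: algebra_simps)
  next
    assume ab: "a - b \<in> max_ideal V"
    have sub: "coset c \<subseteq> coset d" if "c - d \<in> max_ideal V" for c d
    proof
      fix z assume "z \<in> coset c"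
      then obtain i where i: "i \<in> max_ideal V" "z = i + c" by (auto simp: coset_def)
      hence "z = (i + (c - d)) + d" by simp
      thus "z \<in> coset d" unfolding coset_def using max_ideal_add[OF V K i(1) that] by blast
    qed
    have "b - a \<in> max_ideal V" using max_ideal_uminus[OF V K ab] by simp
    thus "coset a = coset b" using sub[OF ab] sub[of b a] by auto
  qed
  show "place_norm (set_ring K) V = card A"
    if A: "\<And>z. z \<in> V \<Longrightarrow> \<exists>a\<in>A. z - a \<in> max_ideal V" "A \<subseteq> V"
      "\<And>a b. a \<in> A \<Longrightarrow> b \<in> A \<Longrightarrow> a - b \<in> max_ideal V \<Longrightarrow> a = b"
  proof -
    have "coset ` V = coset ` A"
    proof (intro equalityI subsetI)
      fix C assume "C \<in> coset ` V"
      then obtain z where z: "z \<in> V" "C = coset z" by auto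
      obtain a where "a \<in> A" "z - a \<in> max_ideal V" using A(1)[OF z(1)] by auto
      thus "C \<in> coset ` A" using coset_eq[of z a] z A(2) by auto
    qed (use A(2) in auto)
    moreover have "inj_on coset A"
      using A(2,3) by (auto intro!: inj_onI simp: coset_eq subset_iff)
    ultimately show ?thesis by (simp add: norm card_image)
  qed
  show "place_norm (set_ring K) V = 0 \<or> card A \<le> place_norm (set_ring K) V"
    if A: "A \<subseteq> V" "\<And>a b. a \<in> A \<Longrightarrow> b \<in> A \<Longrightarrow> a - b \<in> max_ideal V \<Longrightarrow> a = b"
  proof (cases "finite (coset ` V)")
    case True
    have "inj_on coset A"
      using A by (auto intro!: inj_onI simp: coset_eq subset_iff)
    hence "card A = card (coset ` A)" by (simp add: card_image)
    also have "\<dots> \<le> card (coset ` V)" using A(1) True by (intro card_mono) auto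
    finally show ?thesis by (simp add: norm)
  qed (simp add: norm)
qed

end

section \<open>The rational function field\<close>

text \<open>The ambient field is kept abstract; an algebraic closure of the rational function field,
  which contains the root \<open>y\<close>, will be inserted at the end.\<close>

locale poly_embedding =
  fixes emb :: "'k::{finite_field,field_gcd} poly \<Rightarrow> 'o::field"
  assumes emb_1 [simp]: "emb 1 = 1" and emb_add [simp]: "emb (u + v) = emb u + emb v"
    and emb_mult [simp]: "emb (u * v) = emb u * emb v" and emb_eq_0D: "emb u = 0 \<Longrightarrow> u = 0"
begin

lemma emb_0 [simp]: "emb 0 = 0"
proof -
  have "emb 0 + emb 0 = emb 0 + 0"
    using emb_add[of 0 0] by (simp only: add_0_right)
  thus ?thesis by (simp only: add_left_cancel)
qed

lemma emb_eq_0 [simp]: "emb u = 0 \<longleftrightarrow> u = 0"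
  using emb_eq_0D by auto

lemma emb_uminus [simp]: "emb (- u) = - emb u"
  using emb_add[of u "- u"] by (simp add: add_eq_0_iff2)

lemma emb_diff [simp]: "emb (u - v) = emb u - emb v"
  using emb_add[of u "- v"] by simp

lemma emb_power [simp]: "emb (u ^ n) = emb u ^ n"
  by (induction n) simp_all

lemma emb_eq_iff [simp]: "emb u = emb v \<longleftrightarrow> u = v"
  using emb_eq_0[of "u - v"] by simp

definition F :: "'o set" where "F = {emb u / emb v | u v. v \<noteq> 0}"

definition local_ring :: "'k poly \<Rightarrow> 'o set" where
  "local_ring P = {emb u / emb v | u v. \<not> P dvd v}"

definition ring_at_infinity :: "'o set" where
  "ring_at_infinity = {emb u / emb v | u v. v \<noteq> 0 \<and> degree u \<le> degree v}"

lemma FI: "v \<noteq> 0 \<Longrightarrow> emb u / emb v \<in> F" by (auto simp: F_def)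

lemma FE: assumes "a \<in> F" obtains u v where "v \<noteq> 0" "a = emb u / emb v"
  using assms by (auto simp: F_def)

lemma emb_in_F [simp]: "emb u \<in> F"
  using FI[of 1 u] by simp

lemma subfield_F: "subfield_set F"
  unfolding subfield_set_def
proof (intro conjI ballI)
  show "1 \<in> F" using emb_in_F[of 1] by simp
  fix a assume "a \<in> F"
  then obtain u v where a: "v \<noteq> 0" "a = emb u / emb v" by (rule FE)
  show "inverse a \<in> F"
    using FI[of u v] FI[of 1 0] a by (cases "u = 0") auto
  fix b assume "b \<in> F"
  then obtain u' v' where b: "v' \<noteq> 0" "b = emb u' / emb v'" by (rule FE)
  have "a - b = emb (u * v' - u' * v) / emb (v * v')" "a * b = emb (u * u') / emb (v * v')"
    unfolding a(2) b(2) emb_diff emb_mult using a(1) b(1) by (simp_all add: field_simps)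
  moreover have "v * v' \<noteq> 0" using a b by simp
  ultimately show "a - b \<in> F" "a * b \<in> F"
    by (simp_all only: FI simp_thms)
qed

lemma F_coprimeE:
  assumes "a \<in> F" obtains u v where "v \<noteq> 0" "coprime u v" "a = emb u / emb v"
proof -
  obtain u v where a: "v \<noteq> 0" "a = emb u / emb v" using assms by (rule FE)
  define d where "d = gcd u v"
  have d: "d \<noteq> 0" using a(1) by (simp add: d_def)
  obtain u' v' where uv: "u = u' * d" "v = v' * d" "coprime u' v'"
    using gcd_coprime_exists[of u v] d unfolding d_def by blast
  show thesis
    by (rule that[of v' u']) (use a uv d in auto)
qed

lemma emb_divide_eq:
  assumes "emb u / emb v = emb u' / emb v'" "v \<noteq> 0" "v' \<noteq> 0"
  shows "u * v' = u' * v"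
proof -
  have "emb (u * v') = emb (u' * v)" using assms by (simp add: frac_eq_eq)
  thus ?thesis by (simp only: emb_eq_iff)
qed

subsection \<open>The finite places of the rational function field\<close>

lemma local_ringI: "\<not> P dvd v \<Longrightarrow> emb u / emb v \<in> local_ring P"
  by (auto simp: local_ring_def)

lemma emb_in_local_ring: "prime P \<Longrightarrow> emb u \<in> local_ring P"
  using local_ringI[of P 1 u] not_prime_unit[of P] by auto

lemma valuation_ring_local_ring:
  assumes P: "prime P"
  shows "valuation_ring F (local_ring P)"
  unfolding valuation_ring_def
proof (intro conjI ballI)
  show "local_ring P \<subseteq> F" unfolding local_ring_def F_def by auto
  show "1 \<in> local_ring P" using emb_in_local_ring[OF P, of 1] by simp
next
  fix a b assume "a \<in> local_ring P" "b \<in> local_ring P"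
  then obtain u v u' v' where a: "a = emb u / emb v" "\<not> P dvd v"
    and b: "b = emb u' / emb v'" "\<not> P dvd v'"
    by (auto simp: local_ring_def)
  have nz: "v \<noteq> 0" "v' \<noteq> 0" using a b by auto
  have v: "\<not> P dvd v * v'" using a b prime_dvd_multD[OF P, of v v'] by auto
  have "a - b = emb (u * v' - u' * v) / emb (v * v')" "a * b = emb (u * u') / emb (v * v')"
    unfolding a(1) b(1) emb_diff emb_mult using nz by (simp_all add: field_simps)
  thus "a - b \<in> local_ring P" "a * b \<in> local_ring P"
    by (simp_all only: local_ringI[OF v])
next
  fix a assume "a \<in> F"
  then obtain u v where a: "v \<noteq> 0" "coprime u v" "a = emb u / emb v" by (rule F_coprimeE)
  show "a \<in> local_ring P \<or> inverse a \<in> local_ring P"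
  proof (cases "P dvd v")
    case True
    hence "\<not> P dvd u"
      using coprime_common_divisor[OF a(2), of P] not_prime_unit[of P] P by auto
    hence "emb v / emb u \<in> local_ring P" by (rule local_ringI)
    thus ?thesis using a(3) by simp
  qed (use local_ringI a in auto)
qed

lemma max_ideal_local_ring_iff:
  assumes P: "prime P" and v: "\<not> P dvd v"
  shows "emb u / emb v \<in> max_ideal (local_ring P) \<longleftrightarrow> P dvd u"
proof
  assume m: "emb u / emb v \<in> max_ideal (local_ring P)"
  show "P dvd u"
  proof (rule ccontr)
    assume u: "\<not> P dvd u"
    hence "emb v / emb u \<in> local_ring P" by (rule local_ringI)
    moreover have "emb u / emb v \<noteq> 0" using u v by auto
    ultimately show False using m by (simp add: max_ideal_def)
  qed
next
  assume u: "P dvd u"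
  have "emb v / emb u \<notin> local_ring P" if "u \<noteq> 0"
  proof
    assume "emb v / emb u \<in> local_ring P"
    then obtain u' v' where *: "emb v / emb u = emb u' / emb v'" "\<not> P dvd v'"
      by (auto simp: local_ring_def)
    hence "v * v' = u' * u" using that by (intro emb_divide_eq) auto
    hence "P dvd v * v'" using u by simp
    thus False using prime_dvd_multD[OF P, of v v'] v *(2) by auto
  qed
  thus "emb u / emb v \<in> max_ideal (local_ring P)"
    using local_ringI[OF v, of u] by (cases "u = 0") (auto simp: max_ideal_def)
qed

lemma emb_in_max_ideal_iff: "prime P \<Longrightarrow> emb u \<in> max_ideal (local_ring P) \<longleftrightarrow> P dvd u"
  using max_ideal_local_ring_iff[of P 1 u] not_prime_unit[of P] by auto

text \<open>\<open>P\<close> is a uniformizer, in the form that \<open>eisenstein_generator\<close>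
  asks for.\<close>

lemma max_ideal_local_ring_divide:
  assumes P: "prime P" and a: "a \<in> max_ideal (local_ring P)"
  shows "a / emb P \<in> local_ring P"
proof -
  obtain u v where uv: "a = emb u / emb v" "\<not> P dvd v"
    using max_idealD[OF a] by (auto simp: local_ring_def)
  have "P dvd u" using a max_ideal_local_ring_iff[OF P uv(2), of u] uv(1) by simp
  then obtain w where "u = P * w" by (elim dvdE)
  hence "a / emb P = emb w / emb v" using P uv by auto
  thus ?thesis using local_ringI[OF uv(2)] by simp
qed

definition residues :: "'k poly \<Rightarrow> 'o set" where
  "residues P = emb ` {g. g = 0 \<or> degree g < degree P}"

lemma card_residues: "card (residues P) = poly_norm P"
  unfolding residues_def poly_norm_def
  by (subst card_image) (auto simp: card_poly_degree_less inj_on_def)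

lemma residues_complete:
  assumes P: "prime P" and a: "a \<in> local_ring P"
  obtains r where "r \<in> residues P" "a - r \<in> max_ideal (local_ring P)"
proof -
  obtain u v where uv: "a = emb u / emb v" "\<not> P dvd v"
    using a by (auto simp: local_ring_def)
  have "coprime v P"
    using prime_imp_coprime[OF P uv(2)] by (simp add: coprime_commute)
  hence bez: "fst (bezout_coefficients v P) * v + snd (bezout_coefficients v P) * P = 1"
    using bezout_coefficients_fst_snd[of v P] by (simp add: coprime_imp_gcd_eq_1)
  \<comment> \<open>\<open>w\<close> inverts \<open>v\<close> modulo \<open>P\<close>, so
    \<open>u / v\<close> has the residue of \<open>u * w\<close>.\<close>
  define w where "w = fst (bezout_coefficients v P)"
  have "1 - v * w = snd (bezout_coefficients v P) * P"
    unfolding bez [symmetric] w_def by (simp add: mult.commute)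
  hence w: "P dvd 1 - v * w" by (simp only: dvd_triv_right)
  define g where "g = (u * w) mod P"
  have "u - v * g = u * (1 - v * w) + v * (u * w - g)"
    by (simp add: algebra_simps)
  moreover have "P dvd u * w - g" unfolding g_def by (simp add: dvd_minus_mod)
  ultimately have "P dvd u - v * g" using w by (simp only: dvd_add dvd_mult)
  moreover have "a - emb g = emb (u - v * g) / emb v"
    unfolding emb_diff emb_mult using uv by (auto simp: diff_divide_distrib)
  ultimately have "a - emb g \<in> max_ideal (local_ring P)"
    by (simp only: max_ideal_local_ring_iff[OF P uv(2)])
  moreover have "emb g \<in> residues P"
  proof -
    have "P \<noteq> 0" using P by auto
    hence "g = 0 \<or> degree g < degree P"
      unfolding g_def by (rule degree_mod_less)
    thus ?thesis by (auto simp: residues_def)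
  qed
  ultimately show thesis using that by blast
qed

lemma residues_incongruent:
  assumes P: "prime P" and ab: "a \<in> residues P" "b \<in> residues P" "a - b \<in> max_ideal (local_ring P)"
  shows "a = b"
proof -
  obtain g h where gh: "a = emb g" "b = emb h" "g = 0 \<or> degree g < degree P"
    "h = 0 \<or> degree h < degree P"
    using ab unfolding residues_def by auto
  have dvd: "P dvd g - h"
    using ab(3) emb_in_max_ideal_iff[OF P, of "g - h"] by (simp add: gh)
  have "g - h = 0"
  proof (rule ccontr)
    assume nz: "g - h \<noteq> 0"
    hence "degree P \<le> degree (g - h)"
      by (rule dvd_imp_degree_le[OF dvd])
    moreover have "degree (g - h) < degree P"
      using gh(3,4) degree_prime_poly[OF P] by (intro degree_diff_less) auto
    ultimately show False by simp
  qed
  thus ?thesis by (simp add: gh)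
qed

lemma residues_subset: "prime P \<Longrightarrow> residues P \<subseteq> local_ring P"
  unfolding residues_def by (rule image_subsetI) (rule emb_in_local_ring)

subsection \<open>The place at infinity\<close>

lemma ring_at_infinity_iff:
  assumes "v \<noteq> 0"
  shows "emb u / emb v \<in> ring_at_infinity \<longleftrightarrow> degree u \<le> degree v"
proof
  assume "emb u / emb v \<in> ring_at_infinity"
  then obtain u' v' where *: "emb u / emb v = emb u' / emb v'" "v' \<noteq> 0"
      "degree u' \<le> degree v'"
    by (auto simp: ring_at_infinity_def)
  hence eq: "u * v' = u' * v" using assms by (intro emb_divide_eq) auto
  show "degree u \<le> degree v"
  proof (cases "u = 0")
    case False
    hence "u' \<noteq> 0" using eq *(2) by auto
    hence "degree u + degree v' = degree u' + degree v"
      using arg_cong[OF eq, of degree] False assms *(2) by (simp add: Polynomial.degree_mult_eq)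
    thus ?thesis using *(3) by simp
  qed simp
qed (use assms in \<open>auto simp: ring_at_infinity_def\<close>)

lemma valuation_ring_infinity: "valuation_ring F ring_at_infinity"
  unfolding valuation_ring_def
proof (intro conjI ballI)
  show "ring_at_infinity \<subseteq> F" unfolding ring_at_infinity_def F_def by auto
  show "1 \<in> ring_at_infinity" using ring_at_infinity_iff[of 1 1] by simp
next
  fix a b assume "a \<in> ring_at_infinity" "b \<in> ring_at_infinity"
  then obtain u v u' v' where a: "a = emb u / emb v" "v \<noteq> 0" "degree u \<le> degree v"
    and b: "b = emb u' / emb v'" "v' \<noteq> 0" "degree u' \<le> degree v'"
    by (auto simp: ring_at_infinity_def)
  have "a - b = emb (u * v' - u' * v) / emb (v * v')" "a * b = emb (u * u') / emb (v * v')"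
    unfolding a(1) b(1) emb_diff emb_mult using a(2) b(2) by (simp_all add: field_simps)
  moreover have "degree (u * v' - u' * v) \<le> degree (v * v')"
    using a b by (intro degree_diff_le order.trans[OF degree_mult_le]) (auto simp: Polynomial.degree_mult_eq)
  moreover have "degree (u * u') \<le> degree (v * v')"
    using a b by (intro order.trans[OF degree_mult_le]) (auto simp: Polynomial.degree_mult_eq)
  moreover have "v * v' \<noteq> 0" using a b by simp
  ultimately show "a - b \<in> ring_at_infinity" "a * b \<in> ring_at_infinity"
    by (simp_all only: ring_at_infinity_iff simp_thms)
next
  fix a assume "a \<in> F"
  then obtain u v where a: "v \<noteq> 0" "a = emb u / emb v" by (rule FE)
  show "a \<in> ring_at_infinity \<or> inverse a \<in> ring_at_infinity"
  proof (cases "u = 0")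
    case False
    thus ?thesis
      using ring_at_infinity_iff[of v u] ring_at_infinity_iff[of u v] a by (auto simp: nat_le_linear)
  qed (use ring_at_infinity_iff[of 1 0] a in auto)
qed

lemma max_ideal_infinity_iff:
  assumes "v \<noteq> 0"
  shows "emb u / emb v \<in> max_ideal ring_at_infinity \<longleftrightarrow> u = 0 \<or> degree u < degree v"
  using ring_at_infinity_iff[OF assms, of u] ring_at_infinity_iff[of u v] assms
  by (cases "u = 0") (auto simp: max_ideal_def)

text \<open>\<open>1 / x\<close> is a uniformizer at infinity.\<close>

lemma max_ideal_infinity_divide:
  assumes a: "a \<in> max_ideal ring_at_infinity"
  shows "a / (1 / emb [:0, 1:]) \<in> ring_at_infinity"
proof -
  obtain u v where uv: "a = emb u / emb v" "v \<noteq> 0"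
    using max_idealD[OF a] by (auto simp: ring_at_infinity_def)
  have "degree (u * [:0, 1:]) \<le> degree v"
    using a max_ideal_infinity_iff[OF uv(2), of u] degree_mult_le[of u "[:0, 1:]"]
    by (auto simp: uv(1))
  moreover have "a / (1 / emb [:0, 1:]) = emb (u * [:0, 1:]) / emb v"
    unfolding emb_mult uv(1) by simp
  ultimately show ?thesis by (simp only: ring_at_infinity_iff[OF uv(2)])
qed

lemma constants_complete:
  assumes a: "a \<in> ring_at_infinity"
  obtains c where "a - emb [:c:] \<in> max_ideal ring_at_infinity"
proof -
  obtain u v where uv: "a = emb u / emb v" "v \<noteq> 0" "degree u \<le> degree v"
    using a by (auto simp: ring_at_infinity_def)
  \<comment> \<open>The value of \<open>u / v\<close> at infinity, which is 0 if \<open>u\<close>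
    has the smaller degree.\<close>
  define c where "c = Polynomial.coeff u (degree v) / lead_coeff v"
  have "degree (u - [:c:] * v) \<le> degree v"
    using uv(3) by (intro degree_diff_le) auto
  moreover have "Polynomial.coeff (u - [:c:] * v) (degree v) = 0"
    using uv(2) by (simp add: c_def)
  ultimately have "u - [:c:] * v = 0 \<or> degree (u - [:c:] * v) < degree v"
    by (rule eq_zero_or_degree_less)
  moreover have "a - emb [:c:] = emb (u - [:c:] * v) / emb v"
    unfolding emb_diff emb_mult using uv by (simp add: diff_divide_distrib)
  ultimately show thesis
    using that[of c] by (simp only: max_ideal_infinity_iff[OF uv(2)])
qed

lemma constant_in_max_ideal_infinity: "emb [:c:] \<in> max_ideal ring_at_infinity \<Longrightarrow> c = 0"
  using max_ideal_infinity_iff[of 1 "[:c:]"] by simp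

lemma constant_in_ring_at_infinity: "emb [:c:] \<in> ring_at_infinity"
  using ring_at_infinity_iff[of 1 "[:c:]"] by simp

end

section \<open>Classification of the valuation rings of the rational function field\<close>

context poly_embedding
begin

abbreviation x where "x \<equiv> emb [:0, 1:]"

lemma emb_pCons: "emb (pCons a g) = emb [:a:] + x * emb g"
proof -
  have "pCons a g = [:a:] + [:0, 1:] * g" by simp
  thus ?thesis by (simp only: emb_add emb_mult)
qed

lemma emb_const_inverse: "c \<noteq> 0 \<Longrightarrow> inverse (emb [:c:]) = emb [:inverse c:]"
  by (intro inverse_unique) (simp add: emb_mult [symmetric] one_pCons [symmetric] del: emb_mult)

text \<open>If \<open>c\<close> had a pole, its inverse would be integral; but \<open>c\<close> is
  the power of its own inverse with exponent \<open>CARD('k) - 2\<close>.\<close>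

lemma constants_in_valuation_ring:
  assumes R: "valuation_ring F R"
  shows "emb [:c:] \<in> R"
proof (rule ccontr)
  assume c: "emb [:c:] \<notin> R"
  hence c0: "c \<noteq> 0" using valuation_ringD(2)[OF R] by auto
  have "emb [:inverse c:] \<in> R"
    using valuation_ringD(8)[OF R _ c] emb_const_inverse[OF c0] by simp
  hence "emb [:inverse c:] ^ (CARD('k) - 2) \<in> R"
    using valuation_ringD(9)[OF R] by blast
  moreover have "inverse c ^ (CARD('k) - 2) = c"
  proof -
    have "CARD('k) = (CARD('k) - 2) + 2" using card_field_ge_2[where 'k = 'k] by simp
    hence "inverse c ^ (CARD('k) - 2 + 2) = inverse c"
      using finite_field_power_card_eq_same[of "inverse c"] by simp
    hence "inverse c ^ (CARD('k) - 2) * inverse c * inverse c = inverse c"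
      by (simp only: power_add power2_eq_square mult.assoc)
    hence "inverse c ^ (CARD('k) - 2) * inverse c = 1" using c0 by simp
    thus ?thesis using c0 by (simp add: field_simps)
  qed
  moreover have "emb [:inverse c:] ^ n = emb [:inverse c ^ n:]" for n
    by (simp only: emb_power [symmetric] poly_const_pow)
  ultimately show False using c by simp
qed

lemma constants_unit:
  assumes R: "valuation_ring F R" and c: "c \<noteq> 0"
  shows "emb [:c:] \<notin> max_ideal R"
  using constants_in_valuation_ring[OF R, of "inverse c"] emb_const_inverse[OF c] c
  by (simp add: max_ideal_def)

text \<open>Some nonzero polynomial is a non-unit of \<open>R\<close>, or \<open>R\<close> would be
  all of \<open>F\<close>. One of least degree has a prime factor \<open>P\<close> in the maximal
  ideal, since its cofactor has smaller degree; by Bezout every polynomial prime to \<open>P\<close>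
  is then a unit.\<close>

lemma valuation_ring_finite_place:
  assumes R: "valuation_ring F R" and neq: "R \<noteq> F" and xR: "x \<in> R"
  obtains P where "prime P" "R = local_ring P"
proof -
  note Fs = subfield_F
  have emb_R: "emb g \<in> R" for g
  proof (induction g)
    case (pCons a g)
    thus ?case
      using constants_in_valuation_ring[OF R, of a] valuation_ringD(4,5)[OF R] xR
      by (simp only: emb_pCons[of a g])
  qed (use valuation_ringD(2)[OF R] in simp)
  have "\<exists>g. g \<noteq> 0 \<and> emb g \<in> max_ideal R"
  proof (rule ccontr)
    assume *: "\<not> ?thesis"
    have "F \<subseteq> R"
    proof
      fix a assume "a \<in> F"
      then obtain u v where a: "v \<noteq> 0" "a = emb u / emb v" by (rule FE)
      have "inverse (emb v) \<in> R" using unit_inverse[OF emb_R[of v]] * a(1) by auto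
      thus "a \<in> R" using valuation_ringD(4)[OF R emb_R[of u]] a(2) by (simp add: divide_inverse)
    qed
    thus False using neq valuation_ringD(7)[OF R] by auto
  qed
  then obtain g0 where g0: "g0 \<noteq> 0 \<and> emb g0 \<in> max_ideal R" by blast
  define g where "g = (ARG_MIN degree g. g \<noteq> 0 \<and> emb g \<in> max_ideal R)"
  have g: "g \<noteq> 0" "emb g \<in> max_ideal R"
    and min: "\<And>w. w \<noteq> 0 \<Longrightarrow> emb w \<in> max_ideal R \<Longrightarrow> degree g \<le> degree w"
    using arg_min_nat_lemma[of "\<lambda>g. g \<noteq> 0 \<and> emb g \<in> max_ideal R", OF g0] unfolding g_def by auto
  have "\<not> is_unit g"
  proof
    assume "is_unit g"
    then obtain w where w: "1 = g * w" by (elim dvdE)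
    have "emb g * emb w = 1" using arg_cong[OF w [symmetric], of emb] by (simp only: emb_mult emb_1)
    hence "1 \<in> max_ideal R" using max_ideal_mult[OF R Fs g(2) emb_R[of w]] by simp
    thus False using one_notin_max_ideal[OF R Fs] by simp
  qed
  then obtain P where P: "P dvd g" "prime P" using prime_divisor_exists[OF g(1)] by blast
  then obtain w where w: "g = P * w" by (elim dvdE)
  have nz: "P \<noteq> 0" "w \<noteq> 0" using g(1) w by auto
  have "emb P * emb w \<in> max_ideal R" using g(2) w by simp
  hence "emb P \<in> max_ideal R \<or> emb w \<in> max_ideal R"
    by (rule max_ideal_prime[OF R Fs emb_R emb_R])
  moreover have "emb w \<notin> max_ideal R"
    using min[OF nz(2)] degree_prime_poly[OF P(2)] nz by (auto simp: w Polynomial.degree_mult_eq)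
  ultimately have Pm: "emb P \<in> max_ideal R" by simp
  have unit: "emb v \<notin> max_ideal R" if v: "\<not> P dvd v" for v
  proof
    assume m: "emb v \<in> max_ideal R"
    have "coprime P v" using prime_imp_coprime[OF P(2) v] .
    hence "fst (bezout_coefficients P v) * P + snd (bezout_coefficients P v) * v = 1"
      using bezout_coefficients_fst_snd[of P v] by (simp add: coprime_imp_gcd_eq_1)
    hence "emb (fst (bezout_coefficients P v)) * emb P + emb (snd (bezout_coefficients P v)) * emb v = 1"
      by (simp only: emb_mult [symmetric] emb_add [symmetric] emb_1)
    moreover have "emb (fst (bezout_coefficients P v)) * emb P \<in> max_ideal R"
      by (rule max_ideal_mult'[OF R Fs emb_R Pm])
    moreover have "emb (snd (bezout_coefficients P v)) * emb v \<in> max_ideal R"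
      by (rule max_ideal_mult'[OF R Fs emb_R m])
    ultimately have "1 \<in> max_ideal R" using max_ideal_add[OF R Fs] by metis
    thus False using one_notin_max_ideal[OF R Fs] by simp
  qed
  have "R = local_ring P"
  proof (intro equalityI subsetI)
    fix a assume "a \<in> local_ring P"
    then obtain u v where uv: "a = emb u / emb v" "\<not> P dvd v" by (auto simp: local_ring_def)
    have "inverse (emb v) \<in> R" using unit_inverse[OF emb_R unit[OF uv(2)]] .
    thus "a \<in> R" using valuation_ringD(4)[OF R emb_R[of u]] uv by (simp add: divide_inverse)
  next
    fix a assume a: "a \<in> R"
    obtain u v where uv: "v \<noteq> 0" "coprime u v" "a = emb u / emb v"
      using F_coprimeE[OF valuation_ringD(7)[OF R a]] .
    have "\<not> P dvd v"
    proof
      assume v: "P dvd v"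
      hence u: "\<not> P dvd u"
        using coprime_common_divisor[OF uv(2), of P] not_prime_unit[of P] P(2) by auto
      obtain v' where v': "v = P * v'" using v by (elim dvdE)
      have "emb v \<in> max_ideal R" using max_ideal_mult[OF R Fs Pm emb_R[of v']] by (simp add: v')
      hence "a * emb v \<in> max_ideal R" by (rule max_ideal_mult'[OF R Fs a])
      thus False using unit[OF u] uv by simp
    qed
    thus "a \<in> local_ring P" using local_ringI uv(3) by simp
  qed
  thus thesis using that P(2) by blast
qed

text \<open>With \<open>t = 1 / x\<close> in the maximal ideal, \<open>emb g * t ^ degree g\<close>
  is the leading coefficient plus multiples of \<open>t\<close>, hence a unit; so degrees decide
  membership in \<open>R\<close>.\<close>

lemma valuation_ring_infinite_place:
  assumes R: "valuation_ring F R" and xR: "x \<notin> R"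
  shows "R = ring_at_infinity"
proof -
  note Fs = subfield_F
  define t where "t = inverse x"
  have x0: "x \<noteq> 0" by simp
  hence xt: "x * t = 1" by (simp add: t_def)
  have t: "t \<in> max_ideal R" unfolding t_def using max_ideal_inverse[OF R _ xR] by simp
  have tR: "t \<in> R" "t ^ n \<in> R" for n
    using max_idealD[OF t] valuation_ringD(9)[OF R] by auto
  have in_R: "emb g * t ^ n \<in> R" if "degree g \<le> n" for g n
    using that
  proof (induction g arbitrary: n)
    case (pCons a g)
    have a: "emb [:a:] * t ^ n \<in> R"
      by (rule valuation_ringD(4)[OF R constants_in_valuation_ring[OF R] tR(2)])
    show ?case
    proof (cases "g = 0")
      case True
      thus ?thesis using a by simp
    next
      case False
      then obtain m where n: "n = Suc m" "degree g \<le> m"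
        using pCons.prems by (cases n) auto
      have "emb (pCons a g) * t ^ n = emb [:a:] * t ^ n + emb g * t ^ m * (x * t)"
        unfolding emb_pCons[of a g] n(1) by (simp add: algebra_simps)
      also have "\<dots> \<in> R"
        unfolding xt using valuation_ringD(5)[OF R a pCons.IH[OF n(2)]] by simp
      finally show ?thesis .
    qed
  qed (use valuation_ringD(2)[OF R] in simp)
  have unit: "emb g * t ^ degree g \<notin> max_ideal R" if "g \<noteq> 0" for g
    using that
  proof (induction g)
    case (pCons a g)
    show ?case
    proof (cases "g = 0")
      case True
      thus ?thesis using constants_unit[OF R, of a] pCons.hyps by simp
    next
      case False
      define m where "m = degree g"
      have deg: "degree (pCons a g) = Suc m" using False by (simp add: m_def)
      have eq: "emb (pCons a g) * t ^ Suc m = emb g * t ^ m * (x * t) + emb [:a:] * t ^ m * t"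
        unfolding emb_pCons[of a g] by (simp add: algebra_simps)
      have "emb [:a:] * t ^ m * t \<in> max_ideal R"
        using valuation_ringD(4)[OF R constants_in_valuation_ring[OF R] tR(2)]
        by (intro max_ideal_mult'[OF R Fs _ t])
      moreover have "emb g * t ^ m \<in> R" "emb g * t ^ m \<notin> max_ideal R"
        using in_R pCons.IH[OF False] by (auto simp: m_def)
      ultimately show ?thesis
        unfolding deg eq xt using unit_add[OF R Fs] by simp
    qed
  qed simp
  show ?thesis
  proof (intro equalityI subsetI)
    fix a assume "a \<in> ring_at_infinity"
    then obtain u v where uv: "a = emb u / emb v" "v \<noteq> 0" "degree u \<le> degree v"
      by (auto simp: ring_at_infinity_def)
    have "inverse (emb v * t ^ degree v) \<in> R"
      using unit_inverse[OF in_R unit[OF uv(2)]] by simp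
    hence "emb u * t ^ degree v * inverse (emb v * t ^ degree v) \<in> R"
      by (rule valuation_ringD(4)[OF R in_R[OF uv(3)]])
    moreover have "t \<noteq> 0" using x0 by (simp add: t_def)
    ultimately show "a \<in> R" unfolding uv(1) by (simp add: field_simps)
  next
    fix a assume a: "a \<in> R"
    obtain u v where uv: "v \<noteq> 0" "a = emb u / emb v"
      using FE[OF valuation_ringD(7)[OF R a]] .
    have "degree u \<le> degree v"
    proof (rule ccontr)
      assume "\<not> ?thesis"
      then obtain m where m: "degree u = Suc m" "degree v \<le> m"
        by (cases "degree u") auto
      have "a * (emb v * t ^ m) * t \<in> max_ideal R"
        using valuation_ringD(4)[OF R a in_R[OF m(2)]] by (intro max_ideal_mult'[OF R Fs _ t])
      moreover have "a * (emb v * t ^ m) * t = emb u * t ^ degree u"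
        using uv m by (simp add: field_simps)
      moreover have "u \<noteq> 0" using m by auto
      ultimately show False using unit by simp
    qed
    thus "a \<in> ring_at_infinity" using ring_at_infinity_iff[OF uv(1)] uv(2) by simp
  qed
qed

end

section \<open>Quadratic extensions ramified at infinity\<close>

text \<open>Eisenstein's irreducibility argument: a root in \<open>F\<close> would be integral, then
  in the maximal ideal, then divisible by \<open>\<pi>\<close>, and cancelling \<open>\<pi>\<close>
  in the equation would put \<open>g\<close> into the maximal ideal.\<close>

lemma eisenstein_root_notin:
  assumes F: "subfield_set F" and R: "valuation_ring F R" and yy: "y * y = h * y + \<pi> * g"
    and \<pi>: "\<pi> \<in> max_ideal R" "\<pi> \<noteq> 0" "\<And>a. a \<in> max_ideal R \<Longrightarrow> a / \<pi> \<in> R"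
    and h: "h \<in> max_ideal R" and g: "g \<in> R" "g \<notin> max_ideal R"
  shows "y \<notin> F"
proof
  assume yF: "y \<in> F"
  have f: "\<pi> * g \<in> max_ideal R" by (rule max_ideal_mult[OF R F \<pi>(1) g(1)])
  have hR: "h \<in> R" by (rule max_idealD[OF h])
  have yR: "y \<in> R"
  proof (rule ccontr)
    assume "y \<notin> R"
    hence u: "inverse y \<in> max_ideal R" and "y \<noteq> 0"
      using max_ideal_inverse[OF R yF] valuation_ringD(2)[OF R] by auto
    have "1 = (y * y) * (inverse y * inverse y)" using \<open>y \<noteq> 0\<close> by (simp add: field_simps)
    also have "\<dots> = h * inverse y + \<pi> * g * (inverse y * inverse y)"
      unfolding yy using \<open>y \<noteq> 0\<close> by (simp add: algebra_simps)
    also have "\<dots> \<in> max_ideal R"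
      using max_idealD[OF u] valuation_ringD(4)[OF R]
      by (intro max_ideal_add[OF R F] max_ideal_mult[OF R F h] max_ideal_mult[OF R F f])
    finally show False using one_notin_max_ideal[OF R F] by simp
  qed
  have "y * (y - h) \<in> max_ideal R"
    using f by (simp add: right_diff_distrib yy mult.commute)
  hence "y \<in> max_ideal R \<or> y - h \<in> max_ideal R"
    by (rule max_ideal_prime[OF R F yR valuation_ringD(3)[OF R yR hR]])
  hence ym: "y \<in> max_ideal R"
    using max_ideal_add[OF R F _ h, of "y - h"] by auto
  define y' where "y' = y / \<pi>"
  have y': "y' \<in> R" "y = \<pi> * y'" using \<pi>(2,3) ym by (auto simp: y'_def)
  have "\<pi> * (y * y' - h * y') = \<pi> * g"
    using yy y'(2) by (simp add: algebra_simps)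
  hence "g = y * y' - h * y'" using \<pi>(2) by simp
  also have "\<dots> \<in> max_ideal R"
    by (intro max_ideal_diff[OF R F] max_ideal_mult[OF R F _ y'(1)] ym h)
  finally show False using g(2) by simp
qed

lemma quadratic_extension_adjoin:
  assumes F: "subfield_set F" and y: "y \<notin> F" and yy: "y * y = h * y + f" and hf: "h \<in> F" "f \<in> F"
  shows "quadratic_extension F {a + b * y | a b. a \<in> F \<and> b \<in> F}"
proof -
  define K where "K = {a + b * y | a b. a \<in> F \<and> b \<in> F}"
  note Fs = subfield_setD[OF F]
  have KI: "a + b * y \<in> K" if "a \<in> F" "b \<in> F" for a b using that by (auto simp: K_def)
  have FK: "F \<subseteq> K" using KI[of _ 0] Fs(2) by auto
  have "subfield_set K"
    unfolding subfield_set_def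
  proof (intro conjI ballI)
    show "1 \<in> K" using FK Fs(1) by auto
    fix u assume "u \<in> K"
    then obtain a b where u: "u = a + b * y" "a \<in> F" "b \<in> F" by (auto simp: K_def)
    show "inverse u \<in> K"
    proof (cases "u = 0")
      case False
      \<comment> \<open>\<open>n\<close> is the norm of \<open>u\<close>. It is nonzero, because a
        vanishing conjugate would put \<open>y\<close> into \<open>F\<close> or make
        \<open>u\<close> zero.\<close>
      define n where "n = a * a + h * a * b - b * b * f"
      have n: "u * (a + h * b - b * y) = n"
        using yy by (simp add: u n_def algebra_simps)
      have nF: "n \<in> F" unfolding n_def using u hf by (intro Fs)
      have "a + h * b - b * y \<noteq> 0"
      proof
        assume *: "a + h * b - b * y = 0"
        have "b = 0"
        proof (rule ccontr)
          assume "b \<noteq> 0"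
          hence "y = (a + h * b) / b" using * by (simp add: field_simps)
          moreover have "(a + h * b) / b \<in> F" using u hf by (intro Fs)
          ultimately show False using y by simp
        qed
        thus False using * u False by simp
      qed
      hence n0: "n \<noteq> 0" using n False by auto
      have "u * ((a + h * b) / n + - (b / n) * y) = u * (a + h * b - b * y) / n"
        by (simp add: diff_divide_distrib algebra_simps)
      also have "\<dots> = 1" using n n0 by simp
      finally have "inverse u = (a + h * b) / n + - (b / n) * y" by (rule inverse_unique)
      moreover have "(a + h * b) / n \<in> F" "- (b / n) \<in> F" using u hf nF by (auto intro!: Fs)
      ultimately show ?thesis by (simp only: KI)
    qed (use FK Fs(2) in auto)
    fix v assume "v \<in> K"
    then obtain c d where v: "v = c + d * y" "c \<in> F" "d \<in> F" by (auto simp: K_def)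
    have "u - v = (a - c) + (b - d) * y" by (simp add: u v algebra_simps)
    moreover have "a - c \<in> F" "b - d \<in> F" using u v by (auto intro!: Fs)
    ultimately show "u - v \<in> K" by (simp only: KI)
    have "u * v = a * c + (a * d + b * c) * y + b * d * (y * y)"
      by (simp add: u v algebra_simps)
    also have "\<dots> = (a * c + b * d * f) + (a * d + b * c + b * d * h) * y"
      unfolding yy by (simp add: algebra_simps)
    finally have "u * v = (a * c + b * d * f) + (a * d + b * c + b * d * h) * y" .
    moreover have "a * c + b * d * f \<in> F" "a * d + b * c + b * d * h \<in> F"
      using u v hf by (auto intro!: Fs)
    ultimately show "u * v \<in> K" by (simp only: KI)
  qed
  moreover have "\<exists>a\<in>F. \<exists>b\<in>F. z = a + b * w" if w: "w \<in> K" "w \<notin> F" and z: "z \<in> K" for w z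
  proof -
    obtain c d where cd: "w = c + d * y" "c \<in> F" "d \<in> F" using w by (auto simp: K_def)
    obtain a b where ab: "z = a + b * y" "a \<in> F" "b \<in> F" using z by (auto simp: K_def)
    have "d \<noteq> 0" using w(2) cd by auto
    hence "z = (a - b / d * c) + b / d * w" by (simp add: ab cd field_simps)
    moreover have "a - b / d * c \<in> F" "b / d \<in> F" using ab cd by (auto intro!: Fs)
    ultimately show ?thesis by blast
  qed
  ultimately have "quadratic_extension F K"
    using F FK by unfold_locales auto
  thus ?thesis by (simp only: K_def)
qed

locale ramified_quadratic = poly_embedding emb
  for emb :: "'k::{finite_field,field_gcd} poly \<Rightarrow> 'o::field" +
  fixes y :: 'o and h f :: "'k poly"
  assumes yy: "y * y = emb h * y + emb f"
    and odd_degree: "odd (degree f)"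
    and degree_less: "2 * degree h < degree f"
begin

text \<open>Since \<open>2 * m = degree f + 1\<close>, dividing \<open>y\<close> by
  \<open>x ^ m\<close> gives an Eisenstein equation at infinity: the constant term becomes
  \<open>1 / x\<close> times a unit, and \<open>2 * degree h < degree f\<close> means
  \<open>degree h < m\<close>.\<close>

definition m where "m = Suc (degree f) div 2"
definition y_inf where "y_inf = y / x ^ m"
definition h_inf where "h_inf = emb h / x ^ m"
definition g_inf where "g_inf = emb f / x ^ degree f"

lemma degree_f: "degree f + 1 = 2 * m"
  using odd_degree by (auto simp: m_def elim!: oddE)

lemma x_power: "x ^ n = emb ([:0, 1:] ^ n)"
  by (simp only: emb_power)

lemma degree_x_power: "degree ([:0, 1:] ^ n :: 'k poly) = n"
  by (simp add: Polynomial.degree_power_eq)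

lemma inverse_x_in_max_ideal: "1 / x \<in> max_ideal ring_at_infinity"
  using max_ideal_infinity_iff[of "[:0, 1:]" 1] by simp

lemma h_inf_in_max_ideal: "h_inf \<in> max_ideal ring_at_infinity"
  unfolding h_inf_def x_power using degree_less degree_f
  by (subst max_ideal_infinity_iff) (simp_all only: degree_x_power, simp_all)

lemma g_inf: "g_inf \<in> ring_at_infinity" "g_inf \<notin> max_ideal ring_at_infinity"
proof -
  have nz: "[:0, 1:] ^ n \<noteq> (0 :: 'k poly)" for n by simp
  have "f \<noteq> 0" using odd_degree by auto
  thus "g_inf \<in> ring_at_infinity" "g_inf \<notin> max_ideal ring_at_infinity"
    unfolding g_inf_def x_power
    by (simp_all only: ring_at_infinity_iff[OF nz] max_ideal_infinity_iff[OF nz] degree_x_power) simp_all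
qed

lemma yy_inf: "y_inf * y_inf = h_inf * y_inf + 1 / x * g_inf"
proof -
  have "y_inf * y_inf = (y * y) / (x ^ m * x ^ m)" by (simp add: y_inf_def)
  also have "\<dots> = h_inf * y_inf + emb f / (x ^ m * x ^ m)"
    unfolding yy by (simp add: h_inf_def y_inf_def add_divide_distrib)
  also have "x ^ m * x ^ m = x * x ^ degree f"
    using degree_f by (simp only: power_add [symmetric] power_Suc [symmetric]) (simp add: mult_2)
  finally show ?thesis by (simp add: g_inf_def)
qed

lemma y_inf_notin: "y_inf \<notin> F"
  by (rule eisenstein_root_notin[OF subfield_F valuation_ring_infinity yy_inf inverse_x_in_max_ideal _
        max_ideal_infinity_divide h_inf_in_max_ideal g_inf]) simp_all

lemma y_notin: "y \<notin> F"
  using y_inf_notin subfield_setD(8,9)[OF subfield_F] emb_in_F[of "[:0, 1:]"] by (auto simp: y_inf_def)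

definition K where "K = {a + b * y | a b. a \<in> F \<and> b \<in> F}"

sublocale quadratic_extension F K
  unfolding K_def by (rule quadratic_extension_adjoin[OF subfield_F y_notin yy]) simp_all

lemma y_in_K: "y \<in> K"
  unfolding K_def using subfield_setD(1,2)[OF F] by (intro CollectI exI[of _ 0] exI[of _ 1]) simp

sublocale infinite: eisenstein_generator F K y_inf h_inf "1 / x * g_inf" ring_at_infinity "1 / x" g_inf
proof unfold_locales
  show "y_inf \<in> K"
    unfolding y_inf_def using y_in_K FK emb_in_F[of "[:0, 1:]"] by (intro subfield_setD(8,9)[OF K]) auto
  show "y_inf \<notin> F" by (rule y_inf_notin)
  show "y_inf * y_inf = h_inf * y_inf + 1 / x * g_inf" by (rule yy_inf)
  show "valuation_ring F ring_at_infinity" by (rule valuation_ring_infinity)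
  show "h_inf \<in> ring_at_infinity" "h_inf \<in> max_ideal ring_at_infinity"
    using h_inf_in_max_ideal max_idealD by auto
  show "1 / x * g_inf \<in> ring_at_infinity"
    using max_ideal_mult[OF valuation_ring_infinity subfield_F inverse_x_in_max_ideal g_inf(1)]
    by (rule max_idealD)
  show "1 / x \<in> max_ideal ring_at_infinity" by (rule inverse_x_in_max_ideal)
  show "a / (1 / x) \<in> ring_at_infinity" if "a \<in> max_ideal ring_at_infinity" for a
    by (rule max_ideal_infinity_divide[OF that])
qed (use g_inf in simp_all)

abbreviation W_inf where "W_inf \<equiv> infinite.W"

lemma residue_W_inf:
  assumes "z \<in> W_inf" obtains c where "z - emb [:c:] \<in> max_ideal W_inf"
proof -
  have m: "max_ideal W_inf \<inter> F = max_ideal ring_at_infinity"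
    using max_ideal_Int[OF infinite.valuation_ring_W] infinite.W_Int by simp
  obtain a where a: "a \<in> ring_at_infinity" "z - a \<in> max_ideal W_inf"
    using infinite.residue_W[OF assms] .
  obtain c where "a - emb [:c:] \<in> max_ideal ring_at_infinity" using constants_complete[OF a(1)] .
  hence "(z - a) + (a - emb [:c:]) \<in> max_ideal W_inf"
    using m by (intro max_ideal_add[OF infinite.valuation_ring_W K a(2)]) auto
  thus thesis using that[of c] by (simp add: algebra_simps)
qed

lemma constant_in_max_ideal_W_inf:
  assumes "emb [:c:] \<in> max_ideal W_inf" shows "c = 0"
proof -
  have "emb [:c:] \<in> max_ideal W_inf \<inter> F" using assms by simp
  hence "emb [:c:] \<in> max_ideal ring_at_infinity"
    using max_ideal_Int[OF infinite.valuation_ring_W] infinite.W_Int by simp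
  thus ?thesis by (rule constant_in_max_ideal_infinity)
qed

lemma place_norm_infinity: "place_norm (set_ring K) W_inf = CARD('k)"
proof -
  have "place_norm (set_ring K) W_inf = card (range (\<lambda>c. emb [:c:]))"
  proof (rule place_norm_eq_representatives[OF K infinite.valuation_ring_W])
    show "\<exists>a\<in>range (\<lambda>c. emb [:c:]). z - a \<in> max_ideal W_inf" if zW: "z \<in> W_inf" for z
    proof -
      obtain c where "z - emb [:c:] \<in> max_ideal W_inf" using residue_W_inf[OF zW] .
      thus ?thesis by (rule rev_bexI[OF rangeI])
    qed
    show "range (\<lambda>c. emb [:c:]) \<subseteq> W_inf"
      using constant_in_ring_at_infinity infinite.R_subset_W by auto
    fix a b assume ab: "a \<in> range (\<lambda>c. emb [:c:])" "b \<in> range (\<lambda>c. emb [:c:])" "a - b \<in> max_ideal W_inf"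
    then obtain c d where cd: "a = emb [:c:]" "b = emb [:d:]" by auto
    hence "emb [:c - d:] \<in> max_ideal W_inf" using ab(3) emb_diff[of "[:c:]" "[:d:]"] by simp
    hence "c - d = 0" by (rule constant_in_max_ideal_W_inf)
    thus "a = b" using cd by simp
  qed
  also have "\<dots> = CARD('k)" by (rule card_image) (auto intro!: injI)
  finally show ?thesis .
qed

text \<open>Whether \<open>x\<close> has a pole decides between infinity and a prime
  \<open>P\<close>. A place cannot contain all of \<open>F\<close>, because \<open>y\<close> would
  then be integral and the ring would be \<open>K\<close>.\<close>

lemma place_cases:
  assumes V: "valuation_ring K V" "V \<noteq> K"
  obtains "V = W_inf" | P where "prime P" "V \<inter> F = local_ring P"
proof (cases "x \<in> V")
  case False
  hence "V \<inter> F = ring_at_infinity"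
    by (intro valuation_ring_infinite_place[OF valuation_ring_Int[OF V(1)]]) auto
  thus thesis using that(1) infinite.eisenstein_unique[OF V(1)] by blast
next
  case True
  have neq: "V \<inter> F \<noteq> F"
  proof
    assume "V \<inter> F = F"
    hence FV: "a \<in> V" if "a \<in> F" for a using that by auto
    have "y \<in> V"
      using integral_in_valuation_ring[OF V(1) y_in_K, of "emb h" "- emb f"] yy
        FV[of "emb h"] FV[of "- emb f"] emb_in_F[of "- f"] by simp
    hence "K \<subseteq> V" unfolding K_def using FV valuation_ringD(4,5)[OF V(1)] by blast
    thus False using V valuation_ringD(7)[OF V(1)] by auto
  qed
  have xV: "x \<in> V \<inter> F" using True by simp
  obtain P where "prime P" "V \<inter> F = local_ring P"
    using valuation_ring_finite_place[OF valuation_ring_Int[OF V(1)] neq xV] .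
  thus thesis by (rule that(2))
qed

lemma generator_at_finite_place:
  assumes P: "prime P"
  shows "quadratic_generator F K y (emb h) (emb f) (local_ring P)"
  by unfold_locales (use y_in_K y_notin yy valuation_ring_local_ring[OF P] emb_in_local_ring[OF P] in auto)

text \<open>The residues modulo \<open>P\<close> remain incongruent in \<open>V\<close>.\<close>

lemma place_norm_ge:
  assumes P: "prime P" and V: "valuation_ring K V" "V \<inter> F = local_ring P"
  shows "place_norm (set_ring K) V = 0 \<or> poly_norm P \<le> place_norm (set_ring K) V"
proof -
  have m: "max_ideal V \<inter> F = max_ideal (local_ring P)" using max_ideal_Int[OF V(1)] V(2) by simp
  have sub: "residues P \<subseteq> V \<inter> F" using residues_subset[OF P] V(2) by simp
  have "a = b" if "a \<in> residues P" "b \<in> residues P" "a - b \<in> max_ideal V" for a b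
  proof -
    have "a - b \<in> max_ideal V \<inter> F" using that sub subfield_setD(3)[OF F] by auto
    thus ?thesis using residues_incongruent[OF P that(1,2)] m by simp
  qed
  thus ?thesis
    using place_norm_ge_representatives[OF K V(1), of "residues P"] sub by (auto simp: card_residues)
qed

text \<open>Total ramification leaves the residue field unchanged; for \<open>P\<close> of odd
  degree this supplies the place of odd degree.\<close>

lemma eisenstein_place:
  assumes P: "prime P" "P dvd h" "f = P * g" "\<not> P dvd g"
  obtains V where "valuation_ring K V" "V \<noteq> K" "place_norm (set_ring K) V = poly_norm P"
proof -
  interpret quadratic_generator F K y "emb h" "emb f" "local_ring P"
    by (rule generator_at_finite_place[OF P(1)])
  interpret eisenstein_generator F K y "emb h" "emb f" "local_ring P" "emb P" "emb g"
    by unfold_locales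
      (use P emb_in_local_ring[OF P(1)] emb_in_max_ideal_iff[OF P(1)] max_ideal_local_ring_divide[OF P(1)] in auto)
  have m: "max_ideal W \<inter> F = max_ideal (local_ring P)"
    using max_ideal_Int[OF valuation_ring_W] W_Int by simp
  have sub: "residues P \<subseteq> W \<inter> F" using residues_subset[OF P(1)] W_Int by simp
  have "place_norm (set_ring K) W = card (residues P)"
  proof (rule place_norm_eq_representatives[OF K valuation_ring_W])
    fix z assume "z \<in> W"
    from residue_W[OF this] obtain a where a: "a \<in> local_ring P" "z - a \<in> max_ideal W" .
    obtain r where r: "r \<in> residues P" "a - r \<in> max_ideal (local_ring P)"
      using residues_complete[OF P(1) a(1)] .
    have "(z - a) + (a - r) \<in> max_ideal W"
      using r(2) m by (intro max_ideal_add[OF valuation_ring_W K a(2)]) auto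
    thus "\<exists>r\<in>residues P. z - r \<in> max_ideal W" using r(1) by auto
  next
    show "residues P \<subseteq> W" using sub by auto
    fix a b assume *: "a \<in> residues P" "b \<in> residues P" "a - b \<in> max_ideal W"
    hence "a - b \<in> max_ideal W \<inter> F" using sub subfield_setD(3)[OF F] by auto
    thus "a = b" using residues_incongruent[OF P(1) *(1,2)] m by simp
  qed
  thus thesis using that[OF valuation_ring_W W_neq] by (simp add: card_residues)
qed

text \<open>The elements \<open>a + b * y\<close> with \<open>a\<close> and \<open>b\<close>
  residues modulo \<open>P\<close> represent the residue field, which is thus quadratic over that of
  \<open>P\<close>.\<close>

lemma place_norm_inert:
  assumes P: "prime P" and V: "valuation_ring K V" "V \<inter> F = local_ring P"
    and inert: "\<And>g. \<not> P dvd g * g - h * g - f"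
  shows "place_norm (set_ring K) V = poly_norm P ^ 2"
proof -
  interpret quadratic_generator F K y "emb h" "emb f" "local_ring P"
    by (rule generator_at_finite_place[OF P])
  note R = valuation_ring_local_ring[OF P]
  have mV: "max_ideal V \<inter> F = max_ideal (local_ring P)" using max_ideal_Int[OF V(1)] V(2) by simp
  have noroot: "c * c - emb h * c - emb f \<notin> max_ideal (local_ring P)" if c: "c \<in> local_ring P" for c
  proof
    assume m: "c * c - emb h * c - emb f \<in> max_ideal (local_ring P)"
    obtain r where r: "r \<in> residues P" "c - r \<in> max_ideal (local_ring P)"
      using residues_complete[OF P c] .
    then obtain g where g: "r = emb g" by (auto simp: residues_def)
    \<comment> \<open>Being a root depends only on the residue of \<open>c\<close>: replacing
      \<open>c\<close> by \<open>r\<close> changes the value by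
      \<open>(c - r) * (c + r - emb h)\<close>.\<close>
    have "c + r - emb h \<in> local_ring P"
      using c emb_in_local_ring[OF P] valuation_ringD(3,5)[OF R] by (simp add: g)
    hence "(c - r) * (c + r - emb h) \<in> max_ideal (local_ring P)"
      by (rule max_ideal_mult[OF R F r(2)])
    with m have "(c * c - emb h * c - emb f) - (c - r) * (c + r - emb h) \<in> max_ideal (local_ring P)"
      by (rule max_ideal_diff[OF R F])
    also have "(c * c - emb h * c - emb f) - (c - r) * (c + r - emb h) = emb (g * g - h * g - f)"
      unfolding emb_diff emb_mult g by (simp add: algebra_simps)
    finally show False using emb_in_max_ideal_iff[OF P] inert by blast
  qed
  define A where "A = (\<lambda>(a, b). a + b * y) ` (residues P \<times> residues P)"
  have sub: "residues P \<subseteq> local_ring P" by (rule residues_subset[OF P])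
  have incong: "a = a' \<and> b = b'"
    if "a \<in> residues P" "b \<in> residues P" "a' \<in> residues P" "b' \<in> residues P"
      "(a + b * y) - (a' + b' * y) \<in> max_ideal V" for a b a' b'
  proof -
    have *: "(a - a') + (b - b') * y \<in> max_ideal V" using that(5) by (simp add: algebra_simps)
    have R': "a - a' \<in> local_ring P" "b - b' \<in> local_ring P"
      using that sub valuation_ringD(3)[OF R] by auto
    show ?thesis
      using residue_inert[OF noroot V R' *] residues_incongruent[OF P] that by auto
  qed
  have "place_norm (set_ring K) V = card A"
  proof (rule place_norm_eq_representatives[OF K V(1)])
    show "A \<subseteq> V" using integral_basis_in[OF V] sub by (auto simp: A_def)
    show "u = v" if uv: "u \<in> A" "v \<in> A" "u - v \<in> max_ideal V" for u v
    proof -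
      obtain a b a' b' where "a \<in> residues P" "b \<in> residues P" "a' \<in> residues P" "b' \<in> residues P"
        and eq: "u = a + b * y" "v = a' + b' * y"
        using uv(1,2) unfolding A_def by auto
      from incong[OF this(1-4)] show ?thesis using uv(3) unfolding eq by simp
    qed
    fix z assume "z \<in> V"
    from integral_basis_inert[OF noroot V this]
    obtain a b where ab: "a \<in> local_ring P" "b \<in> local_ring P" "z = a + b * y" .
    obtain r where r: "r \<in> residues P" "a - r \<in> max_ideal (local_ring P)"
      using residues_complete[OF P ab(1)] .
    obtain r' where r': "r' \<in> residues P" "b - r' \<in> max_ideal (local_ring P)"
      using residues_complete[OF P ab(2)] .
    have "y \<in> V"
      using integral_basis_in[OF V, of 0 1] valuation_ringD(1,2)[OF R] by simp
    hence "(b - r') * y \<in> max_ideal V"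
      using max_ideal_mult[OF V(1) K, of "b - r'" y] r'(2) mV by auto
    hence "(a - r) + (b - r') * y \<in> max_ideal V"
      using r(2) mV by (intro max_ideal_add[OF V(1) K]) auto
    moreover have "(a - r) + (b - r') * y = z - (r + r' * y)" by (simp add: ab algebra_simps)
    moreover have "r + r' * y \<in> A" unfolding A_def using r(1) r'(1) by (intro image_eqI[of _ _ "(r, r')"]) auto
    ultimately show "\<exists>v\<in>A. z - v \<in> max_ideal V" by auto
  qed
  also have "card A = card (residues P \<times> residues P)"
    unfolding A_def
  proof (rule card_image, rule inj_onI, clarify)
    fix a b a' b'
    assume *: "a \<in> residues P" "b \<in> residues P" "a' \<in> residues P" "b' \<in> residues P" "a + b * y = a' + b' * y"
    show "a = a' \<and> b = b'"
      using incong[OF *(1-4)] *(5) zero_in_max_ideal[OF V(1) K] by simp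
  qed
  also have "\<dots> = poly_norm P ^ 2"
    by (simp add: card_cartesian_product card_residues power2_eq_square)
  finally show ?thesis .
qed

end

section \<open>Comparing the Euler product of \<open>K\<close> with that of the polynomial
  ring\<close>

lemma place_norm_ne_1:
  fixes n N :: nat
  shows "n = 0 \<or> N \<le> n \<Longrightarrow> N \<ge> 2 \<Longrightarrow> n \<noteq> 1"
  by auto

text \<open>For \<open>n = 0\<close> the power is 0 and the factor is 1, which is below the factor
  of \<open>N\<close>.\<close>

lemma euler_factor_le:
  fixes n N :: nat
  assumes "n = 0 \<or> N \<le> n" "N \<ge> 2" "\<sigma> > 1"
  shows "0 \<le> inverse (1 - real n powr (- \<sigma>))"
    and "inverse (1 - real n powr (- \<sigma>)) \<le> inverse (1 - real N powr (- \<sigma>))"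
    and "1 \<le> inverse (1 - real N powr (- \<sigma>))"
proof -
  have N: "real N powr (- \<sigma>) < 1" "0 \<le> real N powr (- \<sigma>)"
    using powr_less_mono[of "- \<sigma>" 0 "real N"] assms by auto
  have n: "real n powr (- \<sigma>) \<le> real N powr (- \<sigma>)"
    using assms by (cases "n = 0") (auto intro: powr_mono2')
  show "0 \<le> inverse (1 - real n powr (- \<sigma>))" using N n by simp
  show "inverse (1 - real n powr (- \<sigma>)) \<le> inverse (1 - real N powr (- \<sigma>))"
    using N n by (intro le_imp_inverse_le) auto
  show "1 \<le> inverse (1 - real N powr (- \<sigma>))"
    using N by (intro one_le_inverse) auto
qed

lemma poly_norm_prime_ge_2:
  assumes "prime (P :: 'k::{finite,field_gcd} poly)"
  shows "poly_norm P \<ge> 2"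
proof -
  have "2 ^ 1 \<le> CARD('k) ^ degree P"
    using card_field_ge_2[where 'k = 'k] degree_prime_poly[OF assms]
    by (intro order.trans[OF power_mono power_increasing]) auto
  thus ?thesis by (simp add: poly_norm_def)
qed

context poly_embedding
begin

lemma local_ring_inj:
  assumes "prime P" "prime Q" "local_ring P = local_ring Q"
  shows "P = Q"
proof -
  have "emb P \<in> max_ideal (local_ring Q)"
    using emb_in_max_ideal_iff[OF assms(1), of P] assms(3) by simp
  hence "Q dvd P" using emb_in_max_ideal_iff[OF assms(2)] by simp
  thus ?thesis using primes_dvd_imp_eq[OF assms(2,1)] by simp
qed

lemma local_ring_neq_infinity: "prime P \<Longrightarrow> local_ring P \<noteq> ring_at_infinity"
  using emb_in_local_ring[of P "[:0, 1:]"] ring_at_infinity_iff[of 1 "[:0, 1:]"] by auto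

end

context ramified_quadratic
begin

lemma place_norm_neq_1:
  assumes "V \<in> places (set_ring K)"
  shows "place_norm (set_ring K) V \<noteq> 1"
proof -
  have V: "valuation_ring K V" "V \<noteq> K" using assms places_set_ring[OF K] by auto
  show ?thesis
  proof (rule place_cases[OF V])
    assume "V = W_inf"
    thus ?thesis using place_norm_infinity card_field_ge_2[where 'k = 'k] by simp
  next
    fix P assume "prime P" "V \<inter> F = local_ring P"
    thus ?thesis
      using place_norm_ne_1[OF place_norm_ge[OF _ V(1)] poly_norm_prime_ge_2] by blast
  qed
qed

text \<open>The places in \<open>G\<close> are grouped by their restrictions to \<open>F\<close>: at
  most one lies over infinity, at most two lie over each prime \<open>P\<close>, and each of these
  has a factor no larger than that of \<open>P\<close>.\<close>

lemma euler_product_le: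
  fixes \<sigma> :: real
  assumes \<sigma>: "\<sigma> > 1" and G: "finite G" "G \<subseteq> places (set_ring K)"
  shows "(\<Prod>V\<in>G. inverse (1 - real (place_norm (set_ring K) V) powr (- \<sigma>))) \<le>
    1 / ((1 - real CARD('k) powr (- \<sigma>)) * (1 - real CARD('k) powr (1 - \<sigma>))\<^sup>2)"
proof -
  define \<phi> where "\<phi> n = inverse (1 - real n powr (- \<sigma>))" for n :: nat
  define E where "E V = \<phi> (place_norm (set_ring K) V)" for V
  define below where "below V = V \<inter> F" for V :: "'o set"
  define S where "S = {P. prime P \<and> local_ring P \<in> below ` G}"
  have GV: "valuation_ring K V" "V \<noteq> K" if "V \<in> G" for V
    using places_set_ring[OF K] G(2) that by auto
  have inj: "inj_on local_ring S"
    using local_ring_inj by (auto simp: inj_on_def S_def)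
  have "local_ring ` S \<subseteq> below ` G" by (auto simp: S_def)
  hence finS: "finite S"
    using finite_imageD[OF _ inj] finite_subset G(1) by blast
  have below_G: "below ` G \<subseteq> insert ring_at_infinity (local_ring ` S)"
  proof (rule image_subsetI)
    fix V assume V: "V \<in> G"
    show "below V \<in> insert ring_at_infinity (local_ring ` S)"
    proof (rule place_cases[OF GV[OF V]])
      assume "V = W_inf"
      thus ?thesis using infinite.W_Int by (simp add: below_def)
    next
      fix P assume P: "prime P" "V \<inter> F = local_ring P"
      hence "P \<in> S" using V unfolding S_def below_def by (metis (mono_tags) image_eqI mem_Collect_eq)
      thus ?thesis using P(2) by (simp add: below_def)
    qed
  qed
  define D where "D R = (\<Prod>V\<in>{V \<in> G. below V = R}. E V)" for R
  have q2: "CARD('k) \<ge> 2" by (rule card_field_ge_2)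
  have D_inf: "0 \<le> D ring_at_infinity \<and> D ring_at_infinity \<le> \<phi> CARD('k)"
  proof -
    have sub: "{V \<in> G. below V = ring_at_infinity} \<subseteq> {W_inf}"
      using infinite.eisenstein_unique GV(1) unfolding below_def by blast
    have bd: "0 \<le> \<phi> CARD('k)" "1 \<le> \<phi> CARD('k)"
      using euler_factor_le[of "CARD('k)" "CARD('k)"] q2 \<sigma> by (auto simp: \<phi>_def)
    consider "{V \<in> G. below V = ring_at_infinity} = {}" | "{V \<in> G. below V = ring_at_infinity} = {W_inf}"
      using sub by blast
    thus ?thesis
    proof cases
      case 1
      thus ?thesis unfolding D_def 1 using bd by simp
    next
      case 2
      thus ?thesis unfolding D_def 2 using bd place_norm_infinity by (simp add: E_def)
    qed
  qed
  have D_P: "0 \<le> D (local_ring P) \<and> D (local_ring P) \<le> (\<phi> (poly_norm P))\<^sup>2" if P: "P \<in> S" for P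
  proof -
    have pr: "prime P" using P by (simp add: S_def)
    let ?A = "{V \<in> G. below V = local_ring P}"
    have A: "valuation_ring K V" "V \<inter> F = local_ring P" if "V \<in> ?A" for V
      using that GV(1) by (auto simp: below_def)
    have E: "0 \<le> E V" "E V \<le> \<phi> (poly_norm P)" if "V \<in> ?A" for V
      using euler_factor_le(1,2)[OF place_norm_ge[OF pr A[OF that]] poly_norm_prime_ge_2[OF pr] \<sigma>]
      by (auto simp: E_def \<phi>_def)
    have one: "1 \<le> \<phi> (poly_norm P)"
      using euler_factor_le(3)[OF _ poly_norm_prime_ge_2[OF pr] \<sigma>] by (auto simp: \<phi>_def)
    have fin: "finite ?A" using G(1) by simp
    have "card ?A \<le> 2"
    proof (rule ccontr)
      assume "\<not> ?thesis"
      hence "3 \<le> card ?A" by simp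
      then obtain B where B: "B \<subseteq> ?A" "card B = 3" by (rule obtain_subset_with_card_n) auto
      then obtain V1 V2 V3 where "B = {V1, V2, V3}" "V1 \<noteq> V2" "V2 \<noteq> V3" "V1 \<noteq> V3"
        by (auto simp: card_3_iff)
      thus False
        using at_most_two_extensions[of V1 "local_ring P" V2 V3] A B(1) by auto
    qed
    \<comment> \<open>The factor of \<open>P\<close> is at least 1, so the exponent may be raised to
      2 even if fewer than two places of \<open>G\<close> lie over \<open>P\<close>.\<close>
    have "D (local_ring P) \<le> (\<Prod>V\<in>?A. \<phi> (poly_norm P))"
      unfolding D_def using E by (intro prod_mono) auto
    also have "\<dots> = \<phi> (poly_norm P) ^ card ?A" by simp
    also have "\<dots> \<le> \<phi> (poly_norm P) ^ 2"
      using \<open>card ?A \<le> 2\<close> one by (intro power_increasing) auto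
    finally show ?thesis unfolding D_def using E by (auto intro: prod_nonneg)
  qed
  have "(\<Prod>V\<in>G. E V) = (\<Prod>R\<in>below ` G. D R)"
    unfolding D_def by (rule prod.image_gen[OF G(1)])
  \<comment> \<open>Infinity may be included whether or not a place of \<open>G\<close> lies over
    it, since an empty group contributes the factor 1.\<close>
  also have "\<dots> = (\<Prod>R\<in>insert ring_at_infinity (local_ring ` S). D R)"
  proof (rule prod.mono_neutral_left)
    show "\<forall>R\<in>insert ring_at_infinity (local_ring ` S) - below ` G. D R = 1"
    proof
      fix R assume "R \<in> insert ring_at_infinity (local_ring ` S) - below ` G"
      hence "{V \<in> G. below V = R} = {}" by auto
      thus "D R = 1" unfolding D_def by (simp only: prod.empty)
    qed
  qed (use below_G finS in auto)
  also have "\<dots> = D ring_at_infinity * (\<Prod>P\<in>S. D (local_ring P))"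
  proof -
    have "ring_at_infinity \<notin> local_ring ` S"
      using local_ring_neq_infinity by (auto simp: S_def)
    thus ?thesis using finS inj by (simp add: prod.reindex)
  qed
  also have "\<dots> \<le> \<phi> CARD('k) * (\<Prod>P\<in>S. (\<phi> (poly_norm P))\<^sup>2)"
    using D_inf D_P by (intro mult_mono prod_mono prod_nonneg) auto
  also have "(\<Prod>P\<in>S. (\<phi> (poly_norm P))\<^sup>2) = (\<Prod>P\<in>S. \<phi> (poly_norm P))\<^sup>2"
    by (rule prod_power_distrib [symmetric])
  also have "\<phi> CARD('k) * (\<Prod>P\<in>S. \<phi> (poly_norm P))\<^sup>2 \<le>
      \<phi> CARD('k) * (1 / (1 - real CARD('k) powr (1 - \<sigma>)))\<^sup>2"
  proof (intro mult_left_mono power_mono)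
    show "(\<Prod>P\<in>S. \<phi> (poly_norm P)) \<le> 1 / (1 - real CARD('k) powr (1 - \<sigma>))"
      unfolding \<phi>_def using euler_product_poly_le[OF \<sigma> finS] by (auto simp: S_def)
    show "0 \<le> (\<Prod>P\<in>S. \<phi> (poly_norm P))"
      using euler_factor_le(1)[of _ _ \<sigma>] \<sigma> poly_norm_prime_ge_2
      by (intro prod_nonneg) (auto simp: S_def \<phi>_def)
    show "0 \<le> \<phi> CARD('k)" using D_inf by linarith
  qed
  also have "\<dots> = 1 / ((1 - real CARD('k) powr (- \<sigma>)) * (1 - real CARD('k) powr (1 - \<sigma>))\<^sup>2)"
    by (simp add: \<phi>_def power_divide inverse_eq_divide)
  finally show ?thesis by (simp add: E_def \<phi>_def)
qed

end

section \<open>The constant field, and \<open>K\<close> as a function field\<close>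

context ramified_quadratic
begin

definition constants :: "'o set" where "constants = range (\<lambda>c. emb [:c:])"

lemma constantsI: "emb [:c:] \<in> constants"
  by (auto simp: constants_def)

lemma subfield_constants: "subfield_set constants"
  unfolding subfield_set_def
proof (intro conjI ballI)
  show "1 \<in> constants" unfolding constants_def
    by (rule range_eqI[of _ _ 1]) (simp add: one_pCons [symmetric])
  fix a assume "a \<in> constants"
  then obtain c where a: "a = emb [:c:]" by (auto simp: constants_def)
  show "inverse a \<in> constants"
    using emb_const_inverse[of c] by (cases "c = 0") (auto simp: a constants_def intro: range_eqI[of _ _ 0])
  fix b assume "b \<in> constants"
  then obtain d where b: "b = emb [:d:]" by (auto simp: constants_def)
  have "a - b = emb [:c - d:]" unfolding a b emb_diff [symmetric] by simp
  thus "a - b \<in> constants" by (simp only: constantsI)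
  have "a * b = emb [:c * d:]" unfolding a b emb_mult [symmetric] by simp
  thus "a * b \<in> constants" by (simp only: constantsI)
qed

lemma constants_subset_K: "constants \<subseteq> K"
  using FK by (auto simp: constants_def)

lemma card_constants: "card constants = CARD('k)"
  unfolding constants_def by (rule card_image) (auto intro!: injI)

lemma constants_in_W_inf: "a \<in> constants \<Longrightarrow> a \<in> W_inf"
  using constant_in_ring_at_infinity infinite.R_subset_W by (auto simp: constants_def)

lemma constants_max_ideal: "a \<in> constants \<Longrightarrow> a \<in> max_ideal W_inf \<Longrightarrow> a = 0"
  using constant_in_max_ideal_W_inf by (auto simp: constants_def)

lemma poly_in_W_inf:
  assumes "\<And>i. Polynomial.coeff D i \<in> constants" "u \<in> W_inf"
  shows "poly D u \<in> W_inf"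
  using assms(1)
proof (induction D)
  case (pCons a p)
  have "a \<in> constants" "\<And>i. Polynomial.coeff p i \<in> constants"
    using pCons.prems[of 0] pCons.prems[of "Suc _"] by auto
  thus ?case
    using pCons.IH assms(2) constants_in_W_inf valuation_ringD(4,5)[OF infinite.valuation_ring_W] by simp
qed (use valuation_ringD(2)[OF infinite.valuation_ring_W] in simp)

lemma poly_in_constants:
  assumes "\<And>i. Polynomial.coeff D i \<in> constants" "a \<in> constants"
  shows "poly D a \<in> constants"
  using assms(1)
proof (induction D)
  case (pCons b p)
  have "b \<in> constants" "\<And>i. Polynomial.coeff p i \<in> constants"
    using pCons.prems[of 0] pCons.prems[of "Suc _"] by auto
  thus ?case
    using pCons.IH assms(2) subfield_setD(4,5)[OF subfield_constants] by simp
qed (use subfield_setD(2)[OF subfield_constants] in simp)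

lemma synthetic_div_constants:
  assumes "\<And>i. Polynomial.coeff D i \<in> constants" "a \<in> constants"
  shows "Polynomial.coeff (synthetic_div D a) i \<in> constants"
  using assms(1)
proof (induction D arbitrary: i)
  case (pCons b p)
  have p: "\<And>i. Polynomial.coeff p i \<in> constants"
    using pCons.prems[of "Suc _"] by auto
  show ?case
    using pCons.IH[OF p] poly_in_constants[OF p assms(2)] by (cases i) auto
qed (use subfield_setD(2)[OF subfield_constants] in simp)

text \<open>A nonzero element \<open>u\<close> of the maximal ideal is transcendental over the
  constants: the constant term of \<open>D\<close> is a multiple of \<open>u\<close>, hence 0, and
  \<open>u\<close> can be divided out.\<close>

lemma root_in_max_ideal_W_inf:
  assumes "\<And>i. Polynomial.coeff D i \<in> constants" "poly D u = 0" "u \<in> max_ideal W_inf" "u \<noteq> 0"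
  shows "D = 0"
  using assms(1,2)
proof (induction D)
  case (pCons a p)
  have ap: "a \<in> constants" "\<And>i. Polynomial.coeff p i \<in> constants"
    using pCons.prems(1)[of 0] pCons.prems(1)[of "Suc _"] by auto
  have "- (u * poly p u) \<in> max_ideal W_inf"
    using poly_in_W_inf[OF ap(2) max_idealD[OF assms(3)]]
    by (intro max_ideal_uminus[OF infinite.valuation_ring_W K] max_ideal_mult[OF infinite.valuation_ring_W K assms(3)])
  moreover have "a = - (u * poly p u)" using pCons.prems(2) by (simp add: eq_neg_iff_add_eq_0)
  ultimately have "a = 0" using constants_max_ideal[OF ap(1)] by simp
  hence "poly p u = 0" using pCons.prems(2) assms(4) by simp
  hence "p = 0" by (rule pCons.IH[OF ap(2)])
  thus ?case using \<open>a = 0\<close> by simp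
qed simp

text \<open>
  The residue field of the infinite place consists of constants only; an element that is
  algebraic over the constants has neither a pole nor, after subtracting its residue, a zero there.
\<close>
lemma algebraic_imp_constant:
  assumes "\<And>i. Polynomial.coeff D i \<in> constants" "D \<noteq> 0" "poly D z = 0" "z \<in> K"
  shows "z \<in> constants"
proof (cases "z \<in> W_inf")
  case False
  have z0: "z \<noteq> 0" using False valuation_ringD(2)[OF infinite.valuation_ring_W] by auto
  \<comment> \<open>Reversing the coefficients gives an equation for \<open>1 / z\<close>, which
    lies in the maximal ideal when \<open>z\<close> has a pole.\<close>
  have "poly (reflect_poly D) (inverse z) = 0"
    using z0 assms(3) by (subst poly_reflect_poly_nz) auto
  moreover have "Polynomial.coeff (reflect_poly D) i \<in> constants" for i
    using assms(1) subfield_setD(2)[OF subfield_constants] by (simp add: coeff_reflect_poly)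
  ultimately have "reflect_poly D = 0"
    using z0 max_ideal_inverse[OF infinite.valuation_ring_W assms(4) False]
    by (intro root_in_max_ideal_W_inf[of _ "inverse z"]) auto
  hence "poly (reflect_poly D) 0 = 0" by simp
  hence "D = 0" by simp
  thus ?thesis using assms(2) by simp
next
  case True
  obtain c where c: "z - emb [:c:] \<in> max_ideal W_inf" using residue_W_inf[OF True] .
  define a where "a = emb [:c:]"
  have a: "a \<in> constants" by (simp add: a_def constants_def)
  show ?thesis
    using assms(1-3)
  proof (induction "degree D" arbitrary: D rule: less_induct)
    case less
    \<comment> \<open>Division by \<open>X - a\<close> leaves the remainder \<open>poly D a\<close>,
      a constant in the maximal ideal and therefore 0. So either \<open>z = a\<close>, or
      \<open>z\<close> is a root of the quotient, whose degree is smaller.\<close>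
    define D1 where "D1 = synthetic_div D a"
    have D1: "Polynomial.coeff D1 i \<in> constants" for i
      unfolding D1_def by (rule synthetic_div_constants[OF less.prems(1) a])
    have eq: "D = [:- a, 1:] * D1 + [:poly D a:]"
      unfolding D1_def by (rule synthetic_div_correct' [symmetric])
    have "poly D z = (z - a) * poly D1 z + poly D a"
      by (subst (1) eq) (simp add: algebra_simps)
    hence *: "(z - a) * poly D1 z + poly D a = 0" using less.prems(3) by simp
    have "- ((z - a) * poly D1 z) \<in> max_ideal W_inf"
      using c poly_in_W_inf[OF D1 True] unfolding a_def [symmetric]
      by (intro max_ideal_uminus[OF infinite.valuation_ring_W K] max_ideal_mult[OF infinite.valuation_ring_W K])
    moreover have "poly D a = - ((z - a) * poly D1 z)" using * by (simp add: eq_neg_iff_add_eq_0 add.commute)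
    ultimately have Da: "poly D a = 0"
      using constants_max_ideal[OF poly_in_constants[OF less.prems(1) a]] by simp
    have "D1 \<noteq> 0" using eq Da less.prems(2) by auto
    hence "degree D \<noteq> 0" by (simp add: D1_def synthetic_div_eq_0_iff)
    hence deg: "degree D1 < degree D" by (simp add: D1_def degree_synthetic_div)
    show ?case
    proof (cases "poly D1 z = 0")
      case True
      show ?thesis by (rule less.hyps[OF deg D1 \<open>D1 \<noteq> 0\<close> True])
    next
      case False
      hence "z = a" using * Da by simp
      thus ?thesis using a by simp
    qed
  qed
qed

text \<open>Polynomials represented as lists carry the leading coefficient first; hence the
  \<open>rev\<close>.\<close>

lemma eval_set_ring:
  assumes "set l \<subseteq> K" "z \<in> K"
  shows "ring.eval (set_ring K) l z = poly (Poly (rev l)) z"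
proof -
  interpret R: Ring.field "set_ring K" by (rule field_set_ring[OF K])
  have pow: "z [^]\<^bsub>set_ring K\<^esub> n = z ^ n" for n :: nat
    by (induction n) simp_all
  show ?thesis
    using assms(1) by (induction l) (simp_all add: pow Poly_append poly_monom)
qed

lemma x_notin_constants: "x \<notin> constants"
  by (auto simp: constants_def)

text \<open>Formulated for an isomorphic copy of \<open>K\<close>, because the isomorphism classes
  are formed among fields carried by sets of natural numbers.\<close>

lemma function_field_image:
  fixes S :: "('b, 'c) ring_scheme"
  assumes S: "Ring.field S" and \<phi>: "\<phi> \<in> ring_iso (set_ring K) S"
  shows "function_field (CARD('k)) S"
proof -
  interpret R: Ring.field "set_ring K" by (rule field_set_ring[OF K])
  interpret S: Ring.field S by (rule S)
  interpret \<phi>: ring_hom_ring "set_ring K" S \<phi>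
    using \<phi> by (intro ring_hom_ring.intro ring_hom_ring_axioms.intro R.ring_axioms S.ring_axioms)
      (auto simp: ring_iso_def)
  have inj: "inj_on \<phi> K" and surj: "\<phi> ` K = carrier S"
    using \<phi> by (auto simp: ring_iso_def bij_betw_def)
  define k where "k = \<phi> ` constants"
  have "subring constants (set_ring K)"
    using constants_subset_K subfield_setD[OF subfield_constants]
    by (intro R.subringI) (auto simp: uminus_set_ring[OF K] subset_iff)
  hence "subfield constants (set_ring K)"
    using constants_subset_K subfield_setD(7)[OF subfield_constants]
    by (intro R.subfieldI') (auto simp: inv_set_ring[OF K] subset_iff)
  hence k: "subfield k S"
    unfolding k_def by (intro \<phi>.img_is_subfield(2)) simp_all
  have card_k: "card k = CARD('k)"
    unfolding k_def using inj_on_subset[OF inj constants_subset_K] by (simp add: card_image card_constants)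
  have algebraic: "z \<in> constants" if z: "z \<in> K" and alg: "\<not> S.transcendental k (\<phi> z)" for z
  proof -
    \<comment> \<open>Failure of transcendence gives two different coefficient lists with the same
      value. Pulled back along \<open>\<phi>\<close>, their difference is a nonzero polynomial over
      the constants that vanishes at \<open>z\<close>.\<close>
    obtain p p' where p: "p \<in> carrier (k[X]\<^bsub>S\<^esub>)" "p' \<in> carrier (k[X]\<^bsub>S\<^esub>)" "p \<noteq> p'"
      and eval: "S.eval p (\<phi> z) = S.eval p' (\<phi> z)"
      using alg by (auto simp: S.transcendental_def inj_on_def)
    have lift: "\<exists>l. set l \<subseteq> constants \<and> p = map \<phi> l \<and> (l \<noteq> [] \<longrightarrow> hd l \<noteq> 0)"
      if "p \<in> carrier (k[X]\<^bsub>S\<^esub>)" for p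
    proof -
      have p: "set p \<subseteq> k" "p \<noteq> [] \<longrightarrow> hd p \<noteq> \<zero>\<^bsub>S\<^esub>"
        using that by (auto simp: univ_poly_def polynomial_def)
      have "p \<in> lists (\<phi> ` constants)" using p(1) by (auto simp: k_def)
      hence "p \<in> map \<phi> ` lists constants" by (simp only: lists_image)
      then obtain l where l: "set l \<subseteq> constants" "p = map \<phi> l" by auto
      have "hd l \<noteq> 0" if "l \<noteq> []"
        using p(2) that \<phi>.hom_zero by (auto simp: l(2) hd_map)
      thus ?thesis using l by blast
    qed
    obtain l l' where l: "set l \<subseteq> constants" "p = map \<phi> l" "l \<noteq> [] \<longrightarrow> hd l \<noteq> 0"
      and l': "set l' \<subseteq> constants" "p' = map \<phi> l'" "l' \<noteq> [] \<longrightarrow> hd l' \<noteq> 0"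
      using lift[OF p(1)] lift[OF p(2)] by blast
    define D where "D = Poly (rev l) - Poly (rev l')"
    have coeffs: "coeffs (Poly (rev xs)) = rev xs" if "xs \<noteq> [] \<longrightarrow> hd xs \<noteq> 0" for xs :: "'o list"
      using that by (cases xs) auto
    have "l \<noteq> l'" using p(3) l(2) l'(2) by auto
    hence D0: "D \<noteq> 0" unfolding D_def using coeffs[OF l(3)] coeffs[OF l'(3)] by (metis eq_iff_diff_eq_0 rev_is_rev_conv)
    have sub: "set l \<subseteq> K" "set l' \<subseteq> K" using l(1) l'(1) constants_subset_K by auto
    have "\<phi> (R.eval l z) = \<phi> (R.eval l' z)"
      using eval \<phi>.eval_hom'[of z l] \<phi>.eval_hom'[of z l'] z sub by (simp add: l(2) l'(2))
    hence "R.eval l z = R.eval l' z"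
      using inj_onD[OF inj] R.eval_in_carrier[of l z] R.eval_in_carrier[of l' z] z sub by simp
    hence "poly D z = 0"
      using z sub by (simp add: eval_set_ring D_def)
    moreover have "Polynomial.coeff D i \<in> constants" for i
    proof -
      have *: "nth_default 0 (rev xs) i \<in> constants" if "set xs \<subseteq> constants" for xs
        using that subfield_setD(2)[OF subfield_constants] nth_mem[of i "rev xs"]
        by (auto simp: nth_default_def simp del: nth_mem)
      show ?thesis
        using subfield_setD(3)[OF subfield_constants *[OF l(1)] *[OF l'(1)]] by (simp add: D_def)
    qed
    ultimately show ?thesis using algebraic_imp_constant[OF _ D0 _ z] by blast
  qed
  have xK: "x \<in> K" using FK emb_in_F by auto
  define G where "G = generate_field S (insert (\<phi> x) k)"
  have ins: "insert (\<phi> x) k \<subseteq> carrier S"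
    using xK constants_subset_K surj by (auto simp: k_def)
  have G: "subfield G S"
    unfolding G_def by (rule S.generate_field_is_subfield[OF ins])
  note Gr = subringE[OF subfieldE(1)[OF G]]
  have gen: "\<phi> (emb u) \<in> G" for u
  proof (induction u)
    case 0
    show ?case using Gr(2) \<phi>.hom_zero by simp
  next
    case (pCons c u)
    have c: "emb [:c:] \<in> K" "\<phi> (emb [:c:]) \<in> G"
      using FK emb_in_F[of "[:c:]"]
      by (auto simp: G_def k_def constants_def intro!: generate_field.incl)
    have xG: "\<phi> x \<in> G" unfolding G_def by (rule generate_field.incl) simp
    have uK: "emb u \<in> K" "x * emb u \<in> K"
      using subsetD[OF FK emb_in_F[of u]] subfield_setD(4)[OF K xK] by auto
    have "\<phi> (emb (pCons c u)) = \<phi> (emb [:c:]) \<oplus>\<^bsub>S\<^esub> \<phi> x \<otimes>\<^bsub>S\<^esub> \<phi> (emb u)"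
      unfolding emb_pCons[of c u]
      using \<phi>.hom_add[of "emb [:c:]" "x * emb u"] \<phi>.hom_mult[of x "emb u"] c uK xK by simp
    thus ?case using Gr(6,7) c(2) xG pCons.IH by simp
  qed
  have gen_F: "\<phi> a \<in> G" if "a \<in> F" for a
  proof -
    obtain u v where uv: "v \<noteq> 0" "a = emb u / emb v" using FE[OF \<open>a \<in> F\<close>] .
    have iK: "inverse (emb v) \<in> K" "emb v \<in> K" "emb u \<in> K"
      using subsetD[OF FK emb_in_F[of v]] subsetD[OF FK emb_in_F[of u]] subfield_setD(7)[OF K] by auto
    have "\<phi> (emb v) \<otimes>\<^bsub>S\<^esub> \<phi> (inverse (emb v)) = \<one>\<^bsub>S\<^esub>"
      using \<phi>.hom_mult[of "emb v" "inverse (emb v)"] iK uv(1) \<phi>.hom_one by simp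
    moreover have "\<phi> (emb v) \<in> carrier S" "\<phi> (inverse (emb v)) \<in> carrier S"
      using iK surj by auto
    ultimately have inv: "inv\<^bsub>S\<^esub> \<phi> (emb v) = \<phi> (inverse (emb v))"
      by (intro S.comm_inv_char)
    have "\<phi> (emb v) \<noteq> \<zero>\<^bsub>S\<^esub>"
      using inj_onD[OF inj, of "emb v" 0] iK uv(1) \<phi>.hom_zero subfield_setD(2)[OF K] by auto
    hence "\<phi> (inverse (emb v)) \<in> G"
      using gen[of v] unfolding inv [symmetric] G_def by (rule generate_field.m_inv[rotated])
    hence "\<phi> (emb u) \<otimes>\<^bsub>S\<^esub> \<phi> (inverse (emb v)) \<in> G" using Gr(6) gen by blast
    thus ?thesis using \<phi>.hom_mult[of "emb u" "inverse (emb v)"] iK by (simp add: uv(2) divide_inverse)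
  qed
  have "S.finite_dimension G (carrier S)"
  proof -
    let ?B = "[\<phi> y, \<one>\<^bsub>S\<^esub>]"
    have B: "set ?B \<subseteq> carrier S" using y_in_K surj by auto
    have "carrier S \<subseteq> S.Span G ?B"
    proof
      fix s assume "s \<in> carrier S"
      then obtain z where z: "z \<in> K" "s = \<phi> z" using surj by auto
      obtain a b where ab: "a \<in> F" "b \<in> F" "z = a + b * y" using z(1) by (auto simp: K_def)
      have abK: "a \<in> K" "b \<in> K" "b * y \<in> K"
        using ab FK y_in_K subfield_setD(4)[OF K] by auto
      have "s = S.combine [\<phi> b, \<phi> a] ?B"
        using \<phi>.hom_add[of a "b * y"] \<phi>.hom_mult[of b y] abK y_in_K surj
        by (simp add: z(2) ab(3) S.a_comm)
      moreover have "set [\<phi> b, \<phi> a] \<subseteq> G" using gen_F ab by simp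
      ultimately show "s \<in> S.Span G ?B"
        unfolding S.Span_eq_combine_set[OF G B] by blast
    qed
    hence "S.Span G ?B = carrier S"
      using S.Span_in_carrier[OF Gr(1) B] by blast
    thus ?thesis using S.Span_finite_dimension[OF G B] by simp
  qed
  moreover have "S.transcendental k (\<phi> x)" using algebraic[OF xK] x_notin_constants by blast
  moreover have "\<forall>w\<in>carrier S. \<not> S.transcendental k w \<longrightarrow> w \<in> k"
  proof (intro ballI impI)
    fix w assume w: "w \<in> carrier S" "\<not> S.transcendental k w"
    then obtain z where "z \<in> K" "w = \<phi> z" using surj by auto
    thus "w \<in> k" using algebraic w(2) by (auto simp: k_def)
  qed
  ultimately show ?thesis
    unfolding function_field_def using S k card_k xK surj G_def by blast
qed

end

section \<open>Choice of the quadratic equation\<close>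

lemma finite_poly_degree_le: "finite {g :: 'k::{finite,field} poly. degree g \<le> n}"
  by (rule finite_subset[OF _ finite_poly_degree_less[of "Suc n"]]) auto

lemma chinese_remainder_family:
  fixes M c :: "'i \<Rightarrow> 'a::euclidean_ring_gcd"
  assumes "finite A" "\<And>i j. i \<in> A \<Longrightarrow> j \<in> A \<Longrightarrow> i \<noteq> j \<Longrightarrow> coprime (M i) (M j)"
  shows "\<exists>f. \<forall>i\<in>A. M i dvd f - c i"
  using assms
proof (induction A rule: finite_induct)
  case (insert i A)
  obtain f where f: "\<And>j. j \<in> A \<Longrightarrow> M j dvd f - c j" using insert by auto
  define N where "N = (\<Prod>j\<in>A. M j)"
  have "coprime N (M i)"
    unfolding N_def using insert.prems insert.hyps by (intro prod_coprime_left) auto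
  hence bez: "fst (bezout_coefficients N (M i)) * N + snd (bezout_coefficients N (M i)) * M i = 1"
    using bezout_coefficients_fst_snd[of N "M i"] by (simp add: coprime_imp_gcd_eq_1)
  define s r where "s = fst (bezout_coefficients N (M i))" and "r = snd (bezout_coefficients N (M i))"
  \<comment> \<open>\<open>s * N\<close> is 1 modulo \<open>M i\<close>, and \<open>N\<close> is 0
    modulo each of the other moduli.\<close>
  define f' where "f' = f + N * (s * (c i - f))"
  have "f' - c i = (1 - s * N) * (f - c i)" by (simp add: f'_def algebra_simps)
  also have "1 - s * N = r * M i" using bez by (simp add: s_def r_def algebra_simps)
  finally have "M i dvd f' - c i" by simp
  moreover have "M j dvd f' - c j" if j: "j \<in> A" for j
  proof -
    have "M j dvd N" unfolding N_def using insert.hyps j by (intro dvd_prodI) auto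
    hence "M j dvd (f - c j) + N * (s * (c i - f))"
      by (intro dvd_add f[OF j] dvd_mult2)
    thus ?thesis by (simp add: f'_def algebra_simps)
  qed
  ultimately show ?case by (intro exI[of _ f']) auto
qed simp

text \<open>Degrees add in a product, so after splitting off a prime of even degree the cofactor
  again has odd degree.\<close>

lemma odd_degree_prime_factor:
  fixes g :: "'k::field_gcd poly"
  assumes "odd (degree g)"
  shows "\<exists>P. prime P \<and> P dvd g \<and> odd (degree P)"
  using assms
proof (induction "degree g" arbitrary: g rule: less_induct)
  case less
  have g0: "g \<noteq> 0" using less.prems by auto
  have "\<not> is_unit g" using less.prems is_unit_iff_degree[OF g0] by auto
  then obtain P where P: "P dvd g" "prime P" using prime_divisor_exists[OF g0] by auto
  then obtain w where w: "g = P * w" by (elim dvdE)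
  hence deg: "degree g = degree P + degree w"
    using g0 by (simp add: Polynomial.degree_mult_eq)
  show ?case
  proof (cases "odd (degree P)")
    case False
    have "degree w < degree g" using deg degree_prime_poly[OF P(2)] by simp
    moreover have "odd (degree w)" using deg less.prems False by simp
    ultimately obtain Q where "prime Q" "Q dvd w" "odd (degree Q)" using less.hyps by auto
    thus ?thesis unfolding w by (intro exI[of _ Q]) auto
  qed (use P in auto)
qed

text \<open>Euclid's argument, applied to a polynomial of odd degree.\<close>
lemma ex_prime_odd_degree_greater:
  "\<exists>P :: 'k::{finite,field_gcd} poly. prime P \<and> odd (degree P) \<and> degree P > n"
proof -
  define T where "T = {Q :: 'k poly. prime Q \<and> degree Q \<le> n}"
  have finT: "finite T"
    by (rule finite_subset[OF _ finite_poly_degree_le[of n]]) (auto simp: T_def)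
  define M where "M = \<Prod>T"
  have M0: "M \<noteq> 0" using finT by (auto simp: M_def T_def)
  \<comment> \<open>This exponent makes the degree of \<open>N\<close> equal to
    \<open>2 * degree M + 1\<close>, which is odd.\<close>
  define e where "e = Suc (degree M)"
  define N where "N = M * Polynomial.monom 1 e"
  have degN: "degree N = degree M + e"
    using M0 by (simp add: N_def Polynomial.degree_mult_eq degree_monom_eq)
  have deg: "degree (1 + N) = degree N"
    using degN by (intro degree_add_eq_right) (simp add: e_def)
  have "odd (degree (1 + N))"
    unfolding deg degN e_def by simp
  from odd_degree_prime_factor[OF this] obtain P
    where P: "prime P" "P dvd 1 + N" "odd (degree P)" by blast
  have "degree P > n"
  proof (rule ccontr)
    assume "\<not> ?thesis"
    hence "P dvd M" unfolding M_def using finT P(1) by (intro dvd_prodI[where f = "\<lambda>x. x", simplified]) (auto simp: T_def)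
    hence "P dvd N" by (simp add: N_def)
    hence "is_unit P" using P(2) dvd_add_left_iff[of P N 1] by simp
    thus False using P(1) not_prime_unit[of P] by blast
  qed
  thus ?thesis using P by blast
qed

text \<open>
  \<open>g \<mapsto> g\<^sup>2 - h g\<close> is not injective modulo \<open>Q\<close>, since it vanishes at both 0 and \<open>h\<close>; hence it is
  not surjective either.
\<close>
lemma ex_inert_residue:
  fixes Q h :: "'k::{finite,field_gcd} poly"
  assumes Q: "prime Q" and h: "\<not> Q dvd h"
  shows "\<exists>c. \<forall>g. \<not> Q dvd g * g - h * g - c"
proof -
  define D where "D = {g :: 'k poly. g = 0 \<or> degree g < degree Q}"
  have Q0: "Q \<noteq> 0" using Q by auto
  have finD: "finite D" unfolding D_def by (rule finite_poly_degree_less)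
  have modD: "g mod Q \<in> D" for g unfolding D_def using degree_mod_less[OF Q0] by auto
  define \<psi> where "\<psi> g = (g * g - h * g) mod Q" for g
  have \<psi>_mod: "\<psi> (g mod Q) = \<psi> g" for g
    unfolding \<psi>_def by (metis (no_types) mod_diff_eq mod_mult_eq mod_mult_right_eq)
  have "\<not> inj_on \<psi> D"
  proof
    assume "inj_on \<psi> D"
    moreover have "\<psi> (h mod Q) = \<psi> 0" unfolding \<psi>_mod by (simp add: \<psi>_def)
    moreover have "h mod Q \<in> D" "0 \<in> D" using modD by (auto simp: D_def)
    ultimately have "h mod Q = 0" by (rule inj_onD)
    thus False using h by (simp add: mod_eq_0_iff_dvd)
  qed
  hence "\<psi> ` D \<noteq> D" using finite_surj_inj[OF finD] by auto
  moreover have "\<psi> ` D \<subseteq> D" using modD by (auto simp: \<psi>_def)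
  ultimately obtain c where c: "c \<in> D" "c \<notin> \<psi> ` D" by blast
  have "\<not> Q dvd g * g - h * g - c" for g
  proof
    assume "Q dvd g * g - h * g - c"
    hence "(g * g - h * g) mod Q = c mod Q" by (simp add: mod_eq_dvd_iff)
    moreover have "c mod Q = c"
      using c(1) by (auto simp: D_def mod_poly_less)
    ultimately have "\<psi> (g mod Q) = c" unfolding \<psi>_mod by (simp add: \<psi>_def)
    thus False using c(2) modD by blast
  qed
  thus ?thesis by blast
qed

text \<open>Prescribing \<open>f\<close> to be \<open>P\<close> modulo \<open>P ^ 2\<close> makes it
  divisible by \<open>P\<close> exactly once. Modulo each other prime \<open>Q\<close> of degree at
  most \<open>n\<close> it is prescribed to be a residue that \<open>u * u - P * u\<close> never
  takes; such a residue exists because \<open>Q\<close> does not divide \<open>P\<close>.\<close>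

lemma ex_quadratic_data:
  fixes P :: "'k::{finite,field_gcd} poly"
  assumes P: "prime P"
  obtains f g where "odd (degree f)" "2 * degree P < degree f"
    "f = P * g" "\<not> P dvd g"
    "\<And>Q u. prime Q \<Longrightarrow> Q \<noteq> P \<Longrightarrow> degree Q \<le> n \<Longrightarrow> \<not> Q dvd u * u - P * u - f"
proof -
  define T where "T = {Q :: 'k poly. prime Q \<and> Q \<noteq> P \<and> degree Q \<le> n}"
  have finT: "finite T"
    by (rule finite_subset[OF _ finite_poly_degree_le[of n]]) (auto simp: T_def)
  have P0: "P \<noteq> 0" using P by auto
  have "\<exists>c. \<forall>g. \<not> Q dvd g * g - P * g - c" if "Q \<in> T" for Q
    using that primes_dvd_imp_eq[of Q P] P by (intro ex_inert_residue) (auto simp: T_def)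
  then obtain c where c: "\<And>Q g. Q \<in> T \<Longrightarrow> \<not> Q dvd g * g - P * g - c Q" by metis
  define M where "M Q = (if Q = P then P ^ 2 else Q)" for Q
  define c' where "c' Q = (if Q = P then P else c Q)" for Q
  have cop: "coprime (M i) (M j)" if "i \<in> insert P T" "j \<in> insert P T" "i \<noteq> j" for i j
  proof -
    have "coprime i j" using that P primes_coprime[of i j] by (auto simp: T_def)
    thus ?thesis by (auto simp: M_def)
  qed
  obtain f0 where f0: "\<And>i. i \<in> insert P T \<Longrightarrow> M i dvd f0 - c' i"
    using chinese_remainder_family[of "insert P T" M c'] cop finT by auto
  define N where "N = (\<Prod>i\<in>insert P T. M i)"
  have N0: "N \<noteq> 0" using finT P0 by (auto simp: N_def M_def T_def)
  \<comment> \<open>Adding a multiple of \<open>N\<close> preserves all congruences. The resulting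
    degree \<open>2 * degree N + 2 * (degree f0 + degree P) + 1\<close> is odd, exceeds
    \<open>2 * degree P\<close>, and also exceeds \<open>degree f0\<close>, so that
    \<open>f0\<close> does not affect it.\<close>
  define e where "e = degree N + 2 * (degree f0 + degree P) + 1"
  define f where "f = f0 + N * Polynomial.monom 1 e"
  have degNe: "degree (N * Polynomial.monom 1 e) = degree N + e"
    using N0 by (simp add: Polynomial.degree_mult_eq degree_monom_eq)
  have deg: "degree f = degree N + e"
    unfolding f_def degNe [symmetric] by (rule degree_add_eq_right) (simp only: degNe, simp add: e_def)
  have f: "M i dvd f - c' i" if i: "i \<in> insert P T" for i
  proof -
    have "M i dvd N" unfolding N_def using finT i by (intro dvd_prodI) auto
    hence "M i dvd (f0 - c' i) + N * Polynomial.monom 1 e" by (intro dvd_add f0[OF i] dvd_mult2)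
    thus ?thesis by (simp add: f_def algebra_simps)
  qed
  have "P ^ 2 dvd f - P" using f[of P] by (simp add: M_def c'_def)
  then obtain w where "f - P = P ^ 2 * w" by (elim dvdE)
  hence fw: "f = P * (1 + P * w)" by (simp add: algebra_simps power2_eq_square)
  show thesis
  proof (rule that[of f "1 + P * w"])
    show "odd (degree f)" "2 * degree P < degree f"
      unfolding deg e_def by simp_all
    show "f = P * (1 + P * w)" by (rule fw)
    have "P dvd 1 + P * w \<longleftrightarrow> is_unit P" by (rule dvd_add_left_iff) simp
    thus "\<not> P dvd 1 + P * w" using P not_prime_unit[of P] by blast
    show "\<not> Q dvd u * u - P * u - f" if Q: "prime Q" "Q \<noteq> P" "degree Q \<le> n" for Q u
    proof
      assume *: "Q dvd u * u - P * u - f"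
      have T: "Q \<in> T" using Q by (simp add: T_def)
      hence "Q dvd f - c Q" using f[of Q] Q(2) by (simp add: M_def c'_def)
      hence "Q dvd (u * u - P * u - f) + (f - c Q)" using * by (intro dvd_add)
      also have "(u * u - P * u - f) + (f - c Q) = u * u - P * u - c Q" by (simp add: algebra_simps)
      finally show False using c[OF T, of u] by simp
    qed
  qed
qed

section \<open>Infinitely many isomorphism classes\<close>

text \<open>\<open>X ^ q - X\<close> has derivative -1, so its roots are simple, and over an
  algebraically closed field there are \<open>q\<close> of them. This gives the cardinality of the
  coefficient field built below.\<close>

lemma card_fixed_points_frobenius:
  assumes p: "prime CHAR('a :: alg_closed_field)" and q: "q = CHAR('a) ^ n" "n > 0"
  shows "card {x :: 'a. x ^ q = x} = q"
proof -
  have "q > 1" using q p by (metis one_less_power prime_gt_1_nat)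
  define P where "P = Polynomial.monom 1 q - Polynomial.monom (1 :: 'a) 1"
  have deg: "degree P = q"
    unfolding P_def using \<open>q > 1\<close>
    using Polynomial.degree_add_eq_left[of "- Polynomial.monom (1 :: 'a) 1" "Polynomial.monom 1 q"]
    by (simp add: Polynomial.degree_monom_eq)
  hence P0: "P \<noteq> 0" using \<open>q > 1\<close> by auto
  have poly_P: "poly P x = x ^ q - x" for x
    by (simp add: P_def Polynomial.poly_monom)
  have "(of_nat q :: 'a) = 0"
    using q by simp
  hence pd: "pderiv P = - 1"
    using \<open>q > 1\<close> by (simp add: P_def Polynomial.pderiv_diff Polynomial.pderiv_monom monom_0 one_pCons)
  have order_le: "Polynomial.order x P \<le> 1" for x
  proof (rule ccontr)
    assume "\<not> ?thesis"
    hence "[:- x, 1:] ^ 2 dvd P" by (simp only: order_divides) simp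
    then obtain r where "P = [:- x, 1:] ^ 2 * r" by (elim dvdE)
    hence "P = [:- x, 1:] * ([:- x, 1:] * r)"
      by (simp only: power2_eq_square mult.assoc)
    hence "poly (pderiv P) x = 0"
      by (simp add: pderiv_mult del: mult_pCons_left)
    thus False by (simp add: pd)
  qed
  obtain A where A: "size A = q" "P = Polynomial.smult (lead_coeff P) (\<Prod>x\<in>#A. [:- x, 1:])"
    using alg_closed_imp_factorization[OF P0] deg by metis
  have ord: "Polynomial.order x P = count A x" for x
  proof -
    have "Polynomial.order x P = Polynomial.order x (\<Prod>x\<in>#A. [:- x, 1:])"
      using P0 by (subst A(2)) (simp add: order_smult)
    also have "\<dots> = count A x"
    proof (induction A)
      case (add a A)
      have "(\<Prod>x\<in>#A. [:- x, 1:]) \<noteq> 0" by (auto simp: prod_mset_zero_iff)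
      hence "Polynomial.order x ([:- a, 1:] * (\<Prod>x\<in>#A. [:- x, 1:])) =
          Polynomial.order x [:- a, 1:] + Polynomial.order x (\<Prod>x\<in>#A. [:- x, 1:])"
        by (intro order_mult) (simp del: mult_pCons_left)
      moreover have "Polynomial.order x [:- a, 1:] = (if x = a then 1 else 0)"
        using order_power_n_n[of a 1] by (auto simp: order_0I)
      ultimately show ?case using add by (simp del: mult_pCons_left)
    qed (simp add: order_0I)
    finally show ?thesis .
  qed
  have "count A x \<le> 1" for x
    using order_le[of x] ord[of x] by simp
  hence "A = mset_set (set_mset A)"
    by (intro multiset_eqI) (metis count_eq_zero_iff count_mset_set(1,3) finite_set_mset le_antisym
        less_one linorder_not_le)
  moreover have "set_mset A = {x. x ^ q = x}"
  proof -
    have "x \<in># A \<longleftrightarrow> x ^ q = x" for x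
      using ord[of x] order_root[of P x] P0 by (simp add: poly_P count_eq_zero_iff [symmetric])
    thus ?thesis by auto
  qed
  ultimately show ?thesis
    using A(1) by (metis size_mset_set)
qed

lemma places_iso:
  assumes R: "Ring.field R" and S: "Ring.field S" and h: "h \<in> ring_iso R S"
  shows "places S = (`) h ` places R"
proof (intro equalityI subsetI)
  fix V' assume V': "V' \<in> places S"
  let ?g = "inv_into (carrier R) h"
  have "?g ` V' \<in> places R"
    using ring_iso_set_sym[OF _ h] R by (intro place_image(1)[OF S R _ V']) (simp add: field_def domain_def cring_def)
  moreover have "V' \<subseteq> h ` carrier R"
    using V' subringE(1)[of V' S] h by (auto simp: places_def ring_iso_def bij_betw_def)
  hence "h ` ?g ` V' = V'" by (rule image_inv_into_cancel[OF refl])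
  ultimately show "V' \<in> (`) h ` places R" by (metis image_eqI)
qed (use place_image(1)[OF R S h] in auto)

text \<open>The condition \<open>d > 1\<close> leaves out the infinite place, which has norm
  \<open>q\<close> in every field of the family.\<close>

definition odd_place_degree :: "nat \<Rightarrow> ('a, 'b) ring_scheme \<Rightarrow> nat \<Rightarrow> bool" where
  "odd_place_degree q K d \<longleftrightarrow> odd d \<and> d > 1 \<and> (\<exists>V\<in>places K. place_norm K V = q ^ d)"

lemma odd_place_degree_iso:
  assumes "Ring.field R" "Ring.field S" "R \<simeq> S"
  shows "odd_place_degree q R d \<longleftrightarrow> odd_place_degree q S d"
proof -
  obtain h where h: "h \<in> ring_iso R S" using assms(3) by (auto simp: is_ring_iso_def)
  show ?thesis
    unfolding odd_place_degree_def places_iso[OF assms(1,2) h]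
    using place_image(2)[OF assms(1,2) h] by auto
qed

text \<open>The bound is carried over for all \<open>\<sigma> > 1\<close>, since convergence near
  \<open>s\<close> enters in addition to the estimate at \<open>Re s\<close>.\<close>

lemma zeta_star_iso_le:
  fixes R :: "('a, 'b) ring_scheme" and S :: "('c, 'd) ring_scheme" and C :: "real \<Rightarrow> real"
  assumes R: "Ring.field R" and S: "Ring.field S" and iso: "R \<simeq> S" and s: "Re s > 1"
    and ne: "\<And>V. V \<in> places R \<Longrightarrow> place_norm R V \<noteq> 1"
    and C: "\<And>\<sigma> G. \<sigma> > 1 \<Longrightarrow> finite G \<Longrightarrow> G \<subseteq> places R \<Longrightarrow>
      (\<Prod>V\<in>G. inverse (1 - real (place_norm R V) powr (- \<sigma>))) \<le> C \<sigma>"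
  shows "cmod (zeta_star S s) \<le> C (Re s)"
proof -
  obtain h where h: "h \<in> ring_iso R S" using iso by (auto simp: is_ring_iso_def)
  have inj: "inj_on ((`) h) (places R)"
  proof (rule inj_on_subset)
    show "inj_on ((`) h) (Pow (carrier R))"
      using h by (intro inj_on_image_Pow) (auto simp: ring_iso_def bij_betw_def)
    show "places R \<subseteq> Pow (carrier R)" using subringE(1) by (auto simp: places_def)
  qed
  have norm: "place_norm S (h ` V) = place_norm R V" if "V \<in> places R" for V
    using place_image(2)[OF R S h that] .
  have bound: "(\<Prod>V\<in>G. inverse (1 - real (place_norm S V) powr (- \<sigma>))) \<le> C \<sigma>"
    if \<sigma>: "\<sigma> > 1" and G: "finite G" "G \<subseteq> places S" for \<sigma> G
  proof -
    obtain G' where G': "G' \<subseteq> places R" "finite G'" "G = (`) h ` G'"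
      using finite_subset_image[OF G(1) G(2)[unfolded places_iso[OF R S h]]] by auto
    have "(\<Prod>V\<in>G. inverse (1 - real (place_norm S V) powr (- \<sigma>))) =
        (\<Prod>V\<in>G'. inverse (1 - real (place_norm R V) powr (- \<sigma>)))"
      unfolding G'(3) using G'(1) norm
      by (subst prod.reindex[OF inj_on_subset[OF inj G'(1)]]) (auto intro!: prod.cong)
    thus ?thesis using C[OF \<sigma> G'(2,1)] by simp
  qed
  show ?thesis
  proof (rule norm_zeta_star_le)
    show "place_norm S V \<noteq> 1" if "V \<in> places S" for V
      using that ne norm unfolding places_iso[OF R S h] by auto
    show "\<exists>B. \<forall>G. finite G \<longrightarrow> G \<subseteq> places S \<longrightarrow>
        (\<Prod>V\<in>G. inverse (1 - real (place_norm S V) powr (- \<sigma>))) \<le> B" if "\<sigma> > 1" for \<sigma>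
      using bound[OF that] by blast
  qed (use s bound[OF s] in auto)
qed

lemma countable_poly: "countable (UNIV :: 'k::{finite,field} poly set)"
proof -
  have "countable (\<Union>n. {g :: 'k poly. degree g \<le> n})"
    by (rule countable_UN[OF countableI_type]) (rule countable_finite[OF finite_poly_degree_le])
  moreover have "(\<Union>n. {g :: 'k poly. degree g \<le> n}) = UNIV" by auto
  ultimately show ?thesis by (simp only:)
qed

context ramified_quadratic
begin

text \<open>Countability permits a copy of \<open>K\<close> whose carrier is a set of natural
  numbers.\<close>

lemma countable_K: "countable K"
proof -
  have "F \<subseteq> (\<lambda>(u, v). emb u / emb v) ` (UNIV \<times> UNIV)"
    by (auto simp: F_def)
  moreover have "countable ((\<lambda>(u, v). emb u / emb v) ` (UNIV \<times> UNIV))"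
    by (intro countable_image countable_SIGMA countable_poly)
  ultimately have "countable F" by (rule countable_subset)
  hence "countable ((\<lambda>(a, b). a + b * y) ` (F \<times> F))"
    by (intro countable_image countable_SIGMA)
  moreover have "K = (\<lambda>(a, b). a + b * y) ` (F \<times> F)" by (auto simp: K_def)
  ultimately show ?thesis by simp
qed

text \<open>The infinite place has degree 1 and places over inert primes have even degree. The
  remaining primes, \<open>P\<close> included, have degree above \<open>n\<close>, and the degree of
  a place over them is at least as large.\<close>

lemma odd_place_degree_greater:
  assumes P: "degree P > n"
    and inert: "\<And>Q u. prime Q \<Longrightarrow> Q \<noteq> P \<Longrightarrow> degree Q \<le> n \<Longrightarrow> \<not> Q dvd u * u - h * u - f"
    and d: "odd_place_degree CARD('k) (set_ring K) d"
  shows "d > n"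
proof -
  obtain V where V: "V \<in> places (set_ring K)" "place_norm (set_ring K) V = CARD('k) ^ d"
    and d': "odd d" "d > 1"
    using d by (auto simp: odd_place_degree_def)
  have q: "CARD('k) \<ge> 2" by (rule card_field_ge_2)
  have V': "valuation_ring K V" "V \<noteq> K" using V(1) places_set_ring[OF K] by auto
  show ?thesis
  proof (rule place_cases[OF V'])
    assume "V = W_inf"
    hence "CARD('k) ^ d = CARD('k) ^ 1" using V(2) place_norm_infinity by simp
    hence "d = 1" using q by (subst (asm) power_inject_exp) auto
    thus ?thesis using d' by simp
  next
    fix Q assume Q: "prime Q" "V \<inter> F = local_ring Q"
    show ?thesis
    proof (cases "degree Q \<le> n")
      case True
      hence "Q \<noteq> P" using P by auto
      hence "place_norm (set_ring K) V = poly_norm Q ^ 2"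
        using inert[OF Q(1) _ True] by (intro place_norm_inert[OF Q(1) V'(1) Q(2)]) auto
      hence "CARD('k) ^ d = CARD('k) ^ (degree Q * 2)"
        using V(2) by (simp add: poly_norm_def power_mult)
      hence "d = degree Q * 2" using q by (subst (asm) power_inject_exp) auto
      thus ?thesis using d' by simp
    next
      case False
      have "place_norm (set_ring K) V \<noteq> 0" using V(2) q by simp
      hence "CARD('k) ^ degree Q \<le> CARD('k) ^ d"
        using place_norm_ge[OF Q(1) V'(1) Q(2)] V(2) by (simp add: poly_norm_def)
      hence "degree Q \<le> d" using q by (subst (asm) power_increasing_iff) auto
      thus ?thesis using False by simp
    qed
  qed
qed

end

text \<open>In the algebraic closure of the fraction field the quadratic equation has a
  root.\<close>

lemma poly_embedding_alg_closure:
  "poly_embedding (\<lambda>p :: 'k::{finite_field,field_gcd} poly. to_ac (Fraction_Field.Fract p 1))"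
  by unfold_locales (simp_all add: One_fract_def Zero_fract_def eq_fract flip: to_ac_add to_ac_mult)

lemma ex_function_field_odd_place_degrees:
  fixes n :: nat and s :: complex
  defines "q \<equiv> CARD('k::{finite_field,field_gcd})"
  assumes s: "Re s > 1"
  obtains S :: "nat ring" where "function_field q S"
    "cmod (zeta_star S s) \<le> 1 / ((1 - real q powr (- Re s)) * (1 - real q powr (1 - Re s))\<^sup>2)"
    "\<exists>d. odd_place_degree q S d" "\<And>d. odd_place_degree q S d \<Longrightarrow> d > n"
proof -
  define emb where "emb p = to_ac (Fraction_Field.Fract p 1)" for p :: "'k poly"
  interpret poly_embedding emb
    unfolding emb_def by (rule poly_embedding_alg_closure)
  \<comment> \<open>\<open>Suc n\<close> instead of \<open>n\<close> ensures
    \<open>degree P > 1\<close> even for \<open>n = 0\<close>, as \<open>odd_place_degree\<close>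
    demands.\<close>
  obtain P :: "'k poly" where P: "prime P" "odd (degree P)" "degree P > Suc n"
    using ex_prime_odd_degree_greater[of "Suc n"] by blast
  obtain f g where f: "odd (degree f)" "2 * degree P < degree f"
    "f = P * g" "\<not> P dvd g"
    and inert: "\<And>Q u. prime Q \<Longrightarrow> Q \<noteq> P \<Longrightarrow> degree Q \<le> n \<Longrightarrow> \<not> Q dvd u * u - P * u - f"
    using ex_quadratic_data[OF P(1), of n] by blast
  obtain y where "poly [:- emb f, - emb P, 1:] y = 0"
    using alg_closed_imp_poly_has_root[of "[:- emb f, - emb P, 1:]"] by auto
  hence yy: "y * y = emb P * y + emb f" by (simp add: algebra_simps)
  interpret ramified_quadratic emb y P f
    by unfold_locales (use yy f in auto)
  obtain \<phi> :: "'k poly fract alg_closure \<Rightarrow> nat" where \<phi>: "inj_on \<phi> K"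
    using countable_K by (auto simp: countable_def)
  define S where "S = image_ring \<phi> (set_ring K)"
  interpret R: Ring.field "set_ring K" by (rule field_set_ring[OF K])
  have iso: "\<phi> \<in> ring_iso (set_ring K) S"
    unfolding S_def using \<phi> by (intro inj_imp_image_ring_iso) simp
  have S: "Ring.field S"
    unfolding S_def using \<phi> by (intro R.inj_imp_image_ring_is_field) simp
  have iso': "set_ring K \<simeq> S" using iso by (auto simp: is_ring_iso_def)
  note opd = odd_place_degree_iso[OF R.field_axioms S iso']
  show thesis
  proof (rule that[of S])
    show "function_field q S" unfolding q_def by (rule function_field_image[OF S iso])
    show "cmod (zeta_star S s) \<le> 1 / ((1 - real q powr (- Re s)) * (1 - real q powr (1 - Re s))\<^sup>2)"
      unfolding q_def
      by (rule zeta_star_iso_le[OF R.field_axioms S iso' s place_norm_neq_1 euler_product_le])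
    obtain V where "valuation_ring K V" "V \<noteq> K" "place_norm (set_ring K) V = poly_norm P"
      using eisenstein_place[OF P(1) dvd_refl f(3,4)] .
    hence "odd_place_degree q (set_ring K) (degree P)"
      using P places_set_ring[OF K] by (auto simp: odd_place_degree_def q_def poly_norm_def)
    thus "\<exists>d. odd_place_degree q S d" unfolding opd by blast
    show "d > n" if "odd_place_degree q S d" for d
      using odd_place_degree_greater[of n P d] P(3) inert that unfolding opd [symmetric] q_def by auto
  qed
qed

lemma not_northcott_CARD:
  fixes s :: complex and B :: real
  defines "q \<equiv> CARD('k::{finite_field,field_gcd})"
  assumes s: "Re s > 1" and B: "B \<ge> 1 / ((1 - real q powr (- Re s)) * (1 - real q powr (1 - Re s))\<^sup>2)"
  shows "\<not> northcott_property q s B"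
proof
  assume "northcott_property q s B"
  hence fin: "finite (northcott_set q s B)" by (simp add: northcott_property_def)
  \<comment> \<open>Being invariant under isomorphism, the least odd degree belongs to the class.
    Finitely many classes would give it a maximum \<open>n\<close>, which the field constructed for
    this \<open>n\<close> exceeds.\<close>
  define m where "m C = (LEAST d. \<exists>S\<in>C. odd_place_degree q S d)" for C :: "nat ring set"
  define n where "n = Max (m ` northcott_set q s B)"
  obtain S :: "nat ring" where S: "function_field q S"
    "cmod (zeta_star S s) \<le> 1 / ((1 - real q powr (- Re s)) * (1 - real q powr (1 - Re s))\<^sup>2)"
    "\<exists>d. odd_place_degree q S d" "\<And>d. odd_place_degree q S d \<Longrightarrow> d > n"
    using ex_function_field_odd_place_degrees[where 'k = 'k, OF s, of n] unfolding q_def by blast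
  define C where "C = iso_class q S"
  have "C \<in> northcott_set q s B"
    using S(1,2) B unfolding northcott_set_def C_def function_fields_def by auto
  hence "m C \<le> n" unfolding n_def using fin by (intro Max_ge) auto
  have field: "Ring.field S'" if "S' \<in> C" for S'
    using that by (auto simp: C_def iso_class_def function_fields_def function_field_def)
  have SC: "S \<in> C" using S(1) by (auto simp: C_def iso_class_def function_fields_def ring_iso_refl)
  hence "\<exists>d. \<exists>S\<in>C. odd_place_degree q S d" using S(3) by blast
  hence "\<exists>S\<in>C. odd_place_degree q S (m C)" unfolding m_def by (rule LeastI_ex)
  then obtain S' where S': "S' \<in> C" "odd_place_degree q S' (m C)" by blast
  have "S \<simeq> S'" using S'(1) by (simp add: C_def iso_class_def)
  hence "odd_place_degree q S (m C)"
    using odd_place_degree_iso[OF field[OF SC] field[OF S'(1)]] S'(2) by simp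
  thus False using S(4) \<open>m C \<le> n\<close> by fastforce
qed

text \<open>\<open>s\<close> and \<open>B\<close> are bound here, so that the choice made below
  concerns \<open>q\<close> alone.\<close>

definition northcott_counterexample :: "nat \<Rightarrow> bool" where
  "northcott_counterexample q \<longleftrightarrow> primepow q \<and> (\<exists>s B. Re s > 1 \<and>
     B \<ge> 1 / ((1 - real q powr (- Re s)) * (1 - real q powr (1 - Re s))\<^sup>2) \<and> northcott_property q s B)"

text \<open>
  The fields above have coefficients in a type, but a type cannot depend on the variable \<open>q\<close>.
  It can depend on a constant; so the type of coefficients is built for one fixed hypothetical
  counterexample \<open>q\<close> (or for 2, if there is none).
\<close>
definition counter_q :: nat where
  "counter_q = (if \<exists>q. northcott_counterexample q then SOME q. northcott_counterexample q else 2)"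

lemma counter_q: "northcott_counterexample q \<Longrightarrow> northcott_counterexample counter_q"
  unfolding counter_q_def by (auto intro: someI)

lemma primepow_counter_q: "primepow counter_q"
proof (cases "\<exists>q. northcott_counterexample q")
  case True
  thus ?thesis using counter_q by (auto simp: northcott_counterexample_def)
next
  case False
  have "primepow (2 :: nat)" by (intro primepow_prime) simp
  thus ?thesis using False by (simp add: counter_q_def)
qed

lemma prime_aprimedivisor_counter_q: "prime (aprimedivisor counter_q)"
  using primepow_gt_Suc_0[OF primepow_counter_q] by (intro prime_aprimedivisor') auto

text \<open>A type of prime cardinality, from which \<open>mod_ring\<close> makes the prime
  field.\<close>

typedef counter_p = "{..<aprimedivisor counter_q}"
  using prime_gt_0_nat[OF prime_aprimedivisor_counter_q] by auto

lemma CARD_counter_p: "CARD(counter_p) = aprimedivisor counter_q"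
  using type_definition.card[OF type_definition_counter_p] by simp

instance counter_p :: prime_card
  by standard (simp add: CARD_counter_p prime_aprimedivisor_counter_q)

lemma counter_q_power: "\<exists>n>0. counter_q = CHAR(counter_p mod_ring alg_closure) ^ n"
proof -
  obtain p k where pk: "prime p" "k > 0" "counter_q = p ^ k"
    using primepow_counter_q unfolding primepow_def by blast
  have "p = CHAR(counter_p mod_ring alg_closure)"
    unfolding CHAR_alg_closure semiring_char_mod_ring CARD_counter_p pk(3)
    using aprimedivisor_prime_power[OF pk(1,2)] by simp
  thus ?thesis using pk by blast
qed

lemma prime_CHAR_counter_p: "prime CHAR(counter_p mod_ring alg_closure)"
  by (simp add: CARD_counter_p prime_aprimedivisor_counter_q)

lemma counter_q_pos: "counter_q > 0"
  using primepow_gt_Suc_0[OF primepow_counter_q] by simp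

lemma frobenius_add:
  fixes a b :: "counter_p mod_ring alg_closure"
  shows "(a + b) ^ counter_q = a ^ counter_q + b ^ counter_q"
  using counter_q_power freshmans_dream'[OF prime_CHAR_counter_p] by blast

lemma frobenius_uminus:
  fixes a :: "counter_p mod_ring alg_closure"
  shows "(- a) ^ counter_q = - (a ^ counter_q)"
  using frobenius_add[of a "- a"] counter_q_pos by (simp add: eq_neg_iff_add_eq_0 add.commute power_0_left)

text \<open>The field with \<open>counter_q\<close> elements, as the fixed points of a power of
  Frobenius in an algebraic closure of the prime field.\<close>

typedef counter_field = "{a :: counter_p mod_ring alg_closure. a ^ counter_q = a}"
  by (rule exI[of _ 0]) (simp add: counter_q_pos power_0_left)

setup_lifting type_definition_counter_field

instantiation counter_field :: field
begin

lift_definition zero_counter_field :: counter_field is 0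
  by (simp add: counter_q_pos power_0_left)

lift_definition one_counter_field :: counter_field is 1
  by simp

lift_definition plus_counter_field :: "counter_field \<Rightarrow> counter_field \<Rightarrow> counter_field" is "(+)"
  by (simp add: frobenius_add)

lift_definition uminus_counter_field :: "counter_field \<Rightarrow> counter_field" is uminus
  by (simp add: frobenius_uminus)

lift_definition minus_counter_field :: "counter_field \<Rightarrow> counter_field \<Rightarrow> counter_field" is "(-)"
  using frobenius_add[of _ "- _"] by (simp add: frobenius_uminus)

lift_definition times_counter_field :: "counter_field \<Rightarrow> counter_field \<Rightarrow> counter_field" is "(*)"
  by (simp add: power_mult_distrib)

lift_definition inverse_counter_field :: "counter_field \<Rightarrow> counter_field" is inverse
  by (simp add: power_inverse)

lift_definition divide_counter_field :: "counter_field \<Rightarrow> counter_field \<Rightarrow> counter_field" is "(/)"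
  by (simp add: power_divide)

instance
  by standard (transfer; simp add: algebra_simps divide_inverse)+

end

lemma CARD_counter_field: "CARD(counter_field) = counter_q"
proof -
  obtain n where n: "counter_q = CHAR(counter_p mod_ring alg_closure) ^ n" "n > 0"
    using counter_q_power by blast
  show ?thesis
    unfolding type_definition.card[OF type_definition_counter_field]
    by (rule card_fixed_points_frobenius[OF prime_CHAR_counter_p n])
qed

instance counter_field :: finite_field
  by (rule finite_fieldI, rule card_ge_0_finite) (simp add: CARD_counter_field counter_q_pos)

text \<open>The trivial Euclidean structure of a field, on the way to the class
  \<open>field_gcd\<close>, through which polynomials over it obtain gcds and prime
  factorizations.\<close>

instantiation counter_field ::
  "{unique_euclidean_ring, normalization_euclidean_semiring, normalization_semidom_multiplicative}"
begin

definition [simp]: "normalize_counter_field = (normalize_field :: counter_field \<Rightarrow> _)"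
definition [simp]: "unit_factor_counter_field = (unit_factor_field :: counter_field \<Rightarrow> _)"
definition [simp]: "modulo_counter_field = (mod_field :: counter_field \<Rightarrow> _)"
definition [simp]: "euclidean_size_counter_field = (euclidean_size_field :: counter_field \<Rightarrow> _)"
definition [simp]: "division_segment (a :: counter_field) = 1"

instance
  by standard (simp_all add: dvd_field_iff field_split_simps split: if_splits)

end

instantiation counter_field :: euclidean_ring_gcd
begin

definition gcd_counter_field :: "counter_field \<Rightarrow> counter_field \<Rightarrow> counter_field" where
  "gcd_counter_field = Euclidean_Algorithm.gcd"
definition lcm_counter_field :: "counter_field \<Rightarrow> counter_field \<Rightarrow> counter_field" where
  "lcm_counter_field = Euclidean_Algorithm.lcm"
definition Gcd_counter_field :: "counter_field set \<Rightarrow> counter_field" where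
  "Gcd_counter_field = Euclidean_Algorithm.Gcd"
definition Lcm_counter_field :: "counter_field set \<Rightarrow> counter_field" where
  "Lcm_counter_field = Euclidean_Algorithm.Lcm"

instance
  by standard (simp_all add: gcd_counter_field_def lcm_counter_field_def
    Gcd_counter_field_def Lcm_counter_field_def)

end

instance counter_field :: field_gcd ..

theorem theorem4p6:
  fixes q :: nat and s :: complex and \<sigma> B :: real
  assumes "primepow q"
    and "\<sigma> = Re s" and "\<sigma> > 1"
    and "B \<ge> 1 / ((1 - real q powr (- \<sigma>)) * (1 - real q powr (1 - \<sigma>))\<^sup>2)"
  shows "\<not> northcott_property q s B"
proof
  assume "northcott_property q s B"
  hence "northcott_counterexample q"
    using assms unfolding northcott_counterexample_def by blast
  \<comment> \<open>\<open>counter_q\<close> may differ from the given \<open>q\<close>, but it is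
    then a counterexample too, and one for which a coefficient type exists.\<close>
  hence "northcott_counterexample counter_q" by (rule counter_q)
  then obtain s' B' where "Re s' > 1" "northcott_property counter_q s' B'"
    "B' \<ge> 1 / ((1 - real counter_q powr (- Re s')) * (1 - real counter_q powr (1 - Re s'))\<^sup>2)"
    by (auto simp: northcott_counterexample_def)
  thus False
    using not_northcott_CARD[where 'k = counter_field, of s' B'] by (simp add: CARD_counter_field)
qed

end
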